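(* Let $M$ be a real analytic manifold of dimension $n\geq 3$ and let $f:M\to \mathbb{R}$ be a (not necessarily continuous) function. Assume that $f|_N$ is real analytic for every real analytic submanifold $N\subset M$ that is homeomorphic to the 2-sphere $\mathbb{S}^2$. Then $f$ is real analytic on $M$. *)

theory Defs
  imports "HOL-Analysis.Analysis"
begin

text \<open>
  Euclidean model spaces are the coordinate subspaces \<open>span B\<close> of a Euclidean space, for
  \<open>B \<subseteq> Basis\<close>: \<open>B = Basis\<close> gives the whole space, and a set \<open>B\<close> of \<open>k\<close> basis vectors gives the
  copy of \<open>k\<close>-space inside it.  In this way a manifold and its submanifolds of all
  dimensions are instances of the same definitions.

  A function is real analytic on the open set \<open>W\<close> if near each point of \<open>W\<close> it is the sum of a
  power series in the coordinates \<open>b \<in> B\<close>; the extensional functions \<open>B \<rightarrow>\<^sub>E UNIV\<close> are the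
  multi-indices.
\<close>

definition real_analytic_on ::
    "'e::euclidean_space set \<Rightarrow> ('e \<Rightarrow> 'f::real_normed_vector) \<Rightarrow> 'e set \<Rightarrow> bool" where
  "real_analytic_on B g W \<longleftrightarrow>
     openin (top_of_set (span B)) W \<and>
     (\<forall>a\<in>W. \<exists>(c :: ('e \<Rightarrow> nat) \<Rightarrow> 'f) r. 0 < r \<and>
        (\<forall>x \<in> W \<inter> ball a r.
           ((\<lambda>\<alpha>. (\<Prod>b\<in>B. ((x - a) \<bullet> b) ^ \<alpha> b) *\<^sub>R c \<alpha>) has_sum g x) (B \<rightarrow>\<^sub>E UNIV)))"

type_synonym ('a, 'e) atlas = "('a set \<times> ('a \<Rightarrow> 'e)) set"

definition chart :: "'e::euclidean_space set \<Rightarrow> 'a topology \<Rightarrow> 'a set \<Rightarrow> ('a \<Rightarrow> 'e) \<Rightarrow> bool" where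
  "chart B X U \<phi> \<longleftrightarrow>
     openin X U \<and> openin (top_of_set (span B)) (\<phi> ` U) \<and>
     homeomorphic_map (subtopology X U) (top_of_set (\<phi> ` U)) \<phi>"

definition analytically_compatible ::
    "'e::euclidean_space set \<Rightarrow> 'a set \<Rightarrow> ('a \<Rightarrow> 'e) \<Rightarrow> 'a set \<Rightarrow> ('a \<Rightarrow> 'e) \<Rightarrow> bool" where
  "analytically_compatible B U \<phi> V \<psi> \<longleftrightarrow>
     real_analytic_on B (\<psi> \<circ> inv_into U \<phi>) (\<phi> ` (U \<inter> V)) \<and>
     real_analytic_on B (\<phi> \<circ> inv_into V \<psi>) (\<psi> ` (U \<inter> V))"

definition analytic_atlas ::
    "'e::euclidean_space set \<Rightarrow> 'a topology \<Rightarrow> ('a, 'e) atlas \<Rightarrow> bool" where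
  "analytic_atlas B X A \<longleftrightarrow>
     (\<forall>(U, \<phi>)\<in>A. chart B X U \<phi>) \<and>
     (\<Union>(U, \<phi>)\<in>A. U) = topspace X \<and>
     (\<forall>(U, \<phi>)\<in>A. \<forall>(V, \<psi>)\<in>A. analytically_compatible B U \<phi> V \<psi>)"

definition analytic_manifold ::
    "'e::euclidean_space set \<Rightarrow> 'a topology \<Rightarrow> ('a, 'e) atlas \<Rightarrow> bool" where
  "analytic_manifold B X A \<longleftrightarrow>
     Hausdorff_space X \<and> second_countable X \<and> analytic_atlas B X A"

definition maximal_atlas ::
    "'e::euclidean_space set \<Rightarrow> 'a topology \<Rightarrow> ('a, 'e) atlas \<Rightarrow> ('a, 'e) atlas" where
  "maximal_atlas B X A =
     {(U, \<phi>). chart B X U \<phi> \<and> (\<forall>(V, \<psi>)\<in>A. analytically_compatible B U \<phi> V \<psi>)}"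

definition analytic_function ::
    "'e::euclidean_space set \<Rightarrow> ('a, 'e) atlas \<Rightarrow> ('a \<Rightarrow> real) \<Rightarrow> bool" where
  "analytic_function B A f \<longleftrightarrow>
     (\<forall>(U, \<phi>)\<in>A. real_analytic_on B (f \<circ> inv_into U \<phi>) (\<phi> ` U))"

text \<open>
  The charts induced on \<open>N\<close> by the charts of the ambient manifold \<open>(X, A)\<close> that
  flatten \<open>N\<close> onto the coordinate subspace \<open>span B\<close>.
\<close>

definition slice_atlas ::
    "'e::euclidean_space set \<Rightarrow> 'a topology \<Rightarrow> ('a, 'e) atlas \<Rightarrow> 'a set \<Rightarrow> ('a, 'e) atlas" where
  "slice_atlas B X A N =
     {(U \<inter> N, \<phi>) | U \<phi>. (U, \<phi>) \<in> maximal_atlas Basis X A \<and> \<phi> ` (U \<inter> N) = \<phi> ` U \<inter> span B}"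

text \<open>
  A submanifold of dimension \<open>card B\<close>, embedded (it carries the subspace topology).
\<close>

definition analytic_submanifold ::
    "'e::euclidean_space set \<Rightarrow> 'a topology \<Rightarrow> ('a, 'e) atlas \<Rightarrow> 'a set \<Rightarrow> bool" where
  "analytic_submanifold B X A N \<longleftrightarrow>
     B \<subseteq> Basis \<and> N \<subseteq> topspace X \<and> (\<Union>(W, \<phi>)\<in>slice_atlas B X A N. W) = N"

end

theory Submission
  imports Defs "HOL-Complex_Analysis.Cauchy_Integral_Formula" "HOL-Computational_Algebra.Polynomial"
begin

text \<open>
  Work in a chart near \<open>x\<^sub>0\<close>.  Inversion at a point \<open>q\<close> near \<open>x\<^sub>0\<close> turns the \<open>2\<close>-spheres through
  \<open>q\<close> into affine planes, so in the inverted coordinates \<open>f\<close> becomes a function \<open>h\<close> that is analytic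
  on every plane through \<open>0\<close> that avoids the direction of \<open>q\<close> by a fixed angle.  Restricting to
  such planes shows that the \<open>k\<close>-th Taylor coefficient \<open>a\<^sub>k(v)\<close> of \<open>t \<mapsto> h(t v)\<close> is, on an open set of \<open>v\<close>,
  a polynomial of degree at most \<open>k\<close> in each coordinate.  By Baire, \<open>\<bar>a\<^sub>k\<bar> \<le> m\<^bsup>k+1\<^esup>\<close> on some box, and
  Lagrange interpolation turns this into a bound on the coefficients of \<open>a\<^sub>k\<close>.  Hence \<open>F = \<Sum>\<^sub>k a\<^sub>k\<close> is
  analytic near \<open>0\<close> and equals \<open>h\<close> on an open cone.  Back in the chart, \<open>f\<close> agrees with an analytic
  function \<open>G\<close> on an open set close to \<open>x\<^sub>0\<close>.  Any point near \<open>x\<^sub>0\<close> is joined to that open set by a small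
  sphere, on which both \<open>f\<close> and \<open>G\<close> are analytic, so \<open>f = G\<close> near \<open>x\<^sub>0\<close>.
\<close>

section \<open>Power series with absolutely summable coefficients\<close>

text \<open>Two obstacles shape the argument. First, \<open>f\<close> need not be continuous, so no
  estimate on the planes is uniform in the direction. The Taylor coefficients, however, are
  polynomial in each coordinate with degree at most k, hence equal to their own interpolants and
  continuous, even though \<open>h\<close> may not be. Baire is therefore applied to the
  coefficients and never to \<open>h\<close>. The bounds may lose a factor \<open>C ^ k\<close>:
  interpolation at equally spaced nodes costs only that much, and homogeneity of degree k absorbs it
  on a smaller box. Second, a sphere through \<open>q\<close> with diameter vector \<open>m\<close>
  becomes the plane z . m = 1, at distance 1/|m| from the origin. Spheres that fit into the chart
  give only planes that keep away from that origin, so planes through the image of the base point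
  may be used only for an open set of directions. This yields agreement on a cone and not on a
  neighbourhood, and it is why a second family of small spheres has to carry the equality back to
  the point itself.\<close>

definition monomial :: "'i set \<Rightarrow> ('i \<Rightarrow> 'x \<Rightarrow> real) \<Rightarrow> ('i \<Rightarrow> nat) \<Rightarrow> 'x \<Rightarrow> real" where
  "monomial I u \<alpha> x = (\<Prod>i\<in>I. u i x ^ \<alpha> i)"

text \<open>\<open>K\<close> bounds a weighted l1 norm of the coefficients. This norm is
  submultiplicative and dominates the supremum over the box, so products and substitutions come with
  explicit bounds. The coordinates \<open>u\<close> are arbitrary functions, which lets the same
  rules serve shifted coordinates.\<close>

definition pseries ::
    "'i set \<Rightarrow> 'x set \<Rightarrow> ('i \<Rightarrow> 'x \<Rightarrow> real) \<Rightarrow> real \<Rightarrow> real \<Rightarrow> ('x \<Rightarrow> real) \<Rightarrow> bool" where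
  "pseries I D u r K g \<longleftrightarrow>
     (\<exists>c L. ((\<lambda>\<alpha>. \<bar>c \<alpha>\<bar> * r ^ sum \<alpha> I) has_sum L) (I \<rightarrow>\<^sub>E UNIV) \<and> L \<le> K \<and>
        (\<forall>x\<in>D. ((\<lambda>\<alpha>. c \<alpha> * monomial I u \<alpha> x) has_sum g x) (I \<rightarrow>\<^sub>E UNIV)))"

lemma pseries_mono: "pseries I D u r K g \<Longrightarrow> K \<le> K' \<Longrightarrow> pseries I D u r K' g"
  unfolding pseries_def by (meson order_trans)

lemma pseries_cong: "pseries I D u r K g \<Longrightarrow> (\<And>x. x \<in> D \<Longrightarrow> g x = g' x) \<Longrightarrow> pseries I D u r K g'"
  unfolding pseries_def by simp

lemma pseries_subset: "pseries I D u r K g \<Longrightarrow> D' \<subseteq> D \<Longrightarrow> pseries I D' u r K g"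
  unfolding pseries_def by (meson subsetD)

lemma summable_on_fibre:
  fixes d :: "'s \<Rightarrow> real"
  assumes "r > 0" and "(\<lambda>s. \<bar>d s\<bar> * r ^ sum (E s) I) summable_on S"
  shows "(\<lambda>s. \<bar>d s\<bar>) summable_on {s\<in>S. E s = \<gamma>}"
proof -
  have "(\<lambda>s. \<bar>d s\<bar> * r ^ sum (E s) I) summable_on {s\<in>S. E s = \<gamma>}"
    using assms(2) by (rule summable_on_subset) auto
  then have "(\<lambda>s. \<bar>d s\<bar> * r ^ sum \<gamma> I) summable_on {s\<in>S. E s = \<gamma>}"
    by (rule summable_on_cong[THEN iffD1, rotated]) auto
  then have "(\<lambda>s. \<bar>d s\<bar> * r ^ sum \<gamma> I * inverse (r ^ sum \<gamma> I)) summable_on {s\<in>S. E s = \<gamma>}"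
    by (rule summable_on_cmult_left)
  then show ?thesis using assms(1) by (simp add: mult.assoc)
qed

text \<open>Absolute convergence allows regrouping an arbitrarily indexed sum of monomials by
  exponent. Collecting equal exponents can only decrease the weighted l1 norm, by the triangle
  inequality on each fibre of \<open>E\<close>.\<close>

lemma pseries_family:
  fixes d :: "'s \<Rightarrow> real" and E :: "'s \<Rightarrow> 'i \<Rightarrow> nat"
  assumes r: "r > 0"
    and E: "\<And>s. s \<in> S \<Longrightarrow> E s \<in> I \<rightarrow>\<^sub>E UNIV"
    and L: "((\<lambda>s. \<bar>d s\<bar> * r ^ sum (E s) I) has_sum L) S"
    and g: "\<And>x. x \<in> D \<Longrightarrow> ((\<lambda>s. d s * monomial I u (E s) x) has_sum g x) S"
  shows "pseries I D u r L g"
proof -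
  define fib where "fib \<gamma> = {s\<in>S. E s = \<gamma>}" for \<gamma>
  define c where "c \<gamma> = infsum d (fib \<gamma>)" for \<gamma>
  have bij: "bij_betw snd (Sigma (I \<rightarrow>\<^sub>E UNIV) fib) S"
    using E by (intro bij_betwI'[of _ snd]) (auto simp: fib_def)
  have abs_fib: "(\<lambda>s. \<bar>d s\<bar>) summable_on fib \<gamma>" for \<gamma>
    unfolding fib_def using summable_on_fibre[OF r has_sum_imp_summable[OF L]] .
  have d_fib: "(d has_sum c \<gamma>) (fib \<gamma>)" for \<gamma>
    unfolding c_def using abs_fib[of \<gamma>]
    by (intro has_sum_infsum, intro abs_summable_summable[where f = d]) simp
  have sums: "((\<lambda>\<gamma>. c \<gamma> * monomial I u \<gamma> x) has_sum g x) (I \<rightarrow>\<^sub>E UNIV)" if "x \<in> D" for x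
  proof (rule has_sum_SigmaD)
    have "((\<lambda>p. d (snd p) * monomial I u (E (snd p)) x) has_sum g x) (Sigma (I \<rightarrow>\<^sub>E UNIV) fib)"
      using g[OF that] has_sum_reindex_bij_betw[OF bij] by fast
    then show "((\<lambda>p. d (snd p) * monomial I u (fst p) x) has_sum g x) (Sigma (I \<rightarrow>\<^sub>E UNIV) fib)"
      by (rule has_sum_cong[THEN iffD1, rotated]) (auto simp: fib_def)
    show "((\<lambda>s. d (snd (\<gamma>, s)) * monomial I u (fst (\<gamma>, s)) x) has_sum c \<gamma> * monomial I u \<gamma> x) (fib \<gamma>)" for \<gamma>
      using has_sum_cmult_left[OF d_fib] by simp
  qed
  have absL: "((\<lambda>\<gamma>. infsum (\<lambda>s. \<bar>d s\<bar>) (fib \<gamma>) * r ^ sum \<gamma> I) has_sum L) (I \<rightarrow>\<^sub>E UNIV)"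
  proof (rule has_sum_SigmaD)
    have "((\<lambda>p. \<bar>d (snd p)\<bar> * r ^ sum (E (snd p)) I) has_sum L) (Sigma (I \<rightarrow>\<^sub>E UNIV) fib)"
      using L has_sum_reindex_bij_betw[OF bij] by fast
    then show "((\<lambda>p. \<bar>d (snd p)\<bar> * r ^ sum (fst p) I) has_sum L) (Sigma (I \<rightarrow>\<^sub>E UNIV) fib)"
      by (rule has_sum_cong[THEN iffD1, rotated]) (auto simp: fib_def)
    show "((\<lambda>s. \<bar>d (snd (\<gamma>, s))\<bar> * r ^ sum (fst (\<gamma>, s)) I) has_sum
        infsum (\<lambda>s. \<bar>d s\<bar>) (fib \<gamma>) * r ^ sum \<gamma> I) (fib \<gamma>)" for \<gamma>
      using has_sum_cmult_left[OF has_sum_infsum[OF abs_fib]] by simp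
  qed
  have le: "\<bar>c \<gamma>\<bar> * r ^ sum \<gamma> I \<le> infsum (\<lambda>s. \<bar>d s\<bar>) (fib \<gamma>) * r ^ sum \<gamma> I" for \<gamma>
    using norm_has_sum_bound[OF _ d_fib[of \<gamma>], of "infsum (\<lambda>s. \<bar>d s\<bar>) (fib \<gamma>)"]
      has_sum_infsum[OF abs_fib[of \<gamma>]] r by (intro mult_right_mono) auto
  have summ: "(\<lambda>\<gamma>. \<bar>c \<gamma>\<bar> * r ^ sum \<gamma> I) summable_on (I \<rightarrow>\<^sub>E UNIV)"
    using has_sum_imp_summable[OF absL] by (rule summable_on_comparison_test) (use le r in auto)
  show ?thesis
    unfolding pseries_def
    using has_sum_infsum[OF summ] has_sum_mono[OF has_sum_infsum[OF summ] absL le] sums by blast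
qed

lemma monomial_bound:
  assumes "\<And>i. i \<in> I \<Longrightarrow> \<bar>u i x\<bar> \<le> r"
  shows "\<bar>monomial I u \<alpha> x\<bar> \<le> r ^ sum \<alpha> I"
proof -
  have "\<bar>monomial I u \<alpha> x\<bar> = (\<Prod>i\<in>I. \<bar>u i x\<bar> ^ \<alpha> i)"
    unfolding monomial_def by (simp add: abs_prod power_abs)
  also have "\<dots> \<le> (\<Prod>i\<in>I. r ^ \<alpha> i)"
    using assms by (intro prod_mono) (auto intro: power_mono)
  also have "\<dots> = r ^ sum \<alpha> I" by (simp add: power_sum)
  finally show ?thesis .
qed

lemma pseries_bound:
  assumes r: "r > 0" and u: "\<And>x i. x \<in> D \<Longrightarrow> i \<in> I \<Longrightarrow> \<bar>u i x\<bar> \<le> r"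
    and g: "pseries I D u r K g" and x: "x \<in> D"
  shows "\<bar>g x\<bar> \<le> K"
proof -
  obtain c L where cL: "((\<lambda>\<alpha>. \<bar>c \<alpha>\<bar> * r ^ sum \<alpha> I) has_sum L) (I \<rightarrow>\<^sub>E UNIV)" "L \<le> K"
      "((\<lambda>\<alpha>. c \<alpha> * monomial I u \<alpha> x) has_sum g x) (I \<rightarrow>\<^sub>E UNIV)"
    using g x unfolding pseries_def by blast
  have le: "norm (c \<alpha> * monomial I u \<alpha> x) \<le> \<bar>c \<alpha>\<bar> * r ^ sum \<alpha> I" for \<alpha>
    using monomial_bound[of I u x r \<alpha>] u[OF x] by (simp add: abs_mult mult_left_mono)
  have "(\<lambda>\<alpha>. norm (c \<alpha> * monomial I u \<alpha> x)) summable_on (I \<rightarrow>\<^sub>E UNIV)"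
    using has_sum_imp_summable[OF cL(1)] le by (rule summable_on_comparison_test) auto
  from norm_has_sum_bound[OF has_sum_infsum[OF this] cL(3)]
    has_sum_mono[OF has_sum_infsum[OF this] cL(1) le] cL(2)
  show ?thesis by simp
qed

text \<open>Infinite sums, products and compositions are all instances of this closure property.\<close>

lemma pseries_infsum:
  assumes r: "r > 0"
    and u: "\<And>x i. x \<in> D \<Longrightarrow> i \<in> I \<Longrightarrow> \<bar>u i x\<bar> \<le> r"
    and h: "\<And>k. k \<in> S \<Longrightarrow> pseries I D u r (K k) (h k)"
    and K: "(K has_sum L) S"
    and g: "\<And>x. x \<in> D \<Longrightarrow> ((\<lambda>k. h k x) has_sum g x) S"
  shows "pseries I D u r L g"
proof -
  let ?M = "I \<rightarrow>\<^sub>E (UNIV :: nat set)"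
  have "\<forall>k\<in>S. \<exists>c l. ((\<lambda>\<alpha>. \<bar>c \<alpha>\<bar> * r ^ sum \<alpha> I) has_sum l) ?M \<and> l \<le> K k \<and>
        (\<forall>x\<in>D. ((\<lambda>\<alpha>. c \<alpha> * monomial I u \<alpha> x) has_sum h k x) ?M)"
    using h unfolding pseries_def by blast
  from bchoice[OF this] obtain c where
    "\<forall>k\<in>S. \<exists>l. ((\<lambda>\<alpha>. \<bar>c k \<alpha>\<bar> * r ^ sum \<alpha> I) has_sum l) ?M \<and> l \<le> K k \<and>
        (\<forall>x\<in>D. ((\<lambda>\<alpha>. c k \<alpha> * monomial I u \<alpha> x) has_sum h k x) ?M)" ..
  from bchoice[OF this] obtain l where cl: "\<And>k. k \<in> S \<Longrightarrow> ((\<lambda>\<alpha>. \<bar>c k \<alpha>\<bar> * r ^ sum \<alpha> I) has_sum l k) ?M"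
      and lK: "\<And>k. k \<in> S \<Longrightarrow> l k \<le> K k"
      and ch: "\<And>k x. k \<in> S \<Longrightarrow> x \<in> D \<Longrightarrow> ((\<lambda>\<alpha>. c k \<alpha> * monomial I u \<alpha> x) has_sum h k x) ?M"
    by blast
  have l0: "0 \<le> l k" if "k \<in> S" for k
    using cl[OF that] by (rule has_sum_nonneg) (use r in auto)
  have lsum: "l summable_on S"
    using has_sum_imp_summable[OF K] lK l0 by (rule summable_on_comparison_test)
  have lL: "infsum l S \<le> L"
    using has_sum_mono[OF has_sum_infsum[OF lsum] K lK] .
  have abs: "(\<lambda>p. \<bar>c (fst p) (snd p)\<bar> * r ^ sum (snd p) I) summable_on (S \<times> ?M)"
    by (rule summable_on_SigmaI[where g = l]) (use cl lsum r in auto)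
  have "pseries I D u r (infsum l S) g"
  proof (rule pseries_family[where S = "S \<times> ?M" and d = "\<lambda>p. c (fst p) (snd p)" and E = snd])
    show "((\<lambda>p. \<bar>c (fst p) (snd p)\<bar> * r ^ sum (snd p) I) has_sum infsum l S) (S \<times> ?M)"
      by (rule has_sum_SigmaI[where g = l]) (use cl lsum abs in auto)
    show "((\<lambda>p. c (fst p) (snd p) * monomial I u (snd p) x) has_sum g x) (S \<times> ?M)" if x: "x \<in> D" for x
    proof (rule has_sum_SigmaI[where g = "\<lambda>k. h k x"])
      have "(\<lambda>p. norm (c (fst p) (snd p) * monomial I u (snd p) x)) summable_on (S \<times> ?M)"
      proof (rule summable_on_comparison_test)
        show "(\<lambda>p. \<bar>c (fst p) (snd p)\<bar> * r ^ sum (snd p) I) summable_on (S \<times> ?M)" by (rule abs)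
        show "norm (c (fst p) (snd p) * monomial I u (snd p) x) \<le> \<bar>c (fst p) (snd p)\<bar> * r ^ sum (snd p) I" for p
          using monomial_bound[where I=I and u=u and x=x and r=r and \<alpha>="snd p"] u[OF x]
          by (simp add: abs_mult mult_left_mono)
      qed simp
      then show "(\<lambda>p. c (fst p) (snd p) * monomial I u (snd p) x) summable_on (S \<times> ?M)"
        by (rule abs_summable_summable)
    qed (use ch x g in auto)
  qed (use r in auto)
  then show ?thesis using lL by (rule pseries_mono)
qed

lemma pseries_cmult:
  assumes "pseries I D u r K g"
  shows "pseries I D u r (\<bar>a\<bar> * K) (\<lambda>x. a * g x)"
proof -
  obtain c L where c: "((\<lambda>\<alpha>. \<bar>c \<alpha>\<bar> * r ^ sum \<alpha> I) has_sum L) (I \<rightarrow>\<^sub>E UNIV)" "L \<le> K"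
      "\<And>x. x\<in>D \<Longrightarrow> ((\<lambda>\<alpha>. c \<alpha> * monomial I u \<alpha> x) has_sum g x) (I \<rightarrow>\<^sub>E UNIV)"
    using assms unfolding pseries_def by blast
  show ?thesis
    unfolding pseries_def
  proof (intro exI[of _ "\<lambda>\<alpha>. a * c \<alpha>"] exI[of _ "\<bar>a\<bar> * L"] conjI ballI)
    show "((\<lambda>\<alpha>. \<bar>a * c \<alpha>\<bar> * r ^ sum \<alpha> I) has_sum \<bar>a\<bar> * L) (I \<rightarrow>\<^sub>E UNIV)"
      using has_sum_cmult_right[OF c(1), of "\<bar>a\<bar>"] by (simp add: abs_mult mult.assoc)
    show "((\<lambda>\<alpha>. a * c \<alpha> * monomial I u \<alpha> x) has_sum a * g x) (I \<rightarrow>\<^sub>E UNIV)" if "x \<in> D" for x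
      using has_sum_cmult_right[OF c(3)[OF that], of a] by (simp add: mult.assoc)
  qed (use c(2) in \<open>auto intro: mult_left_mono\<close>)
qed

lemma pseries_monomial:
  assumes "finite I" "r > 0" "\<alpha> \<in> I \<rightarrow>\<^sub>E UNIV"
  shows "pseries I D u r (r ^ sum \<alpha> I) (monomial I u \<alpha>)"
  by (rule pseries_family[where S = "{()}" and d = "\<lambda>_. 1" and E = "\<lambda>_. \<alpha>"])
     (use assms in \<open>auto intro!: has_sum_finiteI\<close>)

lemma pseries_one: "finite I \<Longrightarrow> r > 0 \<Longrightarrow> pseries I D u r 1 (\<lambda>_. 1)"
  using pseries_monomial[of I r "\<lambda>i\<in>I. 0" D u] by (simp add: monomial_def[abs_def])

lemma pseries_const: "finite I \<Longrightarrow> r > 0 \<Longrightarrow> pseries I D u r \<bar>a\<bar> (\<lambda>_. a)"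
  using pseries_cmult[OF pseries_one, of I r D u a] by simp

lemma pseries_coord:
  assumes "finite I" "r > 0" "i \<in> I"
  shows "pseries I D u r r (u i)"
proof -
  define \<alpha> where "\<alpha> = (\<lambda>j\<in>I. if j = i then (1::nat) else 0)"
  have "monomial I u \<alpha> = u i"
  proof
    fix x
    have "monomial I u \<alpha> x = (\<Prod>j\<in>I. if j = i then u i x else 1)"
      unfolding monomial_def by (intro prod.cong) (auto simp: \<alpha>_def)
    then show "monomial I u \<alpha> x = u i x" using assms by simp
  qed
  moreover have "sum \<alpha> I = 1"
    using assms by (simp add: \<alpha>_def)
  ultimately show ?thesis
    using pseries_monomial[of I r \<alpha> D u] assms by (simp add: \<alpha>_def)
qed

text \<open>Multiplying by one monomial shifts all exponents and scales the norm by
  \<open>r ^ sum \<alpha> I\<close>. Summing this over the expansion of the first factor gives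
  submultiplicativity.\<close>

lemma pseries_mult:
  assumes fin: "finite I" and r: "r > 0"
    and u: "\<And>x i. x \<in> D \<Longrightarrow> i \<in> I \<Longrightarrow> \<bar>u i x\<bar> \<le> r"
    and g: "pseries I D u r K g" and h: "pseries I D u r L h"
  shows "pseries I D u r (K * L) (\<lambda>x. g x * h x)"
proof -
  let ?M = "I \<rightarrow>\<^sub>E (UNIV :: nat set)"
  obtain c K' where c: "((\<lambda>\<alpha>. \<bar>c \<alpha>\<bar> * r ^ sum \<alpha> I) has_sum K') ?M" "K' \<le> K"
      "\<And>x. x\<in>D \<Longrightarrow> ((\<lambda>\<alpha>. c \<alpha> * monomial I u \<alpha> x) has_sum g x) ?M"
    using g unfolding pseries_def by blast
  obtain d L' where d: "((\<lambda>\<alpha>. \<bar>d \<alpha>\<bar> * r ^ sum \<alpha> I) has_sum L') ?M" "L' \<le> L"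
      "\<And>x. x\<in>D \<Longrightarrow> ((\<lambda>\<alpha>. d \<alpha> * monomial I u \<alpha> x) has_sum h x) ?M"
    using h unfolding pseries_def by blast
  have L'0: "L' \<ge> 0" and K'0: "K' \<ge> 0"
    using has_sum_nonneg[OF d(1)] has_sum_nonneg[OF c(1)] r by auto
  have one: "pseries I D u r (r ^ sum \<alpha> I * L') (\<lambda>x. monomial I u \<alpha> x * h x)" if \<alpha>: "\<alpha> \<in> ?M" for \<alpha>
  proof (rule pseries_family[where S = ?M and d = d and E = "\<lambda>\<beta>. \<lambda>i\<in>I. \<alpha> i + \<beta> i"])
    show "((\<lambda>\<beta>. \<bar>d \<beta>\<bar> * r ^ (\<Sum>i\<in>I. (\<lambda>i\<in>I. \<alpha> i + \<beta> i) i)) has_sum r ^ sum \<alpha> I * L') ?M"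
      using has_sum_cmult_right[OF d(1), of "r ^ sum \<alpha> I"]
      by (simp add: sum.distrib power_add mult_ac)
    show "((\<lambda>\<beta>. d \<beta> * monomial I u (\<lambda>i\<in>I. \<alpha> i + \<beta> i) x) has_sum monomial I u \<alpha> x * h x) ?M"
      if "x \<in> D" for x
      using has_sum_cmult_right[OF d(3)[OF that], of "monomial I u \<alpha> x"]
      by (simp add: monomial_def power_add prod.distrib mult_ac)
  qed (use r in auto)
  have "pseries I D u r (K' * L') (\<lambda>x. g x * h x)"
  proof (rule pseries_infsum[where S = ?M and K = "\<lambda>\<alpha>. \<bar>c \<alpha>\<bar> * (r ^ sum \<alpha> I * L')"
        and h = "\<lambda>\<alpha> x. c \<alpha> * (monomial I u \<alpha> x * h x)"])
    show "((\<lambda>\<alpha>. \<bar>c \<alpha>\<bar> * (r ^ sum \<alpha> I * L')) has_sum K' * L') ?M"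
      using has_sum_cmult_left[OF c(1), of L'] by (simp add: mult.assoc)
    show "((\<lambda>\<alpha>. c \<alpha> * (monomial I u \<alpha> x * h x)) has_sum g x * h x) ?M" if "x \<in> D" for x
      using has_sum_cmult_left[OF c(3)[OF that], of "h x"] by (simp add: mult.assoc)
  qed (use r u one in \<open>auto intro!: pseries_cmult\<close>)
  then show ?thesis
    by (rule pseries_mono) (use c(2) d(2) L'0 K'0 in \<open>auto intro: mult_mono\<close>)
qed

lemma pseries_sum:
  assumes r: "r > 0" and u: "\<And>x i. x \<in> D \<Longrightarrow> i \<in> I \<Longrightarrow> \<bar>u i x\<bar> \<le> r"
    and "finite S" "\<And>k. k \<in> S \<Longrightarrow> pseries I D u r (K k) (h k)"
  shows "pseries I D u r (sum K S) (\<lambda>x. \<Sum>k\<in>S. h k x)"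
  by (rule pseries_infsum[where S = S and K = K and h = h]) (use assms in auto)

lemma pseries_add:
  assumes r: "r > 0" and u: "\<And>x i. x \<in> D \<Longrightarrow> i \<in> I \<Longrightarrow> \<bar>u i x\<bar> \<le> r"
    and "pseries I D u r K g" "pseries I D u r L h"
  shows "pseries I D u r (K + L) (\<lambda>x. g x + h x)"
  using pseries_sum[where S = "{True, False}" and K = "\<lambda>b. if b then K else L"
      and h = "\<lambda>b. if b then g else h" and I = I and D = D and u = u and r = r] assms by auto

lemma pseries_prod:
  assumes fin: "finite I" and r: "r > 0" and u: "\<And>x i. x \<in> D \<Longrightarrow> i \<in> I \<Longrightarrow> \<bar>u i x\<bar> \<le> r"
    and "finite S" "\<And>k. k \<in> S \<Longrightarrow> pseries I D u r (K k) (h k)"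
  shows "pseries I D u r (prod K S) (\<lambda>x. \<Prod>k\<in>S. h k x)"
  using assms(4,5)
proof (induction S rule: finite_induct)
  case empty
  then show ?case using pseries_one[OF fin r] by simp
next
  case (insert k S)
  then show ?case
    using pseries_mult[where I = I and D = D and u = u and K = "K k" and g = "h k" and L = "prod K S"] fin r u
    by simp
qed

lemma pseries_power:
  assumes "finite I" "r > 0" "\<And>x i. x \<in> D \<Longrightarrow> i \<in> I \<Longrightarrow> \<bar>u i x\<bar> \<le> r" "pseries I D u r K h"
  shows "pseries I D u r (K ^ n) (\<lambda>x. h x ^ n)"
  using pseries_prod[where S = "{..<n}" and K = "\<lambda>_. K" and h = "\<lambda>_. h" and I=I and r=r and D=D and u=u]
    assms by simp

lemma pseries_nonneg:
  assumes "r > 0" "pseries I D u r K h"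
  shows "0 \<le> K"
proof -
  obtain c L where "((\<lambda>\<alpha>. \<bar>c \<alpha>\<bar> * r ^ sum \<alpha> I) has_sum L) (I \<rightarrow>\<^sub>E UNIV)" "L \<le> K"
    using assms unfolding pseries_def by blast
  then show ?thesis
    using has_sum_nonneg assms(1) by fastforce
qed

text \<open>If every inner coordinate has norm at most \<open>\<rho>\<close>, submultiplicativity
  gives each inner monomial norm at most \<open>\<rho> ^ sum \<alpha> J\<close>. The weighted sum
  that bounds \<open>G\<close> then bounds the composition, with the same constant.\<close>

lemma pseries_compose:
  assumes fin: "finite I" "finite J" and r: "r > 0" and \<rho>: "\<rho> > 0"
    and u: "\<And>x i. x \<in> D \<Longrightarrow> i \<in> I \<Longrightarrow> \<bar>u i x\<bar> \<le> r"
    and h: "\<And>j. j \<in> J \<Longrightarrow> pseries I D u r \<rho> (\<lambda>x. v j (\<theta> x))"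
    and G: "pseries J (\<theta> ` D) v \<rho> K G"
  shows "pseries I D u r K (\<lambda>x. G (\<theta> x))"
proof -
  let ?M = "J \<rightarrow>\<^sub>E (UNIV :: nat set)"
  obtain c K' where c: "((\<lambda>\<alpha>. \<bar>c \<alpha>\<bar> * \<rho> ^ sum \<alpha> J) has_sum K') ?M" "K' \<le> K"
      "\<And>x. x\<in>D \<Longrightarrow> ((\<lambda>\<alpha>. c \<alpha> * monomial J v \<alpha> (\<theta> x)) has_sum G (\<theta> x)) ?M"
    using G unfolding pseries_def by blast
  have "pseries I D u r K' (\<lambda>x. G (\<theta> x))"
  proof (rule pseries_infsum[where S = ?M and K = "\<lambda>\<alpha>. \<bar>c \<alpha>\<bar> * \<rho> ^ sum \<alpha> J"
        and h = "\<lambda>\<alpha> x. c \<alpha> * monomial J v \<alpha> (\<theta> x)"])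
    show "pseries I D u r (\<bar>c \<alpha>\<bar> * \<rho> ^ sum \<alpha> J) (\<lambda>x. c \<alpha> * monomial J v \<alpha> (\<theta> x))" for \<alpha>
    proof (rule pseries_cmult)
      have "pseries I D u r (\<Prod>j\<in>J. \<rho> ^ \<alpha> j) (\<lambda>x. \<Prod>j\<in>J. v j (\<theta> x) ^ \<alpha> j)"
        by (intro pseries_prod pseries_power fin r u h)
      then show "pseries I D u r (\<rho> ^ sum \<alpha> J) (\<lambda>x. monomial J v \<alpha> (\<theta> x))"
        by (simp add: power_sum monomial_def)
    qed
  qed (use r u c in auto)
  then show ?thesis by (rule pseries_mono) (use c in auto)
qed

lemma pseries_shrink:
  assumes "r > 0" "0 < s" "s \<le> 1" and "pseries I D u r K g" "D' \<subseteq> D"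
  shows "pseries I D' u (s * r) K g"
proof -
  let ?M = "I \<rightarrow>\<^sub>E (UNIV :: nat set)"
  obtain c K' where c: "((\<lambda>\<alpha>. \<bar>c \<alpha>\<bar> * r ^ sum \<alpha> I) has_sum K') ?M" "K' \<le> K"
      "\<And>x. x\<in>D \<Longrightarrow> ((\<lambda>\<alpha>. c \<alpha> * monomial I u \<alpha> x) has_sum g x) ?M"
    using assms unfolding pseries_def by blast
  have le: "\<bar>c \<alpha>\<bar> * (s * r) ^ sum \<alpha> I \<le> \<bar>c \<alpha>\<bar> * r ^ sum \<alpha> I" for \<alpha>
    using assms by (intro mult_left_mono power_mono) (auto simp: mult_le_cancel_right1)
  have "(\<lambda>\<alpha>. \<bar>c \<alpha>\<bar> * (s * r) ^ sum \<alpha> I) summable_on ?M"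
    using has_sum_imp_summable[OF c(1)] le by (rule summable_on_comparison_test) (use assms in auto)
  from has_sum_infsum[OF this] has_sum_mono[OF this[THEN has_sum_infsum] c(1) le] c(2,3) assms(5)
  show ?thesis unfolding pseries_def by (meson order_trans subsetD)
qed

text \<open>Without a constant term every monomial has degree at least 1, so shrinking the radius by
  \<open>s\<close> gains a factor \<open>s\<close> in the norm. This is how inner functions are made
  small enough for a substitution.\<close>

lemma pseries_shrink_zero:
  assumes fin: "finite I" and "r > 0" "0 < s" "s \<le> 1" and "pseries I D u r K g" "D' \<subseteq> D"
    and a: "a \<in> D" "g a = 0" "\<And>i. i \<in> I \<Longrightarrow> u i a = 0"
  shows "pseries I D' u (s * r) (s * K) g"
proof -
  let ?M = "I \<rightarrow>\<^sub>E (UNIV :: nat set)"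
  obtain c K' where c: "((\<lambda>\<alpha>. \<bar>c \<alpha>\<bar> * r ^ sum \<alpha> I) has_sum K') ?M" "K' \<le> K"
      "\<And>x. x\<in>D \<Longrightarrow> ((\<lambda>\<alpha>. c \<alpha> * monomial I u \<alpha> x) has_sum g x) ?M"
    using assms unfolding pseries_def by blast
  define z where "z = (\<lambda>i\<in>I. 0::nat)"
  have zM: "z \<in> ?M" by (auto simp: z_def)
  have sum_pos: "sum \<alpha> I > 0" if "\<alpha> \<in> ?M" "\<alpha> \<noteq> z" for \<alpha>
  proof (rule ccontr)
    assume "\<not> sum \<alpha> I > 0"
    then have "\<forall>i\<in>I. \<alpha> i = 0" using fin by simp
    with that(1) have "\<alpha> = z" by (auto simp: z_def PiE_def extensional_def restrict_def)
    with that(2) show False by simp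
  qed
  \<comment> \<open>At the centre only the zero multi-index \<open>z\<close> survives, so
    \<open>c z\<close> equals \<open>g a\<close>, which is 0.\<close>
  have "c \<alpha> * monomial I u \<alpha> a = (if \<alpha> = z then c z else 0)" if "\<alpha> \<in> ?M" for \<alpha>
  proof (cases "\<alpha> = z")
    case True
    then show ?thesis by (simp add: monomial_def z_def)
  next
    case False
    then obtain i where "i \<in> I" "\<alpha> i > 0"
      using sum_pos[of \<alpha>] \<open>\<alpha> \<in> ?M\<close> fin
      by (metis bot_nat_0.not_eq_extremum sum.neutral)
    then have "monomial I u \<alpha> a = 0"
      using fin a(3) by (auto simp: monomial_def intro!: prod_zero)
    then show ?thesis using False by simp
  qed
  then have "((\<lambda>\<alpha>. if \<alpha> = z then c z else 0) has_sum g a) ?M"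
    using c(3)[OF a(1)] by (rule has_sum_cong[THEN iffD1])
  moreover have "((\<lambda>\<alpha>. if \<alpha> = z then c z else 0) has_sum c z) ?M"
    by (rule has_sum_finite_neutralI[of "{z}"]) (use zM in auto)
  ultimately have cz: "c z = 0" using has_sum_unique a(2) by metis
  have le: "\<bar>c \<alpha>\<bar> * (s * r) ^ sum \<alpha> I \<le> s * (\<bar>c \<alpha>\<bar> * r ^ sum \<alpha> I)" if "\<alpha> \<in> ?M" for \<alpha>
  proof (cases "\<alpha> = z")
    case False
    then have "s ^ sum \<alpha> I \<le> s ^ 1"
      using assms sum_pos[OF that] by (intro power_decreasing) auto
    then have "\<bar>c \<alpha>\<bar> * r ^ sum \<alpha> I * s ^ sum \<alpha> I \<le> \<bar>c \<alpha>\<bar> * r ^ sum \<alpha> I * s"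
      using assms by (intro mult_left_mono) auto
    then show ?thesis by (simp add: power_mult_distrib mult_ac)
  qed (use cz in auto)
  have S: "((\<lambda>\<alpha>. s * (\<bar>c \<alpha>\<bar> * r ^ sum \<alpha> I)) has_sum s * K') ?M"
    using c(1) by (rule has_sum_cmult_right)
  have "(\<lambda>\<alpha>. \<bar>c \<alpha>\<bar> * (s * r) ^ sum \<alpha> I) summable_on ?M"
    using has_sum_imp_summable[OF S] le by (rule summable_on_comparison_test) (use assms in auto)
  note H = has_sum_infsum[OF this]
  have "infsum (\<lambda>\<alpha>. \<bar>c \<alpha>\<bar> * (s * r) ^ sum \<alpha> I) ?M \<le> s * K"
    using has_sum_mono[OF H S le] c(2) assms by (smt (verit) mult_left_mono)
  with H c(3) assms(6) show ?thesis unfolding pseries_def by (meson subsetD)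
qed

section \<open>Real analyticity at a point\<close>

definition coord_box :: "'e::euclidean_space set \<Rightarrow> 'e \<Rightarrow> real \<Rightarrow> 'e set" where
  "coord_box B a r = {x \<in> span B. \<forall>b\<in>B. \<bar>(x - a) \<bullet> b\<bar> \<le> r}"

text \<open>A bound for one radius implies the same bound for all smaller ones. Stating it for
  eventually all radii gives finitely many functions a common box without bookkeeping.\<close>

definition real_analytic_at :: "'e::euclidean_space set \<Rightarrow> 'e \<Rightarrow> ('e \<Rightarrow> real) \<Rightarrow> bool" where
  "real_analytic_at B a g \<longleftrightarrow>
     (\<exists>K. \<forall>\<^sub>F r in at_right 0. pseries B (coord_box B a r) (\<lambda>b x. (x - a) \<bullet> b) r K g)"

lemma eventually_at_right_0: "0 < (d::real) \<Longrightarrow> (\<And>r. 0 < r \<Longrightarrow> r \<le> d \<Longrightarrow> P r) \<Longrightarrow> \<forall>\<^sub>F r in at_right 0. P r"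
  by (rule eventually_at_rightI[of 0 d]) auto

lemma eventually_at_right_0E:
  assumes "\<forall>\<^sub>F r in at_right (0::real). P r"
  obtains r where "0 < r" "P r"
proof -
  obtain d where "d > 0" "\<And>r. 0 < r \<Longrightarrow> r < d \<Longrightarrow> P r"
    using assms unfolding eventually_at_right_field by auto
  then show ?thesis using that[of "d/2"] by auto
qed

lemma coord_box_mono: "r \<le> r' \<Longrightarrow> coord_box B a r \<subseteq> coord_box B a r'"
  unfolding coord_box_def by force

lemma coord_box_bound: "x \<in> coord_box B a r \<Longrightarrow> b \<in> B \<Longrightarrow> \<bar>(x - a) \<bullet> b\<bar> \<le> r"
  unfolding coord_box_def by auto

lemma real_analytic_atI:
  assumes "0 < r" "pseries B (coord_box B a r) (\<lambda>b x. (x - a) \<bullet> b) r K g"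
  shows "real_analytic_at B a g"
proof -
  have "pseries B (coord_box B a s) (\<lambda>b x. (x - a) \<bullet> b) s K g" if "0 < s" "s \<le> r" for s
    using pseries_shrink[OF assms(1) _ _ assms(2), of "s / r" "coord_box B a s"] that assms(1)
      coord_box_mono[of s r B a] by auto
  then show ?thesis
    unfolding real_analytic_at_def by (intro exI[of _ K] eventually_at_right_0[OF assms(1)])
qed

lemma real_analytic_atE:
  assumes "real_analytic_at B a g"
  obtains K where "K > 0" "\<forall>\<^sub>F r in at_right 0. 0 < r \<and> pseries B (coord_box B a r) (\<lambda>b x. (x - a) \<bullet> b) r K g"
proof -
  obtain K where "\<forall>\<^sub>F r in at_right 0. pseries B (coord_box B a r) (\<lambda>b x. (x - a) \<bullet> b) r K g"
    using assms unfolding real_analytic_at_def by blast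
  then have "\<forall>\<^sub>F r in at_right 0. 0 < r \<and> pseries B (coord_box B a r) (\<lambda>b x. (x - a) \<bullet> b) r (max K 1) g"
    using eventually_at_right_less[of "0::real"] by eventually_elim (auto elim: pseries_mono)
  then show ?thesis using that[of "max K 1"] by auto
qed

text \<open>Shrinking by the factor \<open>\<epsilon> / K\<close> brings the norm \<open>K\<close>
  below \<open>\<epsilon>\<close>, because the constant term vanishes.\<close>

lemma real_analytic_at_zero:
  assumes fin: "finite B" and a: "a \<in> span B" "g a = 0" and g: "real_analytic_at B a g" and \<epsilon>: "\<epsilon> > 0"
  shows "\<forall>\<^sub>F r in at_right 0. pseries B (coord_box B a r) (\<lambda>b x. (x - a) \<bullet> b) r \<epsilon> g"
proof -
  obtain K where K: "K > 0"
    and ev: "\<forall>\<^sub>F r in at_right 0. 0 < r \<and> pseries B (coord_box B a r) (\<lambda>b x. (x - a) \<bullet> b) r K g"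
    using real_analytic_atE[OF g] .
  obtain r where r: "0 < r" "pseries B (coord_box B a r) (\<lambda>b x. (x - a) \<bullet> b) r K g"
    using eventually_at_right_0E[OF ev] by auto
  define s0 where "s0 = min 1 (\<epsilon> / K)"
  have s0: "s0 > 0" using K \<epsilon> by (auto simp: s0_def)
  show ?thesis
  proof (rule eventually_at_right_0[of "s0 * r"])
    fix t assume t: "0 < t" "t \<le> s0 * r"
    define s where "s = t / r"
    have s: "0 < s" "s \<le> s0" "t = s * r" using t r by (auto simp: s_def field_simps)
    have s1: "s \<le> 1" "s * K \<le> \<epsilon>" using s(2) K by (auto simp: s0_def field_simps)
    have "t \<le> r" using s s1 r by simp
    have "pseries B (coord_box B a t) (\<lambda>b x. (x - a) \<bullet> b) (s * r) (s * K) g"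
      by (rule pseries_shrink_zero[OF fin r(1) s(1) s1(1) r(2) coord_box_mono[OF \<open>t \<le> r\<close>], of a])
         (use a r(1) in \<open>auto simp: coord_box_def\<close>)
    then show "pseries B (coord_box B a t) (\<lambda>b x. (x - a) \<bullet> b) t \<epsilon> g"
      using s s1(2) pseries_mono by blast
  qed (use s0 r in auto)
qed

lemma coord_box_subset_ball:
  assumes B: "B \<subseteq> Basis" and a: "a \<in> span B" and d: "d > 0"
  shows "\<forall>\<^sub>F r in at_right 0. coord_box B a r \<subseteq> ball a d"
\<comment> \<open>The Euclidean norm is at most the sum of the coordinates, hence at most
  \<open>DIM('a) * r\<close>. The extra 1 in the denominator makes the inequality strict.\<close>
proof (rule eventually_at_right_0[of "d / (DIM('a) + 1)"])
  fix r :: real assume r: "0 < r" "r \<le> d / (DIM('a) + 1)"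
  show "coord_box B a r \<subseteq> ball a d"
  proof
    fix x assume x: "x \<in> coord_box B a r"
    then have "x - a \<in> span B" using a by (auto simp: coord_box_def span_diff)
    then have z: "(x - a) \<bullet> b = 0" if "b \<in> Basis" "b \<notin> B" for b
      using span_substd_basis[OF B] that by auto
    have "norm (x - a) \<le> (\<Sum>b\<in>Basis. \<bar>(x - a) \<bullet> b\<bar>)" by (rule norm_le_l1)
    also have "\<dots> \<le> (\<Sum>b\<in>(Basis::'a set). r)"
      using x z r by (intro sum_mono) (metis abs_zero coord_box_bound less_eq_real_def)
    also have "\<dots> < d"
      using r by (simp add: field_simps)
    finally show "x \<in> ball a d" by (simp add: dist_norm norm_minus_commute)
  qed
qed (use d in auto)

lemma real_analytic_at_cong:
  assumes B: "B \<subseteq> Basis" and a: "a \<in> span B" and g: "real_analytic_at B a g" and "d > 0"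
    and eq: "\<And>x. x \<in> span B \<Longrightarrow> dist a x < d \<Longrightarrow> g x = g' x"
  shows "real_analytic_at B a g'"
proof -
  obtain K where "\<forall>\<^sub>F r in at_right 0. 0 < r \<and> pseries B (coord_box B a r) (\<lambda>b x. (x - a) \<bullet> b) r K g"
    using real_analytic_atE[OF g] .
  with coord_box_subset_ball[OF B a \<open>d > 0\<close>]
  have "\<forall>\<^sub>F r in at_right 0. pseries B (coord_box B a r) (\<lambda>b x. (x - a) \<bullet> b) r K g'"
  proof eventually_elim
    case (elim r)
    show ?case
      by (rule pseries_cong[OF conjunct2[OF elim(2)]], rule eq) (use elim(1) in \<open>auto simp: coord_box_def\<close>)
  qed
  then show ?thesis unfolding real_analytic_at_def by blast
qed

section \<open>Closure properties of analyticity at a point\<close>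

context
  fixes B :: "'e::euclidean_space set" and a :: 'e
  assumes B: "B \<subseteq> Basis" and a: "a \<in> span B"
begin

lemma finite_coords: "finite B"
  using finite_subset[OF B finite_Basis] .

lemma real_analytic_at_const: "real_analytic_at B a (\<lambda>_. c)"
  by (rule real_analytic_atI[of 1]) (auto intro: pseries_const finite_coords)

lemma real_analytic_at_add:
  assumes "real_analytic_at B a g" "real_analytic_at B a h"
  shows "real_analytic_at B a (\<lambda>x. g x + h x)"
proof -
  obtain K where K: "\<forall>\<^sub>F r in at_right 0. 0 < r \<and> pseries B (coord_box B a r) (\<lambda>b x. (x - a) \<bullet> b) r K g"
    using real_analytic_atE[OF assms(1)] .
  obtain L where "\<forall>\<^sub>F r in at_right 0. 0 < r \<and> pseries B (coord_box B a r) (\<lambda>b x. (x - a) \<bullet> b) r L h"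
    using real_analytic_atE[OF assms(2)] .
  with K have "\<forall>\<^sub>F r in at_right 0. pseries B (coord_box B a r) (\<lambda>b x. (x - a) \<bullet> b) r (K + L) (\<lambda>x. g x + h x)"
    by eventually_elim (auto intro: pseries_add dest: coord_box_bound)
  then show ?thesis unfolding real_analytic_at_def by blast
qed

lemma real_analytic_at_mult:
  assumes "real_analytic_at B a g" "real_analytic_at B a h"
  shows "real_analytic_at B a (\<lambda>x. g x * h x)"
proof -
  obtain K where K: "\<forall>\<^sub>F r in at_right 0. 0 < r \<and> pseries B (coord_box B a r) (\<lambda>b x. (x - a) \<bullet> b) r K g"
    using real_analytic_atE[OF assms(1)] .
  obtain L where "\<forall>\<^sub>F r in at_right 0. 0 < r \<and> pseries B (coord_box B a r) (\<lambda>b x. (x - a) \<bullet> b) r L h"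
    using real_analytic_atE[OF assms(2)] .
  with K have "\<forall>\<^sub>F r in at_right 0. pseries B (coord_box B a r) (\<lambda>b x. (x - a) \<bullet> b) r (K * L) (\<lambda>x. g x * h x)"
    by eventually_elim (auto intro: pseries_mult finite_coords dest: coord_box_bound)
  then show ?thesis unfolding real_analytic_at_def by blast
qed

lemma real_analytic_at_sum:
  "finite S \<Longrightarrow> (\<And>k. k \<in> S \<Longrightarrow> real_analytic_at B a (h k)) \<Longrightarrow> real_analytic_at B a (\<lambda>x. \<Sum>k\<in>S. h k x)"
  by (induction S rule: finite_induct) (auto intro: real_analytic_at_const real_analytic_at_add)

lemma real_analytic_at_prod:
  "finite S \<Longrightarrow> (\<And>k. k \<in> S \<Longrightarrow> real_analytic_at B a (h k)) \<Longrightarrow> real_analytic_at B a (\<lambda>x. \<Prod>k\<in>S. h k x)"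
  by (induction S rule: finite_induct) (auto intro: real_analytic_at_const real_analytic_at_mult)

lemma real_analytic_at_diff:
  "real_analytic_at B a g \<Longrightarrow> real_analytic_at B a h \<Longrightarrow> real_analytic_at B a (\<lambda>x. g x - h x)"
  using real_analytic_at_add[of g "\<lambda>x. (-1) * h x"] real_analytic_at_mult[OF real_analytic_at_const, of h "-1"]
  by simp

lemma real_analytic_at_coord:
  assumes "b \<in> B" shows "real_analytic_at B a (\<lambda>x. x \<bullet> b)"
proof -
  have "real_analytic_at B a (\<lambda>x. (x - a) \<bullet> b)"
    by (rule real_analytic_atI[of 1]) (auto intro: pseries_coord[where u = "\<lambda>b x. (x - a) \<bullet> b"] finite_coords assms)
  from real_analytic_at_add[OF this real_analytic_at_const[of "a \<bullet> b"]]
  show ?thesis by (simp add: inner_diff_left)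
qed

lemma real_analytic_at_linear:
  assumes f: "linear f"
  shows "real_analytic_at B a f"
proof (rule real_analytic_at_cong[OF B a, where d = 1])
  show "real_analytic_at B a (\<lambda>x. \<Sum>b\<in>B. (x \<bullet> b) * f b)"
    by (intro real_analytic_at_sum real_analytic_at_mult real_analytic_at_coord real_analytic_at_const finite_coords)
  fix x assume x: "x \<in> span B"
  have "x = (\<Sum>b\<in>Basis. (x \<bullet> b) *\<^sub>R b)" by (simp add: euclidean_representation)
  also have "\<dots> = (\<Sum>b\<in>B. (x \<bullet> b) *\<^sub>R b)"
    using B x span_substd_basis[OF B] by (intro sum.mono_neutral_right) auto
  finally have "f x = f (\<Sum>b\<in>B. (x \<bullet> b) *\<^sub>R b)" by simp
  then show "(\<Sum>b\<in>B. (x \<bullet> b) * f b) = f x"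
    using f by (simp add: linear_sum linear_scale)
qed auto

lemma real_analytic_at_inner: "real_analytic_at B a (\<lambda>x. x \<bullet> v)"
  by (rule real_analytic_at_linear) (simp add: bounded_linear.linear bounded_linear_inner_left)

text \<open>The radius \<open>\<rho>\<close> comes from \<open>G\<close>. The increment of
  \<open>\<theta>\<close> vanishes at \<open>a\<close>, so on small boxes its norm is at most
  \<open>\<rho>\<close>, and since the norm bounds the supremum, \<open>\<theta>\<close> maps such a
  box into the box where \<open>G\<close> has its expansion.\<close>

lemma real_analytic_at_compose:
  fixes \<theta> :: "'e \<Rightarrow> 'f::euclidean_space"
  assumes B': "B' \<subseteq> Basis" and d: "d > 0"
    and G: "real_analytic_at B' (\<theta> a) G" and \<theta>: "\<And>b. b \<in> B' \<Longrightarrow> real_analytic_at B a (\<lambda>x. \<theta> x \<bullet> b)"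
    and into: "\<And>x. x \<in> span B \<Longrightarrow> dist a x < d \<Longrightarrow> \<theta> x \<in> span B'"
  shows "real_analytic_at B a (\<lambda>x. G (\<theta> x))"
proof -
  have fin': "finite B'" using finite_subset[OF B' finite_Basis] .
  obtain K where "\<forall>\<^sub>F r in at_right 0. 0 < r \<and> pseries B' (coord_box B' (\<theta> a) r) (\<lambda>b x. (x - \<theta> a) \<bullet> b) r K G"
    using real_analytic_atE[OF G] .
  then obtain \<rho> where \<rho>: "\<rho> > 0" "pseries B' (coord_box B' (\<theta> a) \<rho>) (\<lambda>b x. (x - \<theta> a) \<bullet> b) \<rho> K G"
    using eventually_at_right_0E by blast
  have "\<forall>\<^sub>F r in at_right 0. pseries B (coord_box B a r) (\<lambda>b x. (x - a) \<bullet> b) r \<rho> (\<lambda>x. (\<theta> x - \<theta> a) \<bullet> b)"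
    if b: "b \<in> B'" for b
  proof (rule real_analytic_at_zero[OF finite_coords a])
    show "real_analytic_at B a (\<lambda>x. (\<theta> x - \<theta> a) \<bullet> b)"
      using real_analytic_at_diff[OF \<theta>[OF b] real_analytic_at_const] by (simp add: inner_diff_left)
  qed (use \<rho> in auto)
  then have "\<forall>\<^sub>F r in at_right 0. \<forall>b\<in>B'. pseries B (coord_box B a r) (\<lambda>b x. (x - a) \<bullet> b) r \<rho> (\<lambda>x. (\<theta> x - \<theta> a) \<bullet> b)"
    using fin' by (intro eventually_ball_finite) auto
  with coord_box_subset_ball[OF B a d] eventually_at_right_less[of "0::real"]
  have "\<forall>\<^sub>F r in at_right 0. pseries B (coord_box B a r) (\<lambda>b x. (x - a) \<bullet> b) r K (\<lambda>x. G (\<theta> x))"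
  proof eventually_elim
    case (elim r)
    have bd: "\<bar>(\<theta> x - \<theta> a) \<bullet> b\<bar> \<le> \<rho>" if x: "x \<in> coord_box B a r" and b: "b \<in> B'" for x b
      by (rule pseries_bound[OF elim(2) coord_box_bound bspec[OF elim(3) b] x])
    have sub: "\<theta> ` coord_box B a r \<subseteq> coord_box B' (\<theta> a) \<rho>"
    proof
      fix y assume "y \<in> \<theta> ` coord_box B a r"
      then obtain x where x: "x \<in> coord_box B a r" "y = \<theta> x" by auto
      then have "dist a x < d" "x \<in> span B" using elim(1) by (auto simp: coord_box_def)
      then show "y \<in> coord_box B' (\<theta> a) \<rho>" using into bd[OF x(1)] x(2) by (auto simp: coord_box_def)
    qed
    show ?case
      by (rule pseries_compose[OF finite_coords fin' elim(2) \<rho>(1), where v = "\<lambda>b x. (x - \<theta> a) \<bullet> b"])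
         (use elim(3) pseries_subset[OF \<rho>(2) sub] in \<open>auto simp: coord_box_bound\<close>)
  qed
  then show ?thesis unfolding real_analytic_at_def by blast
qed

end

lemma real_analytic_at_inverse_real:
  fixes c :: real
  assumes c: "c \<noteq> 0"
  shows "real_analytic_at Basis c inverse"
proof -
  \<comment> \<open>Half the distance to the pole makes the ratio of the geometric series at most
    1/2, whence the bound \<open>2 / \<bar>c\<bar>\<close>.\<close>
  define r where "r = \<bar>c\<bar> / 2"
  have r: "r > 0" using c by (simp add: r_def)
  let ?u = "\<lambda>b x :: real. (x - c) \<bullet> b"
  have "pseries Basis (coord_box Basis c r) ?u r (2 / \<bar>c\<bar>) inverse"
  proof (rule pseries_infsum[where S = "UNIV :: nat set" and K = "\<lambda>k. \<bar>(-1)^k / c^(k+1)\<bar> * r ^ k"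
        and h = "\<lambda>k x. (-1)^k / c^(k+1) * (?u 1 x) ^ k", OF r])
    show bd: "\<bar>?u b x\<bar> \<le> r" if "x \<in> coord_box Basis c r" "b \<in> Basis" for x b
      using that by (rule coord_box_bound)
    show "pseries Basis (coord_box Basis c r) ?u r (\<bar>(-1)^k / c^(k+1)\<bar> * r ^ k)
        (\<lambda>x. (-1)^k / c^(k+1) * (?u 1 x) ^ k)" for k
      by (intro pseries_cmult pseries_power pseries_coord[where u = ?u] bd r) auto
    have geo: "((\<lambda>k. z ^ k) has_sum 1 / (1 - z)) UNIV" if "\<bar>z\<bar> < 1" for z :: real
      using that by (intro norm_summable_imp_has_sum) (auto simp: power_abs geometric_sums intro!: summable_geometric)
    have "((\<lambda>k. 1 / \<bar>c\<bar> * (1/2) ^ k) has_sum 1 / \<bar>c\<bar> * 2) UNIV"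
      using geo[of "1/2"] by (intro has_sum_cmult_right) auto
    moreover have "\<bar>(-1)^k / c^(k+1)\<bar> * r ^ k = 1 / \<bar>c\<bar> * (1/2) ^ k" for k
      using c by (simp add: r_def abs_mult power_abs power_divide field_simps)
    ultimately show "((\<lambda>k. \<bar>(-1)^k / c^(k+1)\<bar> * r ^ k) has_sum 2 / \<bar>c\<bar>) UNIV" by simp
    show "((\<lambda>k. (-1)^k / c^(k+1) * (?u 1 x) ^ k) has_sum inverse x) UNIV"
      if x: "x \<in> coord_box Basis c r" for x
    proof -
      define z where "z = (c - x) / c"
      have "\<bar>x - c\<bar> \<le> r" using bd[OF x, of 1] by simp
      then have "\<bar>c - x\<bar> < \<bar>c\<bar>" using c unfolding r_def by linarith
      then have z: "\<bar>z\<bar> < 1" using c by (simp add: z_def)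
      have "((\<lambda>k. 1 / c * z ^ k) has_sum 1 / c * (1 / (1 - z))) UNIV"
        using geo[OF z] by (rule has_sum_cmult_right)
      moreover have "1 / c * z ^ k = (-1)^k / c^(k+1) * (?u 1 x) ^ k" for k
      proof -
        have "z ^ k = (-1)^k * (x - c)^k / c^k"
          unfolding power_mult_distrib[symmetric] power_divide[symmetric] by (simp add: z_def)
        then show ?thesis by simp
      qed
      moreover have "1 / c * (1 / (1 - z)) = inverse x"
        using c by (simp add: z_def field_simps)
      ultimately show ?thesis by simp
    qed
  qed
  then show ?thesis by (rule real_analytic_atI[OF r])
qed

lemma real_analytic_at_inverse:
  assumes B: "B \<subseteq> Basis" and a: "a \<in> span B" and g: "real_analytic_at B a g" and "g a \<noteq> 0"
  shows "real_analytic_at B a (\<lambda>x. inverse (g x))"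
proof (rule real_analytic_at_compose[OF B a, where B' = Basis and \<theta> = g and G = inverse and d = 1])
  show "real_analytic_at Basis (g a) inverse"
    by (rule real_analytic_at_inverse_real[OF assms(4)])
  show "g x \<in> span Basis" for x by (simp only: span_Basis UNIV_I)
qed (use g in auto)

section \<open>Comparison of the norm condition with power series expansions on open sets\<close>

lemma has_sum_sum:
  fixes f :: "'k \<Rightarrow> 's \<Rightarrow> 'f::topological_comm_monoid_add"
  shows "finite S \<Longrightarrow> (\<And>k. k \<in> S \<Longrightarrow> (f k has_sum s k) A) \<Longrightarrow> ((\<lambda>x. \<Sum>k\<in>S. f k x) has_sum sum s S) A"
  by (induction S rule: finite_induct) (auto intro: has_sum_add)

lemma real_analytic_onI:
  fixes g :: "'e::euclidean_space \<Rightarrow> 'f::euclidean_space"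
  assumes B: "B \<subseteq> Basis" and W: "openin (top_of_set (span B)) W"
    and g: "\<And>a b. a \<in> W \<Longrightarrow> b \<in> Basis \<Longrightarrow> real_analytic_at B a (\<lambda>x. g x \<bullet> b)"
  shows "real_analytic_on B g W"
  unfolding real_analytic_on_def
proof (intro conjI ballI W)
  fix a assume a: "a \<in> W"
  have WB: "W \<subseteq> span B" using W openin_imp_subset by fastforce
  have "\<forall>b\<in>Basis. \<exists>K. \<forall>\<^sub>F r in at_right 0. pseries B (coord_box B a r) (\<lambda>b x. (x - a) \<bullet> b) r K (\<lambda>x. g x \<bullet> b)"
    using g[OF a] unfolding real_analytic_at_def by simp
  from bchoice[OF this] obtain K where "\<And>b. b \<in> Basis \<Longrightarrow>
      \<forall>\<^sub>F r in at_right 0. pseries B (coord_box B a r) (\<lambda>b x. (x - a) \<bullet> b) r (K b) (\<lambda>x. g x \<bullet> b)"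
    by blast
  then have "\<forall>\<^sub>F r in at_right 0. \<forall>b\<in>Basis.
      pseries B (coord_box B a r) (\<lambda>b x. (x - a) \<bullet> b) r (K b) (\<lambda>x. g x \<bullet> b)"
    by (intro eventually_ball_finite) auto
  then obtain r where r: "r > 0"
    and ps: "\<And>b. b \<in> Basis \<Longrightarrow> pseries B (coord_box B a r) (\<lambda>b x. (x - a) \<bullet> b) r (K b) (\<lambda>x. g x \<bullet> b)"
    by (rule eventually_at_right_0E) blast
  have "\<forall>b\<in>Basis. \<exists>c. \<forall>x\<in>coord_box B a r.
      ((\<lambda>\<alpha>. c \<alpha> * monomial B (\<lambda>b x. (x - a) \<bullet> b) \<alpha> x) has_sum g x \<bullet> b) (B \<rightarrow>\<^sub>E UNIV)"
    using ps unfolding pseries_def by blast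
  from bchoice[OF this] obtain c where c: "\<And>b x. b \<in> Basis \<Longrightarrow> x \<in> coord_box B a r \<Longrightarrow>
      ((\<lambda>\<alpha>. c b \<alpha> * monomial B (\<lambda>b x. (x - a) \<bullet> b) \<alpha> x) has_sum g x \<bullet> b) (B \<rightarrow>\<^sub>E UNIV)"
    by blast
  show "\<exists>(c :: ('e \<Rightarrow> nat) \<Rightarrow> 'f) r. 0 < r \<and> (\<forall>x \<in> W \<inter> ball a r.
           ((\<lambda>\<alpha>. (\<Prod>b\<in>B. ((x - a) \<bullet> b) ^ \<alpha> b) *\<^sub>R c \<alpha>) has_sum g x) (B \<rightarrow>\<^sub>E UNIV))"
  proof (intro exI[of _ "\<lambda>\<alpha>. \<Sum>b\<in>Basis. c b \<alpha> *\<^sub>R b"] exI[of _ r] conjI ballI r)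
    fix x assume x: "x \<in> W \<inter> ball a r"
    have "\<bar>(x - a) \<bullet> b\<bar> \<le> r" if "b \<in> B" for b
      using x Basis_le_norm[of b "x - a"] that B by (auto simp: dist_norm norm_minus_commute)
    then have "x \<in> coord_box B a r" using x WB by (auto simp: coord_box_def)
    then have "((\<lambda>\<alpha>. \<Sum>b\<in>Basis. (c b \<alpha> * monomial B (\<lambda>b x. (x - a) \<bullet> b) \<alpha> x) *\<^sub>R b) has_sum
        (\<Sum>b\<in>Basis. (g x \<bullet> b) *\<^sub>R b)) (B \<rightarrow>\<^sub>E UNIV)"
      using c by (intro has_sum_sum has_sum_bounded_linear[OF bounded_linear_scaleR_left]) auto
    then show "((\<lambda>\<alpha>. (\<Prod>b\<in>B. ((x - a) \<bullet> b) ^ \<alpha> b) *\<^sub>R (\<Sum>b\<in>Basis. c b \<alpha> *\<^sub>R b)) has_sum g x) (B \<rightarrow>\<^sub>E UNIV)"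
      by (simp add: euclidean_representation monomial_def scaleR_sum_right mult.commute)
  qed
qed

text \<open>Summability of a real family over an infinite index set is absolute summability.
  Convergence at the single corner \<open>x0\<close> of a box, where every monomial equals a power
  of \<open>s\<close>, therefore already bounds the weighted coefficient sum.\<close>

lemma real_analytic_onD:
  fixes g :: "'e::euclidean_space \<Rightarrow> 'f::euclidean_space"
  assumes B: "B \<subseteq> Basis" and g: "real_analytic_on B g W" and a: "a \<in> W"
  shows "real_analytic_at B a (\<lambda>x. g x \<bullet> v)"
proof -
  let ?u = "\<lambda>b x. (x - a) \<bullet> b"
  have W: "openin (top_of_set (span B)) W" using g by (simp add: real_analytic_on_def)
  then obtain e where e: "e > 0" "ball a e \<inter> span B \<subseteq> W"
    using a by (metis openin_contains_ball)
  have aB: "a \<in> span B" using W a openin_imp_subset by fastforce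
  obtain c :: "('e \<Rightarrow> nat) \<Rightarrow> 'f" and r where r: "0 < r"
    and c: "\<And>x. x \<in> W \<inter> ball a r \<Longrightarrow>
           ((\<lambda>\<alpha>. (\<Prod>b\<in>B. ((x - a) \<bullet> b) ^ \<alpha> b) *\<^sub>R c \<alpha>) has_sum g x) (B \<rightarrow>\<^sub>E UNIV)"
    using bspec[OF conjunct2[OF g[unfolded real_analytic_on_def]] a] by blast
  have "\<forall>\<^sub>F s in at_right 0. 0 < s \<and> coord_box B a s \<subseteq> ball a (min r e)"
    using coord_box_subset_ball[OF B aB, of "min r e"] e r
    by (intro eventually_conj eventually_at_right_less) auto
  then obtain s where s: "s > 0" "coord_box B a s \<subseteq> ball a (min r e)"
    by (rule eventually_at_right_0E) blast
  have cs: "((\<lambda>\<alpha>. (c \<alpha> \<bullet> v) * monomial B ?u \<alpha> x) has_sum g x \<bullet> v) (B \<rightarrow>\<^sub>E UNIV)"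
    if x: "x \<in> coord_box B a s" for x
  proof -
    have "x \<in> ball a (min r e)" "x \<in> span B" using x s(2) by (auto simp: coord_box_def)
    then have "x \<in> W \<inter> ball a r" using e(2) by auto
    from has_sum_bounded_linear[OF bounded_linear_inner_left c[OF this], of v]
    show ?thesis by (simp add: monomial_def mult.commute)
  qed
  define x0 where "x0 = a + (\<Sum>b\<in>B. s *\<^sub>R b)"
  have fin: "finite B" using finite_subset[OF B finite_Basis] .
  have x0: "(x0 - a) \<bullet> b = s" if "b \<in> B" for b
  proof -
    have "(x0 - a) \<bullet> b = (\<Sum>b'\<in>B. s * (b' \<bullet> b))" by (simp add: x0_def inner_sum_left)
    also have "\<dots> = (\<Sum>b'\<in>B. if b' = b then s else 0)"
      using B that by (intro sum.cong) (auto simp: inner_Basis subset_iff)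
    finally show ?thesis using fin that by simp
  qed
  have "x0 \<in> span B"
    unfolding x0_def by (intro span_add[OF aB] span_sum span_scale span_base)
  then have "x0 \<in> coord_box B a s" using x0 s by (simp add: coord_box_def)
  from has_sum_imp_summable[OF cs[OF this]]
  have "(\<lambda>\<alpha>. (c \<alpha> \<bullet> v) * s ^ sum \<alpha> B) summable_on (B \<rightarrow>\<^sub>E UNIV)"
    by (simp add: monomial_def x0 power_sum)
  then have "(\<lambda>\<alpha>. norm ((c \<alpha> \<bullet> v) * s ^ sum \<alpha> B)) summable_on (B \<rightarrow>\<^sub>E UNIV)"
    by (simp only: summable_on_iff_abs_summable_on_real[symmetric])
  then have "(\<lambda>\<alpha>. \<bar>c \<alpha> \<bullet> v\<bar> * s ^ sum \<alpha> B) summable_on (B \<rightarrow>\<^sub>E UNIV)"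
    using s(1) by (simp add: abs_mult)
  from has_sum_infsum[OF this] cs
  have "pseries B (coord_box B a s) ?u s (infsum (\<lambda>\<alpha>. \<bar>c \<alpha> \<bullet> v\<bar> * s ^ sum \<alpha> B) (B \<rightarrow>\<^sub>E UNIV)) (\<lambda>x. g x \<bullet> v)"
    unfolding pseries_def by (intro exI[of _ "\<lambda>\<alpha>. c \<alpha> \<bullet> v"] exI conjI ballI) auto
  then show ?thesis by (rule real_analytic_atI[OF s(1)])
qed

section \<open>The identity theorem\<close>

lemma finite_degree_fibre: "finite I \<Longrightarrow> finite {\<alpha> \<in> I \<rightarrow>\<^sub>E (UNIV :: nat set). sum \<alpha> I = k}"
proof -
  assume I: "finite I"
  have "{\<alpha> \<in> I \<rightarrow>\<^sub>E (UNIV :: nat set). sum \<alpha> I = k} \<subseteq> I \<rightarrow>\<^sub>E {..k}"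
    using I by (auto simp: PiE_iff extensional_def intro: member_le_sum)
  then show ?thesis by (rule finite_subset) (use I in \<open>auto intro: finite_PiE\<close>)
qed

text \<open>Regrouping by total degree turns the restriction to a ray into a power series in
  \<open>\<tau>\<close> whose k-th coefficient is a homogeneous polynomial of degree k in the
  direction \<open>\<xi>\<close>.\<close>

lemma has_sum_homogeneous:
  fixes c :: "('i \<Rightarrow> nat) \<Rightarrow> real"
  assumes I: "finite I" and s: "((\<lambda>\<alpha>. c \<alpha> * (\<Prod>i\<in>I. (\<tau> * \<xi> i) ^ \<alpha> i)) has_sum s) (I \<rightarrow>\<^sub>E UNIV)"
  shows "(\<lambda>k. (\<Sum>\<alpha> | \<alpha> \<in> I \<rightarrow>\<^sub>E UNIV \<and> sum \<alpha> I = k. c \<alpha> * (\<Prod>i\<in>I. \<xi> i ^ \<alpha> i)) * \<tau> ^ k) sums s"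
proof -
  let ?M = "I \<rightarrow>\<^sub>E (UNIV :: nat set)"
  define fib where "fib k = {\<alpha> \<in> ?M. sum \<alpha> I = k}" for k
  have bij: "bij_betw snd (Sigma UNIV fib) ?M"
    by (auto simp: bij_betw_def inj_on_def fib_def image_iff)
  have "((\<lambda>k. (\<Sum>\<alpha>\<in>fib k. c \<alpha> * (\<Prod>i\<in>I. \<xi> i ^ \<alpha> i)) * \<tau> ^ k) has_sum s) UNIV"
  proof (rule has_sum_SigmaD)
    show "((\<lambda>p. c (snd p) * (\<Prod>i\<in>I. (\<tau> * \<xi> i) ^ (snd p) i)) has_sum s) (Sigma UNIV fib)"
      using s has_sum_reindex_bij_betw[OF bij, of "\<lambda>\<alpha>. c \<alpha> * (\<Prod>i\<in>I. (\<tau> * \<xi> i) ^ \<alpha> i)"] by simp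
    fix k
    have "(\<Sum>\<alpha>\<in>fib k. c \<alpha> * (\<Prod>i\<in>I. (\<tau> * \<xi> i) ^ \<alpha> i)) = (\<Sum>\<alpha>\<in>fib k. c \<alpha> * (\<Prod>i\<in>I. \<xi> i ^ \<alpha> i)) * \<tau> ^ k"
      unfolding sum_distrib_right
      by (rule sum.cong) (auto simp: fib_def power_mult_distrib prod.distrib power_sum)
    then show "((\<lambda>\<alpha>. c (snd (k, \<alpha>)) * (\<Prod>i\<in>I. (\<tau> * \<xi> i) ^ (snd (k, \<alpha>)) i)) has_sum
        (\<Sum>\<alpha>\<in>fib k. c \<alpha> * (\<Prod>i\<in>I. \<xi> i ^ \<alpha> i)) * \<tau> ^ k) (fib k)"
      using finite_degree_fibre[OF I] by (intro has_sum_finiteI) (auto simp: fib_def)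
  qed
  from has_sum_imp_sums[OF this] show ?thesis by (simp add: fib_def)
qed

lemma real_analytic_at_sums:
  fixes g :: "real \<Rightarrow> real"
  assumes "real_analytic_at Basis a g"
  obtains c r where "0 < r" "\<And>t. \<bar>t - a\<bar> < r \<Longrightarrow> (\<lambda>k. c k * (t - a) ^ k) sums g t"
proof -
  obtain K where "\<forall>\<^sub>F r in at_right 0. 0 < r \<and> pseries Basis (coord_box Basis a r) (\<lambda>b x. (x - a) \<bullet> b) r K g"
    using real_analytic_atE[OF assms] .
  then obtain r where r: "0 < r" and ps: "pseries Basis (coord_box Basis a r) (\<lambda>b x. (x - a) \<bullet> b) r K g"
    by (rule eventually_at_right_0E) blast
  then obtain c where c: "\<And>x. x \<in> coord_box Basis a r \<Longrightarrow>
      ((\<lambda>\<alpha>. c \<alpha> * monomial Basis (\<lambda>b x. (x - a) \<bullet> b) \<alpha> x) has_sum g x) (Basis \<rightarrow>\<^sub>E UNIV)"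
    unfolding pseries_def by blast
  define d where "d k = (\<Sum>\<alpha> | \<alpha> \<in> Basis \<rightarrow>\<^sub>E UNIV \<and> sum \<alpha> Basis = k. c \<alpha> * (\<Prod>i\<in>(Basis::real set). 1 ^ \<alpha> i))" for k
  have "(\<lambda>k. d k * (t - a) ^ k) sums g t" if t: "\<bar>t - a\<bar> < r" for t
  proof -
    have "t \<in> coord_box Basis a r"
      using t span_Basis[where 'a = real] by (auto simp: coord_box_def)
    from c[OF this] show ?thesis
      unfolding d_def by (intro has_sum_homogeneous) (auto simp: monomial_def)
  qed
  then show ?thesis using that r by blast
qed

text \<open>Multiplying by \<open>t - a\<close> reduces to a series that vanishes at \<open>a\<close>, as required by the isolation of zeros.\<close>

lemma powser_accumulating_zeros:
  fixes c :: "nat \<Rightarrow> real"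
  assumes r: "0 < r" and g: "\<And>t. \<bar>t - a\<bar> < r \<Longrightarrow> (\<lambda>k. c k * (t - a) ^ k) sums g t"
    and z: "\<And>s. s > 0 \<Longrightarrow> \<exists>t. t \<noteq> a \<and> \<bar>t - a\<bar> \<le> s \<and> g t = 0"
  shows "c k = 0"
proof (rule ccontr)
  assume k: "c k \<noteq> 0"
  define d where "d n = (case n of 0 \<Rightarrow> 0 | Suc m \<Rightarrow> c m)" for n
  have "(\<lambda>n. d n * (t - a) ^ n) sums ((t - a) * g t)" if "norm (t - a) < r" for t
  proof -
    have "(\<lambda>n. d (Suc n) * (t - a) ^ Suc n) sums ((t - a) * g t)"
      using sums_mult[OF g, of t "t - a"] that by (simp add: d_def mult_ac)
    from sums_Suc[OF this] show ?thesis by (simp add: d_def)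
  qed
  moreover have "d (Suc k) \<noteq> 0" using k by (simp add: d_def)
  ultimately obtain s where "0 < s" "\<And>t. t \<in> cball a s - {a} \<Longrightarrow> (t - a) * g t \<noteq> 0"
    using powser_0_nonzero[of r a d "\<lambda>t. (t - a) * g t" "Suc k"] r by auto
  with z[of s] show False by (auto simp: dist_real_def abs_minus_commute)
qed

lemma powser_coeffs_unique:
  fixes c d :: "nat \<Rightarrow> real"
  assumes "0 < r" "\<And>t. \<bar>t\<bar> < r \<Longrightarrow> (\<lambda>k. c k * t ^ k) sums g t"
    and "0 < s" "\<And>t. \<bar>t\<bar> < s \<Longrightarrow> (\<lambda>k. d k * t ^ k) sums g t"
  shows "c = d"
proof
  fix k
  have "c k - d k = 0"
  proof (rule powser_accumulating_zeros[where a = 0 and r = "min r s" and g = "\<lambda>_. 0" and c = "\<lambda>k. c k - d k"])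
    show "(\<lambda>k. (c k - d k) * (t - 0) ^ k) sums 0" if "\<bar>t - 0\<bar> < min r s" for t
      using sums_diff[OF assms(2,4), of t t] that by (simp add: left_diff_distrib)
    show "\<exists>t. t \<noteq> 0 \<and> \<bar>t - 0\<bar> \<le> s \<and> (0::real) = 0" if "s > 0" for s :: real
      using that by (intro exI[of _ s]) auto
  qed (use assms in auto)
  then show "c k = d k" by simp
qed

lemma real_analytic_accumulating_zeros:
  fixes g :: "real \<Rightarrow> real"
  assumes "real_analytic_at Basis a g" "\<And>s. s > 0 \<Longrightarrow> \<exists>t. t \<noteq> a \<and> \<bar>t - a\<bar> \<le> s \<and> g t = 0"
  obtains r where "r > 0" "\<And>t. \<bar>t - a\<bar> < r \<Longrightarrow> g t = 0"
proof -
  obtain c r where cr: "0 < r" "\<And>t. \<bar>t - a\<bar> < r \<Longrightarrow> (\<lambda>k. c k * (t - a) ^ k) sums g t"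
    by (rule real_analytic_at_sums[OF assms(1)]) blast
  have "c k = 0" for k using powser_accumulating_zeros[OF cr assms(2)] .
  then have "g t = 0" if "\<bar>t - a\<bar> < r" for t using cr(2)[OF that] sums_unique2[OF sums_zero, of "g t"] by simp
  with cr(1) that show ?thesis by blast
qed

text \<open>At the supremum \<open>T\<close> of the initial intervals on which \<open>g\<close>
  vanishes, zeros accumulate from the left. Isolation of zeros then pushes the interval beyond
  \<open>T\<close> unless \<open>T\<close> is 1.\<close>

lemma real_analytic_zero_interval:
  fixes g :: "real \<Rightarrow> real"
  assumes an: "\<And>t. 0 \<le> t \<Longrightarrow> t \<le> 1 \<Longrightarrow> real_analytic_at Basis t g"
    and \<delta>: "\<delta> > 0" "\<And>t. 0 \<le> t \<Longrightarrow> t < \<delta> \<Longrightarrow> g t = 0"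
  shows "g 1 = 0"
proof -
  define S where "S = {t\<in>{0..1}. \<forall>s\<in>{0..t}. g s = 0}"
  define T where "T = Sup S"
  define \<eta> where "\<eta> = min 1 (\<delta> / 2)"
  have \<eta>: "\<eta> \<in> S" "\<eta> > 0" using \<delta> by (auto simp: S_def \<eta>_def)
  have bdd: "bdd_above S" by (auto simp: S_def)
  have T: "\<eta> \<le> T" "T \<le> 1"
    unfolding T_def using \<eta> bdd by (auto intro!: cSup_upper cSup_least) (auto simp: S_def)
  have below: "g s = 0" if "0 \<le> s" "s < T" for s
  proof -
    obtain t where "t \<in> S" "s < t" using \<open>s < T\<close> less_cSup_iff[of S s] \<eta>(1) bdd unfolding T_def by blast
    then show ?thesis using that by (auto simp: S_def)
  qed
  obtain r where r: "r > 0" "\<And>t. \<bar>t - T\<bar> < r \<Longrightarrow> g t = 0"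
  proof (rule real_analytic_accumulating_zeros[OF an[of T]])
    \<comment> \<open>The point \<open>max 0 (T - s)\<close> lies strictly left of \<open>T\<close>
      because \<open>T\<close> is at least the positive number \<open>\<eta>\<close>.\<close>
    show "\<exists>t. t \<noteq> T \<and> \<bar>t - T\<bar> \<le> s \<and> g t = 0" if "s > 0" for s
      using below[of "max 0 (T - s)"] that T \<eta> by (intro exI[of _ "max 0 (T - s)"]) auto
  qed (use T \<eta> in auto)
  define t where "t = min 1 (T + r / 2)"
  have "g s = 0" if "0 \<le> s" "s \<le> t" for s
    using below[of s] r(2)[of s] that r(1) by (cases "s < T") (auto simp: t_def)
  then have "t \<in> S" using T \<eta> r by (auto simp: S_def t_def)
  then have "t \<le> T" unfolding T_def using bdd by (rule cSup_upper)
  then have "t = 1" using r(1) T by (auto simp: t_def min_def split: if_splits)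
  with \<open>t \<in> S\<close> show ?thesis by (auto simp: S_def)
qed

lemma real_analytic_at_affine_line:
  fixes g :: "'e::euclidean_space \<Rightarrow> real"
  assumes "real_analytic_at Basis (a + t *\<^sub>R v) g"
  shows "real_analytic_at Basis t (\<lambda>t. g (a + t *\<^sub>R v))"
proof (rule real_analytic_at_compose[where B' = Basis and d = 1 and \<theta> = "\<lambda>t. a + t *\<^sub>R v"])
  show "real_analytic_at Basis t (\<lambda>t. (a + t *\<^sub>R v) \<bullet> b)" for b
  proof -
    have "real_analytic_at Basis t (\<lambda>t. a \<bullet> b + t * (v \<bullet> b))"
      using real_analytic_at_inner[of Basis t "v \<bullet> b"] span_Basis[where 'a = real]
      by (intro real_analytic_at_add real_analytic_at_const) auto
    then show ?thesis by (simp add: inner_add_left)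
  qed
qed (use assms span_Basis[where 'a = 'e] span_Basis[where 'a = real] in auto)

lemma real_analytic_identity_segment:
  fixes f g :: "'e::euclidean_space \<Rightarrow> real"
  assumes f: "\<And>t. 0 \<le> t \<Longrightarrow> t \<le> 1 \<Longrightarrow> real_analytic_at Basis t (\<lambda>t. f (a + t *\<^sub>R (y - a)))"
    and g: "\<And>t. 0 \<le> t \<Longrightarrow> t \<le> 1 \<Longrightarrow> real_analytic_at Basis (a + t *\<^sub>R (y - a)) g"
    and U: "open U" "a \<in> U" "\<And>x. x \<in> U \<Longrightarrow> f x = g x"
  shows "f y = g y"
proof -
  obtain e where e: "e > 0" "ball a e \<subseteq> U" using U openE by blast
  have "f (a + 1 *\<^sub>R (y - a)) - g (a + 1 *\<^sub>R (y - a)) = 0"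
  proof (rule real_analytic_zero_interval[where g = "\<lambda>t. f (a + t *\<^sub>R (y - a)) - g (a + t *\<^sub>R (y - a))"])
    show "real_analytic_at Basis t (\<lambda>t. f (a + t *\<^sub>R (y - a)) - g (a + t *\<^sub>R (y - a)))" if "0 \<le> t" "t \<le> 1" for t
      using f[OF that] real_analytic_at_affine_line[OF g[OF that]] span_Basis[where 'a = real]
      by (intro real_analytic_at_diff) auto
    show "0 < e / (norm (y - a) + 1)" using e by (simp add: add_nonneg_pos)
    fix t assume t: "0 \<le> t" "t < e / (norm (y - a) + 1)"
    have "t * (norm (y - a) + 1) < e" using t by (simp add: pos_less_divide_eq add_nonneg_pos)
    then have "t * norm (y - a) < e" using t by (simp add: distrib_left)
    then have "a + t *\<^sub>R (y - a) \<in> U" using e t by (auto simp: dist_norm)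
    then show "f (a + t *\<^sub>R (y - a)) - g (a + t *\<^sub>R (y - a)) = 0" using U(3) by simp
  qed
  then show ?thesis by simp
qed

lemma real_analytic_identity:
  fixes f g :: "'e::euclidean_space \<Rightarrow> real"
  assumes C: "convex C" and f: "\<And>x. x \<in> C \<Longrightarrow> real_analytic_at Basis x f"
    and g: "\<And>x. x \<in> C \<Longrightarrow> real_analytic_at Basis x g"
    and U: "open U" "a \<in> U" "a \<in> C" "\<And>x. x \<in> U \<Longrightarrow> f x = g x" and y: "y \<in> C"
  shows "f y = g y"
proof (rule real_analytic_identity_segment[where a = a and U = U])
  have C: "a + t *\<^sub>R (y - a) \<in> C" if "0 \<le> t" "t \<le> 1" for t
    using convexD_alt[OF C U(3) y that] by (simp add: algebra_simps)
  show "real_analytic_at Basis t (\<lambda>t. f (a + t *\<^sub>R (y - a)))" if "0 \<le> t" "t \<le> 1" for t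
    by (rule real_analytic_at_affine_line) (use f C that in auto)
  show "real_analytic_at Basis (a + t *\<^sub>R (y - a)) g" if "0 \<le> t" "t \<le> 1" for t
    using g C that by auto
qed (use U in auto)

text \<open>Recentring is a substitution: with respect to the new centre \<open>y\<close>, the old
  coordinate is the new one plus a constant and has norm at most
  \<open>s + \<bar>(y - a) \<bullet> b\<bar>\<close>, which stays below \<open>r\<close>.\<close>

lemma pseries_imp_real_analytic_at:
  fixes F :: "'e::euclidean_space \<Rightarrow> real"
  assumes F: "pseries Basis (coord_box Basis a r) (\<lambda>b x. (x - a) \<bullet> b) r K F"
    and y: "\<And>b. b \<in> Basis \<Longrightarrow> \<bar>(y - a) \<bullet> b\<bar> < r"
  shows "real_analytic_at Basis y F"
proof -
  have r: "r > 0" using y[OF SOME_Basis] abs_ge_zero le_less_trans by blast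
  define s where "s = Min ((\<lambda>b. r - \<bar>(y - a) \<bullet> b\<bar>) ` Basis)"
  have s: "s > 0" unfolding s_def using y by (subst Min_gr_iff) auto
  have sle: "s + \<bar>(y - a) \<bullet> b\<bar> \<le> r" if "b \<in> Basis" for b
  proof -
    have "s \<le> r - \<bar>(y - a) \<bullet> b\<bar>" unfolding s_def using that by (intro Min_le) auto
    then show ?thesis by simp
  qed
  have u: "\<bar>(x - y) \<bullet> b\<bar> \<le> s" if "x \<in> coord_box Basis y s" "b \<in> Basis" for x b
    using coord_box_bound that .
  have eq: "(x - a) \<bullet> b = (x - y) \<bullet> b + (y - a) \<bullet> b" for x b by (simp add: inner_diff_left)
  have "pseries Basis (coord_box Basis y s) (\<lambda>b x. (x - y) \<bullet> b) s K (\<lambda>x. F x)"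
  proof (rule pseries_compose[where J = Basis and \<theta> = "\<lambda>x. x" and \<rho> = r and v = "\<lambda>b x. (x - a) \<bullet> b", OF _ _ s r u])
    show "pseries Basis (coord_box Basis y s) (\<lambda>b x. (x - y) \<bullet> b) s r (\<lambda>x. (x - a) \<bullet> b)" if "b \<in> Basis" for b
    proof (rule pseries_mono[OF _ sle[OF that]])
      show "pseries Basis (coord_box Basis y s) (\<lambda>b x. (x - y) \<bullet> b) s (s + \<bar>(y - a) \<bullet> b\<bar>) (\<lambda>x. (x - a) \<bullet> b)"
        by (subst eq) (intro pseries_add pseries_const pseries_coord[where u = "\<lambda>b x. (x - y) \<bullet> b"] s u that finite_Basis)
    qed
    show "pseries Basis ((\<lambda>x. x) ` coord_box Basis y s) (\<lambda>b x. (x - a) \<bullet> b) r K F"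
    proof (rule pseries_subset[OF F], rule subsetI)
      fix x assume "x \<in> (\<lambda>x. x) ` coord_box Basis y s"
      then have x: "x \<in> coord_box Basis y s" by simp
      have "\<bar>(x - a) \<bullet> b\<bar> \<le> r" if "b \<in> Basis" for b
        using u[OF x that] sle[OF that] eq[of x b] by linarith
      then show "x \<in> coord_box Basis a r" by (auto simp: coord_box_def)
    qed
  qed auto
  then show ?thesis by (rule real_analytic_atI[OF s])
qed

section \<open>Lagrange interpolation\<close>

text \<open>For \<open>k = 0\<close> division by zero yields 0, so the only node is the left end of
  the interval and no separate case arises.\<close>

definition node :: "real \<Rightarrow> nat \<Rightarrow> nat \<Rightarrow> real" where
  "node \<delta> k j = \<delta> * real j / real k"

text \<open>The denominators are written as constant factors, so that the closure rules for products
  and constants apply to each factor.\<close>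

definition lagrange :: "real \<Rightarrow> nat \<Rightarrow> nat \<Rightarrow> real \<Rightarrow> real" where
  "lagrange \<delta> k j t = (\<Prod>i\<in>{..k} - {j}. (t - node \<delta> k i) * (1 / (node \<delta> k j - node \<delta> k i)))"

lemma node_inj: "\<delta> > 0 \<Longrightarrow> i \<le> k \<Longrightarrow> j \<le> k \<Longrightarrow> node \<delta> k i = node \<delta> k j \<longleftrightarrow> i = j"
  by (cases "k = 0") (auto simp: node_def)

lemma node_bounds: "\<delta> > 0 \<Longrightarrow> j \<le> k \<Longrightarrow> 0 \<le> node \<delta> k j \<and> node \<delta> k j \<le> \<delta>"
  by (cases "k = 0") (auto simp: node_def divide_simps)

lemma lagrange_node:
  assumes "\<delta> > 0" "i \<le> k" "j \<le> k"
  shows "lagrange \<delta> k j (node \<delta> k i) = (if i = j then 1 else 0)"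
proof (cases "i = j")
  case True
  then show ?thesis
    unfolding lagrange_def using assms by (auto simp: node_inj intro!: prod.neutral)
next
  case False
  then show ?thesis using assms by (auto simp: lagrange_def intro!: prod_zero)
qed

lemma lagrange_interpolation:
  fixes p :: "real poly"
  assumes \<delta>: "\<delta> > 0" and p: "degree p \<le> k"
  shows "poly p t = (\<Sum>j\<le>k. poly p (node \<delta> k j) * lagrange \<delta> k j t)"
proof -
  define l where "l j = (\<Prod>i\<in>{..k} - {j}. smult (1 / (node \<delta> k j - node \<delta> k i)) [:- node \<delta> k i, 1:])" for j
  have l: "poly (l j) t = lagrange \<delta> k j t" for j t
    unfolding l_def lagrange_def poly_prod by (intro prod.cong) (auto simp: diff_divide_distrib)
  have dl: "degree (l j) \<le> k" if "j \<le> k" for j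
  proof -
    have "degree (l j) \<le> (\<Sum>i\<in>{..k} - {j}. degree (smult (1 / (node \<delta> k j - node \<delta> k i)) [:- node \<delta> k i, 1:]))"
      unfolding l_def using degree_prod_sum_le[of "{..k} - {j}" "\<lambda>i. smult (1 / (node \<delta> k j - node \<delta> k i)) [:- node \<delta> k i, 1:]"]
      by (simp add: o_def)
    also have "\<dots> \<le> (\<Sum>i\<in>{..k} - {j}. 1)"
      by (intro sum_mono) (auto intro: order_trans[OF degree_smult_le])
    finally show ?thesis using that by simp
  qed
  \<comment> \<open>The interpolation error has degree at most \<open>k\<close> and vanishes at
    \<open>k + 1\<close> distinct nodes, hence is zero.\<close>
  define q where "q = p - (\<Sum>j\<le>k. smult (poly p (node \<delta> k j)) (l j))"
  have "degree q \<le> k"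
    unfolding q_def by (intro degree_diff_le degree_sum_le p order_trans[OF degree_smult_le] dl) auto
  moreover have "poly q x = 0" if x: "x \<in> node \<delta> k ` {..k}" for x
  proof -
    obtain i where i: "i \<le> k" "x = node \<delta> k i" using x by auto
    have "(\<Sum>j\<le>k. poly p (node \<delta> k j) * lagrange \<delta> k j x) = (\<Sum>j\<le>k. if i = j then poly p (node \<delta> k j) else 0)"
      using i \<delta> by (intro sum.cong) (auto simp: lagrange_node)
    also have "\<dots> = poly p x" using i by simp
    finally show ?thesis by (simp add: q_def poly_sum l)
  qed
  moreover have "card (node \<delta> k ` {..k}) = k + 1"
    using \<delta> by (subst card_image) (auto simp: inj_on_def node_inj)
  ultimately have "q = 0"
    using card_poly_roots_bound[of q] card_mono[OF poly_roots_finite[of q], of "node \<delta> k ` {..k}"]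
    by (metis (mono_tags, lifting) add.commute le_trans mem_Collect_eq subsetI Suc_eq_plus1_left not_less_eq_eq)
  then have "poly p t = poly (\<Sum>j\<le>k. smult (poly p (node \<delta> k j)) (l j)) t"
    by (simp add: q_def)
  then show ?thesis by (simp add: poly_sum l)
qed

lemma prod_node_differences:
  assumes "j \<le> k"
  shows "(\<Prod>i\<in>{..k} - {j}. \<bar>real j - real i\<bar>) = fact j * fact (k - j)"
proof -
  have split: "{..k} - {j} = {..<j} \<union> {j<..k}" using assms by auto
  have "(\<Prod>i\<in>{..k} - {j}. \<bar>real j - real i\<bar>) = (\<Prod>i<j. \<bar>real j - real i\<bar>) * (\<Prod>i\<in>{j<..k}. \<bar>real j - real i\<bar>)"
    unfolding split by (rule prod.union_disjoint) auto
  also have "(\<Prod>i<j. \<bar>real j - real i\<bar>) = (\<Prod>i\<in>{1..j}. real i)"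
    by (rule prod.reindex_bij_witness[of _ "\<lambda>i. j - i" "\<lambda>i. j - i"]) auto
  also have "(\<Prod>i\<in>{j<..k}. \<bar>real j - real i\<bar>) = (\<Prod>i\<in>{1..k-j}. real i)"
    using assms by (intro prod.reindex_bij_witness[of _ "\<lambda>i. i + j" "\<lambda>i. i - j"]) auto
  finally show ?thesis by (simp add: fact_prod)
qed

text \<open>The product is a binomial coefficient times \<open>k ^ k / fact k\<close>. Both factors
  grow only geometrically in \<open>k\<close>, which is what later allows the interpolation loss to
  be compensated by a smaller radius.\<close>

lemma prod_node_quotients_le:
  assumes "j \<le> k"
  shows "(\<Prod>i\<in>{..k} - {j}. real k / \<bar>real j - real i\<bar>) \<le> (2 * exp 1) ^ k"
proof -
  have "(\<Prod>i\<in>{..k} - {j}. real k / \<bar>real j - real i\<bar>) = real k ^ k / (fact j * fact (k - j))"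
    using assms by (simp add: prod_dividef prod_node_differences)
  also have "\<dots> = real (k choose j) * (real k ^ k / fact k)"
    using assms by (simp add: binomial_fact)
  also have "\<dots> \<le> 2 ^ k * exp 1 ^ k"
  proof (rule mult_mono)
    have "k choose j \<le> 2 ^ k" using assms choose_row_sum[of k] member_le_sum[of j "{..k}" "\<lambda>j. k choose j"] by simp
    then show "real (k choose j) \<le> 2 ^ k" by (metis of_nat_le_iff of_nat_numeral of_nat_power)
    \<comment> \<open>This quotient is a single term of the exponential series at
      \<open>k\<close>.\<close>
    have "real k ^ k /\<^sub>R fact k \<le> (\<Sum>n. real k ^ n /\<^sub>R fact n)"
      by (rule sum_le_suminf[of _ "{k}", simplified]) (use summable_exp[of "real k"] in \<open>auto simp: mult.commute\<close>)
    also have "(\<Sum>n. real k ^ n /\<^sub>R fact n) = exp (real k)" by (simp add: exp_def)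
    finally show "real k ^ k / fact k \<le> exp 1 ^ k"
      by (simp add: exp_of_nat_mult[symmetric] divide_inverse mult.commute)
  qed auto
  finally show ?thesis by (simp add: power_mult_distrib)
qed

text \<open>Each of the \<open>k\<close> factors \<open>h - node\<close> has norm at most
  \<open>R + \<delta>\<close>. The denominators contribute
  \<open>k / (\<delta> \<bar>j - i\<bar>)\<close>, whose product over i is at most
  \<open>(2 * exp 1) ^ k / \<delta> ^ k\<close>.\<close>

lemma pseries_lagrange:
  assumes fin: "finite I" and r: "r > 0" and u: "\<And>x i. x \<in> D \<Longrightarrow> i \<in> I \<Longrightarrow> \<bar>u i x\<bar> \<le> r"
    and h: "pseries I D u r R h" and \<delta>: "\<delta> > 0" and j: "j \<le> k"
  shows "pseries I D u r (((R + \<delta>) / \<delta> * (2 * exp 1)) ^ k) (\<lambda>x. lagrange \<delta> k j (h x))"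
proof -
  have R: "R \<ge> 0" using pseries_nonneg[OF r h] .
  define N where "N i = (R + \<delta>) * \<bar>1 / (node \<delta> k j - node \<delta> k i)\<bar>" for i
  have "pseries I D u r (\<Prod>i\<in>{..k} - {j}. N i) (\<lambda>x. lagrange \<delta> k j (h x))"
    unfolding lagrange_def N_def
  proof (intro pseries_prod[OF fin r u] pseries_mult[OF fin r u] pseries_const fin r)
    fix i assume "i \<in> {..k} - {j}"
    then have "\<bar>- node \<delta> k i\<bar> \<le> \<delta>" using node_bounds[OF \<delta>, of i k] by auto
    then show "pseries I D u r (R + \<delta>) (\<lambda>x. h x - node \<delta> k i)"
      using pseries_mono[OF pseries_add[OF r u h pseries_const[OF fin r, where a = "- node \<delta> k i"]], of "R + \<delta>"]
      by simp
  qed auto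
  moreover have "(\<Prod>i\<in>{..k} - {j}. N i) \<le> ((R + \<delta>) / \<delta> * (2 * exp 1)) ^ k"
  proof -
    have "(\<Prod>i\<in>{..k} - {j}. N i) = (\<Prod>i\<in>{..k} - {j}. ((R + \<delta>) / \<delta>) * (real k / \<bar>real j - real i\<bar>))"
    proof (rule prod.cong)
      fix i assume "i \<in> {..k} - {j}"
      then have k: "real k > 0" and ij: "real j - real i \<noteq> 0" using j by auto
      have "node \<delta> k j - node \<delta> k i = \<delta> * (real j - real i) / real k"
        by (simp add: node_def right_diff_distrib diff_divide_distrib)
      then show "N i = ((R + \<delta>) / \<delta>) * (real k / \<bar>real j - real i\<bar>)"
        using k ij \<delta> by (simp add: N_def abs_mult)
    qed simp
    also have "\<dots> = ((R + \<delta>) / \<delta>) ^ k * (\<Prod>i\<in>{..k} - {j}. real k / \<bar>real j - real i\<bar>)"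
      unfolding prod.distrib using j by simp
    also have "\<dots> \<le> ((R + \<delta>) / \<delta>) ^ k * (2 * exp 1) ^ k"
      using prod_node_quotients_le[OF j] R \<delta> by (intro mult_left_mono) auto
    finally show ?thesis by (simp only: power_mult_distrib)
  qed
  ultimately show ?thesis by (rule pseries_mono)
qed

text \<open>Tensor product Lagrange interpolation on a grid in the cube with corner
  \<open>\<xi>\<close> and side \<open>\<delta>\<close>. It is a polynomial in \<open>x\<close> for
  every function \<open>a\<close>, so continuity and analyticity hold before anything is known about
  \<open>a\<close>.\<close>

definition interpolant :: "'e::euclidean_space \<Rightarrow> real \<Rightarrow> nat \<Rightarrow> ('e \<Rightarrow> real) \<Rightarrow> 'e \<Rightarrow> real" where
  "interpolant \<xi> \<delta> k a x =
     (\<Sum>j\<in>Basis \<rightarrow>\<^sub>E {..k}. a (\<Sum>b\<in>Basis. (\<xi> \<bullet> b + node \<delta> k (j b)) *\<^sub>R b) *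
        (\<Prod>b\<in>Basis. lagrange \<delta> k (j b) ((x - \<xi>) \<bullet> b)))"

text \<open>Polynomial behaviour of bounded degree along each coordinate direction is enough:
  interpolating in one coordinate after another keeps all intermediate points in the cube, and no
  joint regularity enters.\<close>

lemma interpolant_eq:
  fixes \<xi> :: "'e::euclidean_space"
  assumes \<delta>: "\<delta> > 0"
    and a: "\<And>x b. x \<in> coord_box Basis \<xi> \<delta> \<Longrightarrow> b \<in> Basis \<Longrightarrow> \<exists>p. degree p \<le> k \<and> (\<forall>s. a (x + s *\<^sub>R b) = poly p s)"
    and x: "x \<in> coord_box Basis \<xi> \<delta>"
  shows "a x = interpolant \<xi> \<delta> k a x"
proof -
  \<comment> \<open>The induction moves the coordinates in \<open>I\<close> onto the grid and leaves
    the others as in \<open>x\<close>.\<close>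
  define repl where "repl I j = (\<Sum>b\<in>Basis. (if b \<in> I then \<xi> \<bullet> b + node \<delta> k (j b) else x \<bullet> b) *\<^sub>R b)" for I j
  have repl_inner: "repl I j \<bullet> b = (if b \<in> I then \<xi> \<bullet> b + node \<delta> k (j b) else x \<bullet> b)" if "b \<in> Basis" for I j b
    unfolding repl_def using that by simp
  have "a x = (\<Sum>j\<in>I \<rightarrow>\<^sub>E {..k}. a (repl I j) * (\<Prod>b\<in>I. lagrange \<delta> k (j b) ((x - \<xi>) \<bullet> b)))"
    if "finite I" "I \<subseteq> Basis" for I
    using that
  proof (induction I rule: finite_induct)
    case empty
    then show ?case by (simp add: repl_def euclidean_representation)
  next
    case (insert i I)
    then have i: "i \<in> Basis" "i \<notin> I" "I \<subseteq> Basis" by auto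
    let ?T = "(x - \<xi>) \<bullet> i"
    have step: "a (repl I j) = (\<Sum>l\<le>k. a (repl (insert i I) (j(i := l))) * lagrange \<delta> k l ?T)"
      if j: "j \<in> I \<rightarrow>\<^sub>E {..k}" for j
    proof -
      have Q: "repl I j \<in> coord_box Basis \<xi> \<delta>"
      proof -
        have "\<bar>(repl I j - \<xi>) \<bullet> b\<bar> \<le> \<delta>" if b: "b \<in> Basis" for b
        proof (cases "b \<in> I")
          case True
          then have "j b \<le> k" using j by (auto simp: PiE_iff)
          then show ?thesis using node_bounds[OF \<delta>, of "j b" k] True repl_inner[OF b] by (simp add: inner_diff_left)
        next
          case False
          then show ?thesis using repl_inner[OF b] coord_box_bound[OF x b] by (simp add: inner_diff_left)
        qed
        then show ?thesis by (simp add: coord_box_def)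
      qed
      obtain p where p: "degree p \<le> k" "\<And>s. a (repl I j + s *\<^sub>R i) = poly p s"
        using a[OF Q i(1)] by blast
      \<comment> \<open>The parameter of \<open>p\<close> is the displacement from
        \<open>repl I j\<close>. Shifting by \<open>?T\<close> turns it into the offset from
        \<open>\<xi>\<close>, in which the nodes are given.\<close>
      define q where "q = pcompose p [:- ?T, 1:]"
      have dq: "degree q \<le> k" using p(1) by (simp add: q_def degree_pcompose)
      have q: "poly q t = a (repl I j + (t - ?T) *\<^sub>R i)" for t
        by (simp add: q_def poly_pcompose p(2))
      have "a (repl (insert i I) (j(i := l))) = poly q (node \<delta> k l)" for l
      proof -
        have "repl (insert i I) (j(i := l)) = repl I j + (node \<delta> k l - ?T) *\<^sub>R i"
        proof (rule euclidean_eqI)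
          fix b :: 'e assume b: "b \<in> Basis"
          show "repl (insert i I) (j(i := l)) \<bullet> b = (repl I j + (node \<delta> k l - ?T) *\<^sub>R i) \<bullet> b"
            using i by (cases "b = i") (auto simp: repl_inner[OF b] repl_inner[OF i(1)] inner_add_left inner_Basis b inner_diff_left)
        qed
        then show ?thesis by (simp add: q)
      qed
      then show ?thesis using lagrange_interpolation[OF \<delta> dq, of ?T] q[of ?T] by simp
    qed
    have "a x = (\<Sum>j\<in>I \<rightarrow>\<^sub>E {..k}. a (repl I j) * (\<Prod>b\<in>I. lagrange \<delta> k (j b) ((x - \<xi>) \<bullet> b)))"
      using insert by auto
    also have "\<dots> = (\<Sum>j\<in>I \<rightarrow>\<^sub>E {..k}. \<Sum>l\<le>k. a (repl (insert i I) (j(i := l))) *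
        (lagrange \<delta> k l ?T * (\<Prod>b\<in>I. lagrange \<delta> k (j b) ((x - \<xi>) \<bullet> b))))"
      by (rule sum.cong) (auto simp: step sum_distrib_right mult.assoc)
    also have "\<dots> = (\<Sum>l\<le>k. \<Sum>j\<in>I \<rightarrow>\<^sub>E {..k}. a (repl (insert i I) (j(i := l))) *
        (lagrange \<delta> k l ?T * (\<Prod>b\<in>I. lagrange \<delta> k (j b) ((x - \<xi>) \<bullet> b))))"
      by (rule sum.swap)
    also have "\<dots> = (\<Sum>(l, j)\<in>{..k} \<times> (I \<rightarrow>\<^sub>E {..k}). a (repl (insert i I) (j(i := l))) *
        (lagrange \<delta> k l ?T * (\<Prod>b\<in>I. lagrange \<delta> k (j b) ((x - \<xi>) \<bullet> b))))"
      by (rule sum.cartesian_product)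
    also have "\<dots> = (\<Sum>(l, j)\<in>{..k} \<times> (I \<rightarrow>\<^sub>E {..k}). a (repl (insert i I) (j(i := l))) *
        (\<Prod>b\<in>insert i I. lagrange \<delta> k ((j(i := l)) b) ((x - \<xi>) \<bullet> b)))"
    proof (rule sum.cong, simp, clarify)
      fix l j
      have "(\<Prod>b\<in>I. lagrange \<delta> k ((j(i := l)) b) ((x - \<xi>) \<bullet> b)) = (\<Prod>b\<in>I. lagrange \<delta> k (j b) ((x - \<xi>) \<bullet> b))"
        using i by (intro prod.cong) auto
      then show "a (repl (insert i I) (j(i := l))) * (lagrange \<delta> k l ?T * (\<Prod>b\<in>I. lagrange \<delta> k (j b) ((x - \<xi>) \<bullet> b))) =
        a (repl (insert i I) (j(i := l))) * (\<Prod>b\<in>insert i I. lagrange \<delta> k ((j(i := l)) b) ((x - \<xi>) \<bullet> b))"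
        using i insert.hyps by simp
    qed
    also have "\<dots> = (\<Sum>j\<in>insert i I \<rightarrow>\<^sub>E {..k}. a (repl (insert i I) j) *
        (\<Prod>b\<in>insert i I. lagrange \<delta> k (j b) ((x - \<xi>) \<bullet> b)))"
      unfolding PiE_insert_eq using inj_combinator[OF i(2), of "\<lambda>_. {..k}"]
      by (subst sum.reindex) (auto simp: case_prod_unfold o_def)
    finally show ?case .
  qed
  from this[of Basis]
  show ?thesis by (simp add: interpolant_def repl_def)
qed

lemma interpolant_analytic: "real_analytic_at Basis x (interpolant \<xi> \<delta> k a)"
proof -
  have "real_analytic_at Basis x (\<lambda>x. (x - \<xi>) \<bullet> b)" for b
    using real_analytic_at_diff[OF _ _ real_analytic_at_inner real_analytic_at_const, of Basis x b "\<xi> \<bullet> b"]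
    by (simp add: inner_diff_left)
  then show ?thesis
    unfolding interpolant_def[abs_def] lagrange_def
    by (intro real_analytic_at_sum real_analytic_at_mult real_analytic_at_prod real_analytic_at_diff
          real_analytic_at_const finite_PiE finite_Basis) auto
qed

lemma continuous_interpolant: "continuous_on S (interpolant \<xi> \<delta> k a)"
  unfolding interpolant_def[abs_def] lagrange_def by (intro continuous_intros)

text \<open>The factors count the grid points, bound the sampled values by \<open>M\<close>, and
  bound one Lagrange polynomial per coordinate. The number \<open>1 + norm \<xi>\<close> bounds the
  norm of the shifted coordinate on the unit box.\<close>

lemma pseries_interpolant:
  fixes \<xi> :: "'e::euclidean_space"
  assumes \<delta>: "\<delta> > 0" and a: "\<And>x. x \<in> coord_box Basis \<xi> \<delta> \<Longrightarrow> \<bar>a x\<bar> \<le> M"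
  shows "pseries Basis (coord_box Basis 0 1) (\<lambda>b x. (x - 0) \<bullet> b) 1
           (real (k + 1) ^ DIM('e) * (M * (((1 + norm \<xi> + \<delta>) / \<delta> * (2 * exp 1)) ^ k) ^ DIM('e)))
           (interpolant \<xi> \<delta> k a)"
proof -
  let ?u = "\<lambda>b x :: 'e. (x - 0) \<bullet> b"
  let ?C = "((1 + norm \<xi> + \<delta>) / \<delta> * (2 * exp 1)) ^ k"
  have u: "\<bar>?u b x\<bar> \<le> 1" if "x \<in> coord_box Basis 0 1" "b \<in> Basis" for x b
    using that by (rule coord_box_bound)
  have h: "pseries Basis (coord_box Basis 0 1) ?u 1 (1 + norm \<xi>) (\<lambda>x. (x - \<xi>) \<bullet> b)" if b: "b \<in> Basis" for b
    using pseries_mono[OF pseries_add[OF _ u pseries_coord[where u = ?u and i = b] pseries_const[where a = "- (\<xi> \<bullet> b)"]],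
        where K' = "1 + norm \<xi>"] Basis_le_norm[OF b, of \<xi>] b
    by (simp add: inner_diff_left)
  have "pseries Basis (coord_box Basis 0 1) ?u 1 (\<Sum>j\<in>(Basis::'e set) \<rightarrow>\<^sub>E {..k}. M * (\<Prod>b\<in>(Basis::'e set). ?C)) (interpolant \<xi> \<delta> k a)"
    unfolding interpolant_def[abs_def]
  proof (intro pseries_sum[OF _ u] pseries_mult[OF _ _ u] pseries_prod[OF _ _ u] pseries_lagrange[OF _ _ u h \<delta>] finite_PiE)
    fix j :: "'e \<Rightarrow> nat" assume j: "j \<in> Basis \<rightarrow>\<^sub>E {..k}"
    then show "j b \<le> k" if "b \<in> Basis" for b using that by (auto simp: PiE_iff)
    then have "(\<Sum>b\<in>Basis. (\<xi> \<bullet> b + node \<delta> k (j b)) *\<^sub>R b) \<in> coord_box Basis \<xi> \<delta>"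
      using node_bounds[OF \<delta>] by (auto simp: coord_box_def inner_diff_left abs_le_iff dest: spec) (smt (verit, best) node_bounds \<delta>)+
    from a[OF this] show "pseries Basis (coord_box Basis 0 1) ?u 1 M
        (\<lambda>x. a (\<Sum>b\<in>Basis. (\<xi> \<bullet> b + node \<delta> k (j b)) *\<^sub>R b))"
      by (intro pseries_mono[OF pseries_const]) auto
  qed auto
  then show ?thesis by (simp add: card_PiE)
qed

section \<open>Functions analytic on an open family of planes\<close>

text \<open>The \<open>k\<close>-th Taylor coefficient at \<open>0\<close> of \<open>t \<mapsto> h (t x)\<close>; meaningless unless that function is analytic at \<open>0\<close>.\<close>

definition ray_coeff :: "('e::real_vector \<Rightarrow> real) \<Rightarrow> nat \<Rightarrow> 'e \<Rightarrow> real" where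
  "ray_coeff h k x = (SOME c. \<exists>r>0. \<forall>t. \<bar>t\<bar> < r \<longrightarrow> (\<lambda>k. c k * t ^ k) sums h (t *\<^sub>R x)) k"

lemma ray_coeff_eq:
  assumes "0 < r" "\<And>t. \<bar>t\<bar> < r \<Longrightarrow> (\<lambda>k. c k * t ^ k) sums h (t *\<^sub>R x)"
  shows "ray_coeff h k x = c k"
proof -
  let ?P = "\<lambda>c. \<exists>r>0. \<forall>t. \<bar>t\<bar> < r \<longrightarrow> (\<lambda>k. c k * t ^ k) sums h (t *\<^sub>R x)"
  have "?P c" using assms by blast
  then have "?P (SOME c. ?P c)" by (rule someI[of ?P])
  then obtain s where "s > 0" "\<And>t. \<bar>t\<bar> < s \<Longrightarrow> (\<lambda>k. (SOME c. ?P c) k * t ^ k) sums h (t *\<^sub>R x)" by blast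
  from powser_coeffs_unique[OF this assms] show ?thesis by (simp add: ray_coeff_def)
qed

text \<open>The coordinate plane of \<open>b1\<close> and \<open>b2\<close> only parametrizes the
  plane through 0 spanned by \<open>x\<close> and \<open>b\<close>. Nothing is assumed about
  \<open>h\<close> across different planes. Basis vectors as second direction give access to each
  coordinate of \<open>x\<close> separately.\<close>

locale analytic_on_planes =
  fixes h :: "'e::euclidean_space \<Rightarrow> real" and V :: "'e set" and b1 b2 :: 'e
  assumes b: "b1 \<in> Basis" "b2 \<in> Basis" "b1 \<noteq> b2"
    and V: "open V"
    and planes: "\<And>x b y. x \<in> V \<Longrightarrow> b \<in> Basis \<Longrightarrow> y \<in> span {b1, b2} \<Longrightarrow>
        real_analytic_at {b1, b2} y (\<lambda>y. h ((y \<bullet> b1) *\<^sub>R x + (y \<bullet> b2) *\<^sub>R b))"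
begin

lemma b_inner: "b1 \<bullet> b1 = 1" "b2 \<bullet> b2 = 1" "b1 \<bullet> b2 = 0" "b2 \<bullet> b1 = 0"
  using b by (auto simp: inner_Basis)

lemma line_analytic:
  assumes "x \<in> V"
  shows "real_analytic_at Basis t (\<lambda>t. h (t *\<^sub>R x))"
proof -
  have "real_analytic_at Basis t (\<lambda>t. h (((t *\<^sub>R b1) \<bullet> b1) *\<^sub>R x + ((t *\<^sub>R b1) \<bullet> b2) *\<^sub>R b1))"
  proof (rule real_analytic_at_compose[where B' = "{b1, b2}" and d = 1 and \<theta> = "\<lambda>t. t *\<^sub>R b1"])
    show "real_analytic_at {b1, b2} (t *\<^sub>R b1) (\<lambda>y. h ((y \<bullet> b1) *\<^sub>R x + (y \<bullet> b2) *\<^sub>R b1))"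
      by (rule planes[OF assms b(1)]) (auto intro: span_scale span_base)
    show "real_analytic_at Basis t (\<lambda>t. (t *\<^sub>R b1) \<bullet> b)" if "b \<in> {b1, b2}" for b
      using real_analytic_at_inner[of Basis t "b1 \<bullet> b"] span_Basis[where 'a = real] by auto
    show "t *\<^sub>R b1 \<in> span {b1, b2}" for t by (auto intro: span_scale span_base)
  qed (use b span_Basis[where 'a = real] in auto)
  then show ?thesis by (simp add: b_inner)
qed

text \<open>The point \<open>t *\<^sub>R (x + s *\<^sub>R b')\<close> has plane coordinates t and t
  s. Grouping the double series by total degree makes the coefficient of \<open>t ^ k\<close> a
  polynomial in \<open>s\<close> of degree at most \<open>k\<close>. This holds for all
  \<open>s\<close>, even when \<open>x + s *\<^sub>R b'\<close> leaves \<open>V\<close>, since the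
  plane stays the same.\<close>

lemma ray_coeff_plane:
  assumes x: "x \<in> V" and b': "b' \<in> Basis"
  shows "\<exists>r>0. \<forall>t. \<bar>t\<bar> < r \<longrightarrow> (\<lambda>k. ray_coeff h k (x + s *\<^sub>R b') * t ^ k) sums h (t *\<^sub>R (x + s *\<^sub>R b'))"
    and "\<exists>p. degree p \<le> k \<and> (\<forall>s. ray_coeff h k (x + s *\<^sub>R b') = poly p s)"
proof -
  let ?B = "{b1, b2}"
  have an: "real_analytic_at ?B 0 (\<lambda>y. h ((y \<bullet> b1) *\<^sub>R x + (y \<bullet> b2) *\<^sub>R b'))"
    by (rule planes[OF x b']) (rule span_0)
  obtain K where "\<forall>\<^sub>F r in at_right 0. 0 < r \<and> pseries ?B (coord_box ?B 0 r) (\<lambda>b x. (x - 0) \<bullet> b) r K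
      (\<lambda>y. h ((y \<bullet> b1) *\<^sub>R x + (y \<bullet> b2) *\<^sub>R b'))"
    using real_analytic_atE[OF an] .
  then obtain r where r: "0 < r" and ps: "pseries ?B (coord_box ?B 0 r) (\<lambda>b x. (x - 0) \<bullet> b) r K
      (\<lambda>y. h ((y \<bullet> b1) *\<^sub>R x + (y \<bullet> b2) *\<^sub>R b'))"
    by (rule eventually_at_right_0E) blast
  then obtain c where c: "\<And>y. y \<in> coord_box ?B 0 r \<Longrightarrow>
      ((\<lambda>\<alpha>. c \<alpha> * monomial ?B (\<lambda>b x. (x - 0) \<bullet> b) \<alpha> y) has_sum
        h ((y \<bullet> b1) *\<^sub>R x + (y \<bullet> b2) *\<^sub>R b')) (?B \<rightarrow>\<^sub>E UNIV)"
    unfolding pseries_def by blast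
  define fib where "fib k = {\<alpha> \<in> ?B \<rightarrow>\<^sub>E (UNIV :: nat set). sum \<alpha> ?B = k}" for k
  define d where "d s k = (\<Sum>\<alpha>\<in>fib k. c \<alpha> * s ^ \<alpha> b2)" for s k
  \<comment> \<open>The radius depends on \<open>s\<close> so that both coordinates t and t s stay
    within \<open>r\<close>.\<close>
  have sums: "(\<lambda>k. d s k * t ^ k) sums h (t *\<^sub>R (x + s *\<^sub>R b'))" if t: "\<bar>t\<bar> < r / (1 + \<bar>s\<bar>)" for s t
  proof -
    define \<xi> where "\<xi> b = (if b = b1 then 1 else s)" for b
    define y where "y = t *\<^sub>R b1 + (t * s) *\<^sub>R b2"
    have y: "y \<bullet> b1 = t" "y \<bullet> b2 = t * s" by (simp_all add: y_def inner_add_left b_inner)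
    have "\<bar>t\<bar> * (1 + \<bar>s\<bar>) < r" using t by (simp add: pos_less_divide_eq)
    then have "\<bar>t\<bar> + \<bar>t * s\<bar> < r" by (simp add: distrib_left abs_mult)
    moreover have "y \<in> span ?B" unfolding y_def by (intro span_add span_scale span_base) auto
    ultimately have "y \<in> coord_box ?B 0 r" using y by (auto simp: coord_box_def)
    moreover have "monomial ?B (\<lambda>b x. (x - 0) \<bullet> b) \<alpha> y = (\<Prod>b\<in>?B. (t * \<xi> b) ^ \<alpha> b)" for \<alpha>
      unfolding monomial_def using y b by (intro prod.cong) (auto simp: \<xi>_def)
    ultimately have "((\<lambda>\<alpha>. c \<alpha> * (\<Prod>b\<in>?B. (t * \<xi> b) ^ \<alpha> b)) has_sum h (t *\<^sub>R x + (t * s) *\<^sub>R b')) (?B \<rightarrow>\<^sub>E UNIV)"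
      using c[of y] y by simp
    from has_sum_homogeneous[OF _ this]
    have "(\<lambda>k. (\<Sum>\<alpha>\<in>fib k. c \<alpha> * (\<Prod>b\<in>?B. \<xi> b ^ \<alpha> b)) * t ^ k) sums h (t *\<^sub>R x + (t * s) *\<^sub>R b')"
      by (simp add: fib_def)
    moreover have "(\<Prod>b\<in>?B. \<xi> b ^ \<alpha> b) = s ^ \<alpha> b2" for \<alpha> using b by (simp add: \<xi>_def)
    ultimately show ?thesis by (simp add: d_def scaleR_add_right)
  qed
  have pos: "0 < r / (1 + \<bar>s\<bar>)" for s using r by (simp add: add_pos_nonneg)
  have eq: "ray_coeff h k (x + s *\<^sub>R b') = d s k" for s k
    using pos sums by (rule ray_coeff_eq)
  show "\<exists>r>0. \<forall>t. \<bar>t\<bar> < r \<longrightarrow> (\<lambda>k. ray_coeff h k (x + s *\<^sub>R b') * t ^ k) sums h (t *\<^sub>R (x + s *\<^sub>R b'))"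
    using pos sums eq by auto
  show "\<exists>p. degree p \<le> k \<and> (\<forall>s. ray_coeff h k (x + s *\<^sub>R b') = poly p s)"
  proof (intro exI[of _ "\<Sum>\<alpha>\<in>fib k. monom (c \<alpha>) (\<alpha> b2)"] conjI allI)
    have "\<alpha> b2 \<le> k" if "\<alpha> \<in> fib k" for \<alpha> using that b by (auto simp: fib_def)
    then show "degree (\<Sum>\<alpha>\<in>fib k. monom (c \<alpha>) (\<alpha> b2)) \<le> k"
      by (intro degree_sum_le order_trans[OF degree_monom_le]) (auto simp: fib_def intro: finite_degree_fibre)
    show "ray_coeff h k (x + s *\<^sub>R b') = poly (\<Sum>\<alpha>\<in>fib k. monom (c \<alpha>) (\<alpha> b2)) s" for s
      by (simp add: eq d_def poly_sum poly_monom)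
  qed
qed

lemma ray_coeff_sums:
  assumes "x \<in> V"
  obtains r where "r > 0" "\<And>t. \<bar>t\<bar> < r \<Longrightarrow> (\<lambda>k. ray_coeff h k x * t ^ k) sums h (t *\<^sub>R x)"
  using ray_coeff_plane(1)[OF assms b(1), of 0] by auto

lemma ray_coeff_scale:
  assumes "x \<in> V" "\<sigma> \<noteq> 0"
  shows "ray_coeff h k (\<sigma> *\<^sub>R x) = \<sigma> ^ k * ray_coeff h k x"
proof -
  obtain r where r: "r > 0" "\<And>t. \<bar>t\<bar> < r \<Longrightarrow> (\<lambda>k. ray_coeff h k x * t ^ k) sums h (t *\<^sub>R x)"
    by (rule ray_coeff_sums[OF assms(1)]) blast
  show ?thesis
  proof (rule ray_coeff_eq[of "r / \<bar>\<sigma>\<bar>"])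
    fix t assume "\<bar>t\<bar> < r / \<bar>\<sigma>\<bar>"
    then have "\<bar>t * \<sigma>\<bar> < r" using assms by (simp add: pos_less_divide_eq abs_mult)
    from r(2)[OF this] show "(\<lambda>k. \<sigma> ^ k * ray_coeff h k x * t ^ k) sums h (t *\<^sub>R \<sigma> *\<^sub>R x)"
      by (simp add: power_mult_distrib mult_ac)
  qed (use r assms in auto)
qed

text \<open>The terms of a convergent power series are bounded. Using one natural number for both
  the constant and the ratio, with exponent \<open>k + 1\<close>, indexes the possible bounds by a
  countable set, as Baire requires.\<close>

lemma ray_coeff_bounded:
  assumes "x \<in> V"
  shows "\<exists>m::nat. \<forall>k. \<bar>ray_coeff h k x\<bar> \<le> real m ^ (k + 1)"
proof -
  obtain r where r: "r > 0" "\<And>t. \<bar>t\<bar> < r \<Longrightarrow> (\<lambda>k. ray_coeff h k x * t ^ k) sums h (t *\<^sub>R x)"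
    by (rule ray_coeff_sums[OF assms]) blast
  define t where "t = min (r / 2) 1"
  have t: "0 < t" "t < r" "t \<le> 1" using r by (auto simp: t_def)
  have "(\<lambda>k. ray_coeff h k x * t ^ k) \<longlonglongrightarrow> 0"
    using r(2)[of t] t by (intro summable_LIMSEQ_zero) (auto simp: sums_iff)
  then have "Bseq (\<lambda>k. ray_coeff h k x * t ^ k)" by (intro convergent_imp_Bseq convergentI)
  then obtain M where M: "M > 0" "\<And>k. \<bar>ray_coeff h k x * t ^ k\<bar> \<le> M"
    unfolding Bseq_def by auto
  obtain m :: nat where m: "max M (1 / t) \<le> real m" using real_arch_simple by blast
  have "\<bar>ray_coeff h k x\<bar> \<le> real m ^ (k + 1)" for k
  proof -
    have "\<bar>ray_coeff h k x\<bar> \<le> M * (1 / t) ^ k"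
      using M(2)[of k] t by (simp add: abs_mult power_divide pos_le_divide_eq)
    also have "\<dots> \<le> real m * real m ^ k"
      using m M t by (intro mult_mono power_mono) auto
    finally show ?thesis by simp
  qed
  then show ?thesis by blast
qed

lemma ray_coeff_interpolant:
  assumes "\<delta> > 0" "coord_box Basis \<xi> \<delta> \<subseteq> V" "x \<in> coord_box Basis \<xi> \<delta>"
  shows "ray_coeff h k x = interpolant \<xi> \<delta> k (ray_coeff h k) x"
  by (rule interpolant_eq[OF assms(1) _ assms(3)]) (use ray_coeff_plane(2) assms(2) in blast)

lemma ball_subset_coord_box: "ball \<xi> \<delta> \<subseteq> coord_box Basis (\<xi>::'e) \<delta>"
proof
  fix x assume x: "x \<in> ball \<xi> \<delta>"
  have "\<bar>(x - \<xi>) \<bullet> b\<bar> \<le> \<delta>" if "b \<in> Basis" for b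
    using Basis_le_norm[OF that, of "x - \<xi>"] x by (simp add: dist_norm norm_minus_commute)
  then show "x \<in> coord_box Basis \<xi> \<delta>" by (simp add: coord_box_def)
qed

lemma closed_coord_box: "closed (coord_box Basis (\<xi>::'e) \<delta>)"
  unfolding coord_box_def by (auto intro!: closed_Collect_all closed_Collect_imp closed_Collect_le continuous_intros simp: Ball_def)

lemma coord_box_in_open:
  assumes "open U" "(x::'e) \<in> U"
  obtains \<delta> where "\<delta> > 0" "coord_box Basis x \<delta> \<subseteq> U"
proof -
  obtain d where d: "d > 0" "ball x d \<subseteq> U" using assms openE by blast
  have "\<forall>\<^sub>F r in at_right 0. coord_box Basis x r \<subseteq> ball x d"
    by (rule coord_box_subset_ball) (use d in auto)
  then obtain r where "r > 0" "coord_box Basis x r \<subseteq> ball x d" by (rule eventually_at_right_0E)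
  with d that show ?thesis by blast
qed

text \<open>On a box in \<open>V\<close> each coefficient coincides with its interpolant and is
  therefore continuous. The sets with a given bound are then closed and cover the box, so one of
  them has interior points.\<close>

lemma uniform_bound_box:
  assumes "V \<noteq> {}"
  obtains \<xi> \<delta> and m :: nat where "\<delta> > 0" "coord_box Basis \<xi> \<delta> \<subseteq> V"
    "\<And>x k. x \<in> coord_box Basis \<xi> \<delta> \<Longrightarrow> \<bar>ray_coeff h k x\<bar> \<le> real m ^ (k + 1)"
proof -
  obtain x0 where x0: "x0 \<in> V" using assms by auto
  obtain \<delta>0 where \<delta>0: "\<delta>0 > 0" and QV: "coord_box Basis x0 \<delta>0 \<subseteq> V" using coord_box_in_open[OF V x0] .
  let ?Q = "coord_box Basis x0 \<delta>0"
  define E where "E m = (\<Inter>k. {x\<in>?Q. \<bar>ray_coeff h k x\<bar> \<le> real m ^ (k + 1)})" for m :: nat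
  have closedE: "closed (E m)" for m
  proof -
    have "continuous_on ?Q (ray_coeff h k)" for k
      using continuous_interpolant[of ?Q x0 \<delta>0 k "ray_coeff h k"]
      by (rule continuous_on_cong[THEN iffD1, rotated -1])
         (use ray_coeff_interpolant[OF \<delta>0 QV] in auto)
    then have "closed {x\<in>?Q. \<bar>ray_coeff h k x\<bar> \<le> real m ^ (k + 1)}" for k
      by (intro continuous_on_closed_Collect_le closed_coord_box continuous_intros)
    then show ?thesis unfolding E_def by (intro closed_INT) auto
  qed
  have cover: "?Q \<subseteq> (\<Union>m. E m)"
    using ray_coeff_bounded QV by (fastforce simp: E_def)
  have "\<exists>m. interior (E m) \<noteq> {}"
  proof (rule ccontr)
    assume "\<not> ?thesis"
    \<comment> \<open>Otherwise the complements are dense and open, and their intersection, which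
      misses the ball, would be dense.\<close>
    then have "closure (- E m) = UNIV" for m by (simp add: closure_complement)
    then have "(UNIV :: 'e set) \<subseteq> closure (\<Inter> (range (\<lambda>m. - E m)))"
      using closedE by (intro Baire) (auto simp: open_Compl)
    moreover have "\<Inter> (range (\<lambda>m. - E m)) \<subseteq> - ball x0 \<delta>0"
      using cover ball_subset_coord_box[of x0 \<delta>0] by blast
    ultimately have "(UNIV :: 'e set) \<subseteq> closure (- ball x0 \<delta>0)" using closure_mono by blast
    then have "x0 \<in> - ball x0 \<delta>0" by (metis UNIV_I closure_closed closed_Compl open_ball subsetD)
    then show False using \<delta>0 by simp
  qed
  then obtain m \<xi> where "\<xi> \<in> interior (E m)" by auto
  with coord_box_in_open[OF open_interior] obtain \<delta> where \<delta>: "\<delta> > 0" "coord_box Basis \<xi> \<delta> \<subseteq> interior (E m)" .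
  then have sub: "coord_box Basis \<xi> \<delta> \<subseteq> E m" using interior_subset by blast
  show ?thesis
  proof (rule that[OF \<delta>(1)])
    show "coord_box Basis \<xi> \<delta> \<subseteq> V" using sub QV by (force simp: E_def)
    show "\<bar>ray_coeff h k x\<bar> \<le> real m ^ (k + 1)" if "x \<in> coord_box Basis \<xi> \<delta>" for x k
      using sub that by (auto simp: E_def)
  qed
qed

lemma real_analytic_at_scale_arg:
  fixes P :: "'e \<Rightarrow> real"
  assumes "\<And>x. real_analytic_at Basis x P"
  shows "real_analytic_at Basis x (\<lambda>x. P (\<sigma> *\<^sub>R x))"
proof (rule real_analytic_at_compose[where B' = Basis and d = 1 and \<theta> = "\<lambda>x. \<sigma> *\<^sub>R x"])
  show "real_analytic_at Basis x (\<lambda>x. (\<sigma> *\<^sub>R x) \<bullet> b)" for b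
    using real_analytic_at_inner[of Basis x "\<sigma> *\<^sub>R b"] by simp
qed (use assms in auto)

text \<open>Homogeneity holds near \<open>\<xi>\<close> for \<open>\<sigma>\<close> near \<open>1\<close> because the interpolant agrees with the ray
  coefficient there; the identity theorem removes both restrictions.\<close>

lemma interpolant_homogeneous:
  assumes \<delta>: "\<delta> > 0" and Q: "coord_box Basis \<xi> \<delta> \<subseteq> V"
  shows "interpolant \<xi> \<delta> k (ray_coeff h k) (\<sigma> *\<^sub>R x) = \<sigma> ^ k * interpolant \<xi> \<delta> k (ray_coeff h k) x"
proof -
  define P where "P = interpolant \<xi> \<delta> k (ray_coeff h k)"
  have P: "P x = ray_coeff h k x" "x \<in> V" if "x \<in> ball \<xi> \<delta>" for x
    using ray_coeff_interpolant[OF \<delta> Q] ball_subset_coord_box[of \<xi> \<delta>] that Q by (auto simp: P_def)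
  have an: "real_analytic_at Basis x P" for x unfolding P_def by (rule interpolant_analytic)
  \<comment> \<open>A factor this close to 1 moves points of norm at most
    \<open>norm \<xi> + \<delta>\<close> by at most \<open>\<delta> / 2\<close>; the bound 1/2 keeps
    \<open>\<sigma>\<close> away from 0.\<close>
  define \<eta> where "\<eta> = min (1/2) (\<delta> / 2 / (norm \<xi> + \<delta>))"
  have \<eta>: "\<eta> > 0" using \<delta> by (simp add: \<eta>_def add_nonneg_pos)
  have near: "P (\<sigma> *\<^sub>R x) = \<sigma> ^ k * P x" if \<sigma>: "\<sigma> \<in> ball 1 \<eta>" for \<sigma> x
  proof (rule real_analytic_identity[where C = UNIV and U = "ball \<xi> (\<delta> / 2)" and a = \<xi>])
    have lam: "\<bar>\<sigma> - 1\<bar> < \<eta>" using \<sigma> by (simp add: dist_real_def abs_minus_commute)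
    then have \<sigma>0: "\<sigma> \<noteq> 0" by (auto simp: \<eta>_def)
    fix x assume x: "x \<in> ball \<xi> (\<delta> / 2)"
    have "norm x \<le> norm \<xi> + norm (\<xi> - x)" by (metis add.commute norm_triangle_sub norm_minus_commute)
    then have nx: "norm x \<le> norm \<xi> + \<delta>" using x \<delta> by (simp add: dist_norm)
    have "\<sigma> *\<^sub>R x - x = (\<sigma> - 1) *\<^sub>R x" by (simp add: scaleR_diff_left)
    then have "norm (\<sigma> *\<^sub>R x - x) = \<bar>\<sigma> - 1\<bar> * norm x" by simp
    also have "\<dots> \<le> \<eta> * (norm \<xi> + \<delta>)" using lam nx \<eta> by (intro mult_mono) auto
    also have "\<dots> \<le> \<delta> / 2 / (norm \<xi> + \<delta>) * (norm \<xi> + \<delta>)"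
      using \<delta> by (intro mult_right_mono) (auto simp: \<eta>_def)
    also have "\<dots> = \<delta> / 2"
    proof -
      have "norm \<xi> + \<delta> \<noteq> 0" using \<delta> norm_ge_zero[of \<xi>] by linarith
      from iffD1[OF nonzero_eq_divide_eq[OF this] refl] show ?thesis .
    qed
    finally have "dist x (\<sigma> *\<^sub>R x) \<le> \<delta> / 2" by (simp add: dist_norm norm_minus_commute)
    moreover have "dist \<xi> x < \<delta> / 2" using x by simp
    ultimately have "\<sigma> *\<^sub>R x \<in> ball \<xi> \<delta>" "x \<in> ball \<xi> \<delta>"
      using dist_triangle[of \<xi> "\<sigma> *\<^sub>R x" x] \<delta> by (auto simp: dist_commute)
    then show "P (\<sigma> *\<^sub>R x) = \<sigma> ^ k * P x" using P ray_coeff_scale \<sigma>0 by simp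
  next
    show "real_analytic_at Basis x (\<lambda>x. P (\<sigma> *\<^sub>R x))" for x
      by (rule real_analytic_at_scale_arg[OF an])
    show "real_analytic_at Basis x (\<lambda>x. \<sigma> ^ k * P x)" for x
      by (intro real_analytic_at_mult real_analytic_at_const an) auto
  qed (use \<delta> in auto)
  have "P (\<sigma> *\<^sub>R x) = \<sigma> ^ k * P x"
  proof (rule real_analytic_identity[where C = UNIV and U = "ball 1 \<eta>" and a = 1 and f = "\<lambda>\<sigma>. P (\<sigma> *\<^sub>R x)" and y = \<sigma>])
    show "real_analytic_at Basis t (\<lambda>\<sigma>. P (\<sigma> *\<^sub>R x))" for t
      using real_analytic_at_affine_line[of 0 t x P] an by simp
    \<comment> \<open>The power \<open>\<sigma> ^ k\<close> is written as a product of linear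
      functionals to fit the closure rules.\<close>
    have "real_analytic_at Basis t (\<lambda>\<sigma>. (\<Prod>i<k. \<sigma> \<bullet> 1) * P x)" for t :: real
      using span_Basis[where 'a = real]
      by (intro real_analytic_at_mult real_analytic_at_const real_analytic_at_prod real_analytic_at_inner) auto
    then show "real_analytic_at Basis t (\<lambda>\<sigma>. \<sigma> ^ k * P x)" for t :: real by simp
  qed (use near \<eta> in auto)
  then show ?thesis by (simp add: P_def)
qed

text \<open>\<open>F\<close> is the sum of the interpolants, which converges on a full neighbourhood
  of 0, while agreement with \<open>h\<close> is obtained only on rays through the box where the
  bound holds. Scaled copies of a ball in that box give open sets of agreement arbitrarily close to
  0.\<close>

theorem analytic_extension:
  assumes "V \<noteq> {}"
  obtains F \<rho> K where "\<rho> > 0"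
    and "pseries Basis (coord_box Basis 0 \<rho>) (\<lambda>b x. (x - 0) \<bullet> b) \<rho> K F"
    and "\<And>\<epsilon>. \<epsilon> > 0 \<Longrightarrow> \<exists>U. open U \<and> U \<noteq> {} \<and> U \<subseteq> ball 0 \<epsilon> \<and> (\<forall>x\<in>U. h x = F x)"
proof -
  obtain \<xi> \<delta> and m :: nat where \<delta>: "\<delta> > 0" and Q: "coord_box Basis \<xi> \<delta> \<subseteq> V"
    and m: "\<And>x k. x \<in> coord_box Basis \<xi> \<delta> \<Longrightarrow> \<bar>ray_coeff h k x\<bar> \<le> real m ^ (k + 1)"
    by (rule uniform_bound_box[OF assms]) blast
  let ?u = "\<lambda>b x :: 'e. (x - 0) \<bullet> b"
  define n where "n = DIM('e)"
  define C where "C = (1 + norm \<xi> + \<delta>) / \<delta> * (2 * exp 1)"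
  have C: "C > 0" using \<delta> by (simp add: C_def add_pos_pos add_pos_nonneg)
  define P where "P k = interpolant \<xi> \<delta> k (ray_coeff h k)" for k
  \<comment> \<open>Since \<open>k + 1\<close> is at most \<open>2 ^ k\<close>, every factor of the
    norm bound fits into a k-th power. Adding 1 keeps \<open>A\<close> positive even when
    \<open>m\<close> is 0.\<close>
  define A where "A = 2 ^ n * real m * C ^ n + 1"
  have A: "A \<ge> 1" using C by (simp add: A_def)
  have ps1: "pseries Basis (coord_box Basis 0 1) ?u 1 (real m * A ^ k) (P k)" for k
  proof -
    have "pseries Basis (coord_box Basis 0 1) ?u 1 (real (k + 1) ^ n * (real m ^ (k + 1) * (C ^ k) ^ n)) (P k)"
      unfolding P_def C_def n_def by (rule pseries_interpolant[OF \<delta> m])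
    moreover have "real (k + 1) ^ n * (real m ^ (k + 1) * (C ^ k) ^ n) \<le> real m * A ^ k"
    proof -
      have "k + 1 \<le> 2 ^ k" by (simp add: Suc_le_eq)
      then have "real (k + 1) \<le> 2 ^ k" by (metis of_nat_le_iff of_nat_numeral of_nat_power)
      then have "real (k + 1) ^ n * (real m ^ (k + 1) * (C ^ k) ^ n) \<le> (2 ^ k) ^ n * (real m ^ (k + 1) * (C ^ k) ^ n)"
        using C by (intro mult_right_mono power_mono) auto
      also have "\<dots> = real m * (2 ^ n * real m * C ^ n) ^ k"
        by (simp add: power_mult_distrib power_mult[symmetric] mult.commute mult.left_commute)
      also have "\<dots> \<le> real m * A ^ k"
        using C by (intro mult_left_mono power_mono) (auto simp: A_def)
      finally show ?thesis .
    qed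
    ultimately show ?thesis by (rule pseries_mono)
  qed
  \<comment> \<open>By homogeneity, passing from radius 1 to \<open>\<rho>\<close> multiplies the
    norm of \<open>P k\<close> by \<open>\<rho> ^ k\<close>, so \<open>A ^ k\<close> becomes
    \<open>(1/2) ^ k\<close>.\<close>
  define \<rho> where "\<rho> = 1 / (2 * A)"
  have \<rho>: "\<rho> > 0" using A by (simp add: \<rho>_def)
  have homog: "P k (t *\<^sub>R x) = t ^ k * P k x" for k t x
    unfolding P_def by (rule interpolant_homogeneous[OF \<delta> Q])
  have u\<rho>: "\<bar>?u b x\<bar> \<le> \<rho>" if "x \<in> coord_box Basis 0 \<rho>" "b \<in> Basis" for x b
    using that by (rule coord_box_bound)
  have ps\<rho>: "pseries Basis (coord_box Basis 0 \<rho>) ?u \<rho> (real m * (1/2) ^ k) (P k)" for k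
  proof -
    have "pseries Basis (coord_box Basis 0 \<rho>) ?u \<rho> (real m * A ^ k) (\<lambda>x. P k ((1 / \<rho>) *\<^sub>R x))"
    proof (rule pseries_compose[where J = Basis and \<rho> = 1 and v = ?u, OF _ _ \<rho> _ u\<rho>])
      show "pseries Basis (coord_box Basis 0 \<rho>) ?u \<rho> 1 (\<lambda>x. ((1 / \<rho>) *\<^sub>R x - 0) \<bullet> b)" if "b \<in> Basis" for b
        using pseries_cmult[OF pseries_coord[where u = ?u and i = b and D = "coord_box Basis 0 \<rho>", OF finite_Basis \<rho> that], of "1 / \<rho>"] \<rho>
        by simp
      show "pseries Basis ((\<lambda>x. (1 / \<rho>) *\<^sub>R x) ` coord_box Basis 0 \<rho>) ?u 1 (real m * A ^ k) (P k)"
        by (rule pseries_subset[OF ps1]) (use \<rho> in \<open>auto simp: coord_box_def abs_mult divide_simps\<close>)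
    qed auto
    from pseries_cmult[OF this, of "\<rho> ^ k"]
    have "pseries Basis (coord_box Basis 0 \<rho>) ?u \<rho> (\<bar>\<rho> ^ k\<bar> * (real m * A ^ k)) (P k)"
      by (rule pseries_cong) (use \<rho> in \<open>simp add: homog power_divide\<close>)
    moreover have "\<bar>\<rho> ^ k\<bar> * (real m * A ^ k) = real m * (1/2) ^ k"
      using A by (simp add: \<rho>_def power_divide power_mult_distrib)
    ultimately show ?thesis by simp
  qed
  define F where "F x = (\<Sum>k. P k x)" for x
  have absP: "\<bar>P k x\<bar> \<le> real m * (1/2) ^ k" if "x \<in> coord_box Basis 0 \<rho>" for k x
    by (rule pseries_bound[OF \<rho> u\<rho> ps\<rho> that])
  have geo: "summable (\<lambda>k. real m * (1/2) ^ k)" by (intro summable_mult summable_geometric) auto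
  have Fsum: "((\<lambda>k. P k x) has_sum F x) UNIV" if x: "x \<in> coord_box Basis 0 \<rho>" for x
  proof -
    have "summable (\<lambda>k. norm (P k x))"
      by (rule summable_comparison_test'[OF geo, of 0]) (use absP[OF x] in auto)
    then show ?thesis unfolding F_def
      by (intro norm_summable_imp_has_sum summable_sums) (auto intro: summable_norm_cancel)
  qed
  have "((\<lambda>k. real m * (1/2) ^ k) has_sum (\<Sum>k. real m * (1/2) ^ k)) UNIV"
    using geo by (intro norm_summable_imp_has_sum summable_sums) auto
  from pseries_infsum[OF \<rho> u\<rho> ps\<rho> this Fsum]
  have F: "pseries Basis (coord_box Basis 0 \<rho>) ?u \<rho> (\<Sum>k. real m * (1/2) ^ k) F" by blast
  \<comment> \<open>Near 0 on the ray both functions have the same Taylor series. \<open>h\<close>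
    is analytic on the whole line through \<open>x\<close>, so the identity theorem carries equality
    out to \<open>\<tau> *\<^sub>R x\<close>, beyond the convergence radius known for
    \<open>h\<close>.\<close>
  have hF: "h (\<tau> *\<^sub>R x) = F (\<tau> *\<^sub>R x)" if x: "x \<in> ball \<xi> \<delta>" and \<tau>: "\<tau> > 0" and small: "\<tau> *\<^sub>R x \<in> ball 0 \<rho>" for x \<tau>
  proof -
    have xV: "x \<in> coord_box Basis \<xi> \<delta>" "x \<in> V" using x Q ball_subset_coord_box[of \<xi> \<delta>] by auto
    obtain r where r: "r > 0" "\<And>t. \<bar>t\<bar> < r \<Longrightarrow> (\<lambda>k. ray_coeff h k x * t ^ k) sums h (t *\<^sub>R x)"
      by (rule ray_coeff_sums[OF xV(2)]) blast
    have box: "t *\<^sub>R \<tau> *\<^sub>R x \<in> ball 0 \<rho>" if "0 \<le> t" "t \<le> 1" for t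
      using small mult_left_le_one_le[of "norm (\<tau> *\<^sub>R x)" t] that by (auto simp: mult.assoc abs_mult)
    have "h ((1 * \<tau>) *\<^sub>R x) - F (1 *\<^sub>R \<tau> *\<^sub>R x) = 0"
    proof (rule real_analytic_zero_interval[where g = "\<lambda>t. h ((t * \<tau>) *\<^sub>R x) - F (t *\<^sub>R \<tau> *\<^sub>R x)" and \<delta> = "min 1 (r / \<tau>)"])
      show "real_analytic_at Basis t (\<lambda>t. h ((t * \<tau>) *\<^sub>R x) - F (t *\<^sub>R \<tau> *\<^sub>R x))" if "0 \<le> t" "t \<le> 1" for t
      proof (rule real_analytic_at_diff)
        have "real_analytic_at Basis (0 + t *\<^sub>R \<tau>) (\<lambda>t. h (t *\<^sub>R x))" by (rule line_analytic[OF xV(2)])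
        from real_analytic_at_affine_line[OF this]
        show "real_analytic_at Basis t (\<lambda>t. h ((t * \<tau>) *\<^sub>R x))" by simp
        have "\<bar>(0 + t *\<^sub>R \<tau> *\<^sub>R x - 0) \<bullet> b\<bar> < \<rho>" if "b \<in> Basis" for b
          using Basis_le_norm[OF that, of "t *\<^sub>R \<tau> *\<^sub>R x"] box[OF \<open>0 \<le> t\<close> \<open>t \<le> 1\<close>] by simp
        from real_analytic_at_affine_line[OF pseries_imp_real_analytic_at[OF F this]]
        show "real_analytic_at Basis t (\<lambda>t. F (t *\<^sub>R \<tau> *\<^sub>R x))" by simp
      qed (use span_Basis[where 'a = real] in auto)
      show "0 < min 1 (r / \<tau>)" using r \<tau> by simp
      fix t assume t: "0 \<le> t" "t < min 1 (r / \<tau>)"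
      then have "\<bar>t * \<tau>\<bar> < r" using \<tau> by (simp add: pos_less_divide_eq abs_mult)
      from r(2)[OF this] have 1: "(\<lambda>k. P k x * (t * \<tau>) ^ k) sums h ((t * \<tau>) *\<^sub>R x)"
        using ray_coeff_interpolant[OF \<delta> Q xV(1)] by (simp add: P_def)
      have "t *\<^sub>R \<tau> *\<^sub>R x \<in> coord_box Basis 0 \<rho>" using subsetD[OF ball_subset_coord_box box[of t]] t by simp
      from has_sum_imp_sums[OF Fsum[OF this]]
      have "(\<lambda>k. P k x * (t * \<tau>) ^ k) sums F (t *\<^sub>R \<tau> *\<^sub>R x)" by (simp add: homog power_mult_distrib mult_ac)
      with 1 show "h ((t * \<tau>) *\<^sub>R x) - F (t *\<^sub>R \<tau> *\<^sub>R x) = 0" using sums_unique2 by fastforce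
    qed
    then show ?thesis by simp
  qed
  show ?thesis
  proof (rule that[OF \<rho> F])
    fix \<epsilon> :: real assume \<epsilon>: "\<epsilon> > 0"
    \<comment> \<open>Points of the ball around \<open>\<xi>\<close> have norm less than
      \<open>norm \<xi> + \<delta>\<close>, so this factor brings them within
      \<open>\<epsilon>\<close> and \<open>\<rho>\<close> of 0.\<close>
    define \<tau> where "\<tau> = min \<epsilon> \<rho> / (norm \<xi> + \<delta>)"
    have n0: "norm \<xi> + \<delta> > 0" using \<delta> by (simp add: add_nonneg_pos)
    then have \<tau>: "\<tau> > 0" using \<epsilon> \<rho> by (simp add: \<tau>_def)
    have small: "norm (\<tau> *\<^sub>R x) < min \<epsilon> \<rho>" if "x \<in> ball \<xi> \<delta>" for x
    proof -
      have "norm x \<le> norm \<xi> + norm (\<xi> - x)" by (metis add.commute norm_triangle_sub norm_minus_commute)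
      then have "norm x < norm \<xi> + \<delta>" using that by (simp add: dist_norm)
      then have "\<tau> * norm x < \<tau> * (norm \<xi> + \<delta>)" using \<tau> by simp
      also have "\<dots> = min \<epsilon> \<rho>" using n0 by (simp add: \<tau>_def)
      finally show ?thesis using \<tau> by simp
    qed
    show "\<exists>U. open U \<and> U \<noteq> {} \<and> U \<subseteq> ball 0 \<epsilon> \<and> (\<forall>x\<in>U. h x = F x)"
    proof (intro exI[of _ "(\<lambda>x. \<tau> *\<^sub>R x) ` ball \<xi> \<delta>"] conjI)
      show "open ((\<lambda>x. \<tau> *\<^sub>R x) ` ball \<xi> \<delta>)" using \<tau> by (intro open_scaling) auto
      show "\<forall>x\<in>(\<lambda>x. \<tau> *\<^sub>R x) ` ball \<xi> \<delta>. h x = F x" using hF \<tau> small by auto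
    qed (use small \<delta> in auto)
  qed
qed

end

section \<open>Analytic maps and inversion\<close>

definition analytic_map_at :: "'e::euclidean_space set \<Rightarrow> 'e \<Rightarrow> ('e \<Rightarrow> 'f::euclidean_space) \<Rightarrow> bool" where
  "analytic_map_at B a \<theta> \<longleftrightarrow> (\<forall>v. real_analytic_at B a (\<lambda>x. \<theta> x \<bullet> v))"

lemma analytic_map_atI: "(\<And>v. real_analytic_at B a (\<lambda>x. \<theta> x \<bullet> v)) \<Longrightarrow> analytic_map_at B a \<theta>"
  by (simp add: analytic_map_at_def)

lemma analytic_map_atD: "analytic_map_at B a \<theta> \<Longrightarrow> real_analytic_at B a (\<lambda>x. \<theta> x \<bullet> v)"
  by (simp add: analytic_map_at_def)

lemma real_analytic_at_compose_map:
  assumes "B \<subseteq> Basis" "a \<in> span B" "analytic_map_at B a \<theta>" "real_analytic_at Basis (\<theta> a) G"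
  shows "real_analytic_at B a (\<lambda>x. G (\<theta> x))"
proof (rule real_analytic_at_compose[where B' = Basis and d = 1 and \<theta> = \<theta> and G = G])
  show "\<theta> x \<in> span Basis" for x by (simp only: span_Basis UNIV_I)
qed (use assms analytic_map_atD in auto)

lemma analytic_map_at_compose:
  assumes "B \<subseteq> Basis" "a \<in> span B" "analytic_map_at B a \<theta>" "analytic_map_at Basis (\<theta> a) \<eta>"
  shows "analytic_map_at B a (\<lambda>x. \<eta> (\<theta> x))"
proof (rule analytic_map_atI)
  show "real_analytic_at B a (\<lambda>x. \<eta> (\<theta> x) \<bullet> v)" for v
    by (rule real_analytic_at_compose_map[OF assms(1-3) analytic_map_atD[OF assms(4)]])
qed

lemma analytic_map_at_linear:
  assumes "B \<subseteq> Basis" "a \<in> span B" "linear L"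
  shows "analytic_map_at B a L"
proof (rule analytic_map_atI)
  fix v
  have "linear (\<lambda>x. L x \<bullet> v)"
    using linear_compose[OF assms(3) bounded_linear.linear[OF bounded_linear_inner_left[of v]]] by (simp add: o_def)
  then show "real_analytic_at B a (\<lambda>x. L x \<bullet> v)" by (rule real_analytic_at_linear[OF assms(1,2)])
qed

lemma analytic_map_at_add_const:
  assumes "B \<subseteq> Basis" "a \<in> span B" "analytic_map_at B a \<theta>"
  shows "analytic_map_at B a (\<lambda>x. c + \<theta> x)" "analytic_map_at B a (\<lambda>x. \<theta> x - c)"
proof -
  show "analytic_map_at B a (\<lambda>x. c + \<theta> x)"
    using real_analytic_at_add[OF assms(1,2) real_analytic_at_const[OF assms(1,2)] analytic_map_atD[OF assms(3)]]
    by (intro analytic_map_atI) (simp add: inner_add_left)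
  show "analytic_map_at B a (\<lambda>x. \<theta> x - c)"
    using real_analytic_at_diff[OF assms(1,2) analytic_map_atD[OF assms(3)] real_analytic_at_const[OF assms(1,2)]]
    by (intro analytic_map_atI) (simp add: inner_diff_left)
qed

text \<open>The junk value \<open>inversion 0 = 0\<close> makes this an involution of the whole space.\<close>

definition inversion :: "'e::euclidean_space \<Rightarrow> 'e" where
  "inversion z = (1 / (z \<bullet> z)) *\<^sub>R z"

lemma inversion_inversion [simp]: "inversion (inversion z) = z"
  by (cases "z = 0") (auto simp: inversion_def)

lemma inversion_eq_0_iff [simp]: "inversion z = 0 \<longleftrightarrow> z = 0"
  by (auto simp: inversion_def)

lemma inversion_inner: "inversion z \<bullet> m = (z \<bullet> m) / (z \<bullet> z)"
  by (simp add: inversion_def)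

lemma inversion_inner_self: "inversion z \<bullet> inversion z = 1 / (z \<bullet> z)"
  by (cases "z = 0") (auto simp: inversion_def)

lemma continuous_on_inversion: "continuous_on (- {0}) inversion"
  unfolding inversion_def by (intro continuous_intros) auto

lemma analytic_inversion:
  fixes a :: "'e::euclidean_space"
  assumes "a \<noteq> 0"
  shows "analytic_map_at Basis a inversion"
proof (rule analytic_map_atI)
  fix v
  have "real_analytic_at Basis a (\<lambda>z. \<Sum>b\<in>Basis. (z \<bullet> b) * (z \<bullet> b))"
    by (intro real_analytic_at_sum real_analytic_at_mult real_analytic_at_inner) auto
  then have "real_analytic_at Basis a (\<lambda>z. z \<bullet> z)" by (simp add: euclidean_inner[symmetric])
  then have "real_analytic_at Basis a (\<lambda>z. inverse (z \<bullet> z) * (z \<bullet> v))"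
    using assms by (intro real_analytic_at_mult real_analytic_at_inverse real_analytic_at_inner) auto
  then show "real_analytic_at Basis a (\<lambda>z. inversion z \<bullet> v)"
    by (simp add: inversion_inner divide_inverse mult.commute)
qed

section \<open>Charts of the maximal atlas\<close>

lemma open_iff_openin_span_Basis: "openin (top_of_set (span Basis)) W \<longleftrightarrow> open (W :: 'e::euclidean_space set)"
  by (simp only: span_Basis open_openin subtopology_UNIV)

lemma real_analytic_on_cong:
  assumes "real_analytic_on B g W" "\<And>x. x \<in> W \<Longrightarrow> g x = g' x"
  shows "real_analytic_on B g' W"
  unfolding real_analytic_on_def
proof (intro conjI ballI)
  show "openin (top_of_set (span B)) W" using assms(1) by (simp add: real_analytic_on_def)
  fix a assume "a \<in> W"
  then obtain c r where "0 < r" "\<forall>x \<in> W \<inter> ball a r.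
      ((\<lambda>\<alpha>. (\<Prod>b\<in>B. ((x - a) \<bullet> b) ^ \<alpha> b) *\<^sub>R c \<alpha>) has_sum g x) (B \<rightarrow>\<^sub>E UNIV)"
    using assms(1) unfolding real_analytic_on_def by blast
  then show "\<exists>c r. 0 < r \<and> (\<forall>x \<in> W \<inter> ball a r.
      ((\<lambda>\<alpha>. (\<Prod>b\<in>B. ((x - a) \<bullet> b) ^ \<alpha> b) *\<^sub>R c \<alpha>) has_sum g' x) (B \<rightarrow>\<^sub>E UNIV))"
    by (intro exI[of _ c] exI[of _ r]) (simp add: assms(2))
qed

lemma analytic_map_at_if_real_analytic_on:
  assumes "real_analytic_on B g W" "B \<subseteq> Basis" "a \<in> W"
  shows "analytic_map_at B a g"
  using real_analytic_onD[OF assms(2,1,3)] by (intro analytic_map_atI)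

lemma real_analytic_on_Basis_iff:
  "real_analytic_on Basis g W \<longleftrightarrow> open W \<and> (\<forall>a\<in>W. analytic_map_at Basis a g)"
proof
  assume g: "real_analytic_on Basis g W"
  then have "open W" using open_iff_openin_span_Basis unfolding real_analytic_on_def by blast
  then show "open W \<and> (\<forall>a\<in>W. analytic_map_at Basis a g)"
    using analytic_map_at_if_real_analytic_on[OF g] by auto
next
  assume "open W \<and> (\<forall>a\<in>W. analytic_map_at Basis a g)"
  then show "real_analytic_on Basis g W"
    by (intro real_analytic_onI) (auto simp: open_iff_openin_span_Basis intro: analytic_map_atD)
qed

context
  fixes X :: "'a topology" and U :: "'a set" and \<phi> :: "'a \<Rightarrow> 'e::euclidean_space"
  assumes chart: "chart Basis X U \<phi>"
begin

lemma chart_open: "open (\<phi> ` U)"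
  using chart open_iff_openin_span_Basis unfolding chart_def by blast

lemma chart_subset: "U \<subseteq> topspace X"
  using chart unfolding chart_def by (auto dest: openin_subset)

lemma chart_homeo: "homeomorphic_map (subtopology X U) (top_of_set (\<phi> ` U)) \<phi>"
  using chart unfolding chart_def by blast

lemma chart_inj: "inj_on \<phi> U"
  using homeomorphic_imp_injective_map[OF chart_homeo] chart_subset by (simp add: Int_absorb1)

lemma chart_inv: "p \<in> U \<Longrightarrow> inv_into U \<phi> (\<phi> p) = p"
  using chart_inj by simp

lemma chart_image_open:
  assumes "openin X W"
  shows "open (\<phi> ` (U \<inter> W))"
proof -
  have "openin (subtopology X U) (U \<inter> W)" using assms by (rule openin_subtopology_Int2)
  then have "openin (top_of_set (\<phi> ` U)) (\<phi> ` (U \<inter> W))"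
    using homeomorphic_imp_open_map[OF chart_homeo] unfolding open_map_def by blast
  then show ?thesis using chart_open by (rule openin_open_trans)
qed

lemma chart_preimage_open:
  assumes "open E"
  shows "openin X {p\<in>U. \<phi> p \<in> E}"
proof -
  have "continuous_map (subtopology X U) (top_of_set (\<phi> ` U)) \<phi>"
    using homeomorphic_imp_continuous_map[OF chart_homeo] .
  moreover have "openin (top_of_set (\<phi> ` U)) (\<phi> ` U \<inter> E)" using assms by (rule openin_open_Int)
  ultimately have "openin (subtopology X U) {p \<in> topspace (subtopology X U). \<phi> p \<in> \<phi> ` U \<inter> E}"
    by (rule openin_continuous_map_preimage)
  moreover have "{p \<in> topspace (subtopology X U). \<phi> p \<in> \<phi> ` U \<inter> E} = {p\<in>U. \<phi> p \<in> E}"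
    using chart_subset by (auto simp: topspace_subtopology_subset)
  ultimately show ?thesis using chart openin_trans_full unfolding chart_def by fastforce
qed

end

text \<open>Slice charts must come from the maximal atlas. A chart of \<open>A\<close> followed by
  an analytic diffeomorphism stays compatible with \<open>A\<close>, because its transition maps
  factor through those of the original chart.\<close>

lemma maximal_atlas_reparametrization:
  fixes X :: "'a topology" and \<theta> \<theta>' :: "'e::euclidean_space \<Rightarrow> 'e"
  assumes at: "analytic_atlas Basis X A" and U: "(U, \<phi>) \<in> A"
    and E: "open E" "E \<subseteq> \<phi> ` U" and E': "open E'" "\<theta> ` E = E'"
    and inv: "\<And>y. y \<in> E \<Longrightarrow> \<theta>' (\<theta> y) = y"
    and cont: "continuous_on E \<theta>" "continuous_on E' \<theta>'"
    and an: "\<And>y. y \<in> E \<Longrightarrow> analytic_map_at Basis y \<theta>" "\<And>y. y \<in> E' \<Longrightarrow> analytic_map_at Basis y \<theta>'"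
  shows "({p\<in>U. \<phi> p \<in> E}, \<lambda>p. \<theta> (\<phi> p)) \<in> maximal_atlas Basis X A"
proof -
  define W where "W = {p\<in>U. \<phi> p \<in> E}"
  define \<psi> where "\<psi> = (\<lambda>p. \<theta> (\<phi> p))"
  have cU: "chart Basis X U \<phi>" using at U by (auto simp: analytic_atlas_def)
  have W: "openin X W" unfolding W_def by (rule chart_preimage_open[OF cU E(1)])
  have WU: "W \<subseteq> U" by (auto simp: W_def)
  have \<phi>W: "\<phi> ` W = E" using E(2) by (auto simp: W_def)
  have \<psi>W: "\<psi> ` W = E'" unfolding \<psi>_def using \<phi>W E'(2) by force
  have inj: "inj_on \<psi> W"
    using chart_inj[OF cU] inv by (auto simp: inj_on_def \<psi>_def W_def) metis
  have "homeomorphic_map (subtopology (subtopology X U) W) (subtopology (top_of_set (\<phi> ` U)) E) \<phi>"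
  proof (rule homeomorphic_map_subtopologies[OF chart_homeo[OF cU]])
    have "topspace (subtopology X U) \<inter> W = W" using WU chart_subset[OF cU] by auto
    then show "\<phi> ` (topspace (subtopology X U) \<inter> W) = topspace (top_of_set (\<phi> ` U)) \<inter> E"
      using \<phi>W E(2) by auto
  qed
  moreover have "U \<inter> W = W" "\<phi> ` U \<inter> E = E" using WU E(2) by auto
  ultimately have h1: "homeomorphic_map (subtopology X W) (top_of_set E) \<phi>"
    by (simp only: subtopology_subtopology)
  have "homeomorphic_maps (top_of_set E) (top_of_set E') \<theta> \<theta>'"
    unfolding homeomorphic_maps_def using cont E'(2) inv by (auto simp: continuous_map_in_subtopology)
  then have h2: "homeomorphic_map (top_of_set E) (top_of_set E') \<theta>"
    using homeomorphic_map_maps by blast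
  have chartW: "chart Basis X W \<psi>"
    unfolding chart_def \<psi>W
    using W iffD2[OF open_iff_openin_span_Basis E'(1)] homeomorphic_map_compose[OF h1 h2]
    unfolding o_def \<psi>_def by blast
  have "analytically_compatible Basis W \<psi> V \<kappa>" if V: "(V, \<kappa>) \<in> A" for V \<kappa>
  proof -
    have cV: "chart Basis X V \<kappa>" using at V by (auto simp: analytic_atlas_def)
    have "analytically_compatible Basis U \<phi> V \<kappa>" using at U V by (auto simp: analytic_atlas_def)
    then have t1: "\<And>y. y \<in> \<phi> ` (U \<inter> V) \<Longrightarrow> analytic_map_at Basis y (\<kappa> \<circ> inv_into U \<phi>)"
        and t2: "\<And>y. y \<in> \<kappa> ` (U \<inter> V) \<Longrightarrow> analytic_map_at Basis y (\<phi> \<circ> inv_into V \<kappa>)"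
      by (auto simp: analytically_compatible_def real_analytic_on_Basis_iff)
    have oV: "openin X V" using cV by (simp add: chart_def)
    \<comment> \<open>The change from \<open>\<psi>\<close> to \<open>\<kappa>\<close> is
      \<open>\<theta>'\<close> followed by the change from \<open>\<phi>\<close> to
      \<open>\<kappa>\<close>, which is analytic because both charts belong to
      \<open>A\<close>.\<close>
    have "real_analytic_on Basis (\<lambda>x. (\<kappa> \<circ> inv_into U \<phi>) (\<theta>' x)) (\<psi> ` (W \<inter> V))"
      unfolding real_analytic_on_Basis_iff
    proof (intro conjI ballI)
      show "open (\<psi> ` (W \<inter> V))" by (rule chart_image_open[OF chartW oV])
      fix x assume "x \<in> \<psi> ` (W \<inter> V)"
      then obtain p where p: "p \<in> W" "p \<in> V" "x = \<theta> (\<phi> p)" by (auto simp: \<psi>_def)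
      then have "\<theta>' x = \<phi> p" "x \<in> E'" using inv E'(2) by (auto simp: W_def)
      then show "analytic_map_at Basis x (\<lambda>x. (\<kappa> \<circ> inv_into U \<phi>) (\<theta>' x))"
        using an(2) t1[of "\<phi> p"] p WU
        by (intro analytic_map_at_compose[where \<theta> = \<theta>' and \<eta> = "\<kappa> \<circ> inv_into U \<phi>"]) (auto simp del: o_apply)
    qed
    then have 1: "real_analytic_on Basis (\<kappa> \<circ> inv_into W \<psi>) (\<psi> ` (W \<inter> V))"
    proof (rule real_analytic_on_cong)
      fix x assume "x \<in> \<psi> ` (W \<inter> V)"
      then obtain p where p: "p \<in> W" "x = \<psi> p" by auto
      then have "inv_into W \<psi> x = p" using inj by simp
      moreover have "\<theta>' x = \<phi> p" using inv p by (auto simp: \<psi>_def W_def)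
      ultimately show "(\<kappa> \<circ> inv_into U \<phi>) (\<theta>' x) = (\<kappa> \<circ> inv_into W \<psi>) x"
        using p WU chart_inv[OF cU] by auto
    qed
    have 2: "real_analytic_on Basis (\<psi> \<circ> inv_into V \<kappa>) (\<kappa> ` (W \<inter> V))"
      unfolding real_analytic_on_Basis_iff
    proof (intro conjI ballI)
      show "open (\<kappa> ` (W \<inter> V))" using chart_image_open[OF cV W] by (simp add: Int_commute)
      fix x assume "x \<in> \<kappa> ` (W \<inter> V)"
      then obtain p where p: "p \<in> W" "p \<in> V" "x = \<kappa> p" by auto
      then have "(\<phi> \<circ> inv_into V \<kappa>) x = \<phi> p" using chart_inv[OF cV] by auto
      moreover have "\<phi> p \<in> E" "x \<in> \<kappa> ` (U \<inter> V)" using p WU by (auto simp: W_def)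
      ultimately have "analytic_map_at Basis x (\<lambda>x. \<theta> ((\<phi> \<circ> inv_into V \<kappa>) x))"
        using an(1)[of "\<phi> p"] t2[of x]
        by (intro analytic_map_at_compose[where \<theta> = "\<phi> \<circ> inv_into V \<kappa>" and \<eta> = \<theta>]) (auto simp del: o_apply)
      then show "analytic_map_at Basis x (\<psi> \<circ> inv_into V \<kappa>)" by (simp add: \<psi>_def o_def)
    qed
    from 1 2 show ?thesis by (simp add: analytically_compatible_def)
  qed
  with chartW show ?thesis unfolding maximal_atlas_def W_def[symmetric] \<psi>_def[symmetric] by auto
qed

text \<open>Slice charts have to flatten onto a coordinate plane, so the plane of \<open>v\<close>
  and \<open>w\<close> is straightened by completing the pair to a basis and matching it with the
  standard one.\<close>

lemma linear_isomorphism_of_pair: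
  fixes v w b1 b2 :: "'e::euclidean_space"
  assumes vw: "independent {v, w}" "v \<noteq> w" and b: "b1 \<in> Basis" "b2 \<in> Basis" "b1 \<noteq> b2"
  obtains L L' where "linear L" "linear L'" "\<And>x. L (L' x) = x" "\<And>x. L' (L x) = x" "L' b1 = v" "L' b2 = w"
proof -
  obtain C where C: "{v, w} \<subseteq> C" "C \<subseteq> UNIV" "independent C" "UNIV \<subseteq> span C"
    by (rule maximal_independent_subset_extend[OF subset_UNIV vw(1)])
  have finC: "finite C" using C(3) by (rule independent_imp_finite)
  have "card C = DIM('e)" 
  proof -
    have "dim C = DIM('e)" using C(4) by (simp add: dim_eq_full top.extremum_unique)
    then show ?thesis using dim_eq_card_independent[OF C(3)] by simp
  qed
  then have "card (Basis - {b1, b2}) = card (C - {v, w})"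
    using C(1) b vw(2) finC by (simp add: card_Diff_subset)
  then obtain \<pi> where \<pi>: "bij_betw \<pi> (Basis - {b1, b2}) (C - {v, w})"
    using finite_same_card_bij[of "Basis - {b1, b2}" "C - {v, w}"] finC by auto
  define \<sigma> where "\<sigma> b = (if b = b1 then v else if b = b2 then w else \<pi> b)" for b
  define L' where "L' x = (\<Sum>b\<in>Basis. (x \<bullet> b) *\<^sub>R \<sigma> b)" for x
  have lin: "linear L'"
    unfolding L'_def by (intro linear_compose_sum ballI) (auto intro!: linearI simp: inner_add_left scaleR_add_left)
  have L'b: "L' b = \<sigma> b" if "b \<in> Basis" for b
  proof -
    have "L' b = (\<Sum>b'\<in>Basis. if b' = b then \<sigma> b else 0)"
      unfolding L'_def using that by (intro sum.cong) (auto simp: inner_Basis)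
    then show ?thesis using that by simp
  qed
  have "C \<subseteq> range L'"
  proof
    fix c assume c: "c \<in> C"
    consider "c = v" | "c = w" | "c \<in> C - {v, w}" using c by blast
    then show "c \<in> range L'"
    proof cases
      case 3
      then have "c \<in> \<pi> ` (Basis - {b1, b2})" using bij_betw_imp_surj_on[OF \<pi>] by simp
      then obtain b' where "b' \<in> Basis - {b1, b2}" "\<pi> b' = c" by blast
      then show ?thesis using L'b[of b'] by (auto simp: \<sigma>_def intro: range_eqI[of _ _ b'])
    qed (use L'b b in \<open>auto simp: \<sigma>_def image_iff intro: bexI[of _ b1] bexI[of _ b2]\<close>, metis+)
  qed
  then have "span C \<subseteq> range L'" using lin by (intro span_minimal) (auto intro: linear_subspace_image subspace_UNIV)
  then have "surj L'" using C(4) by blast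
  from linear_surjective_isomorphism[OF lin this]
  obtain L where "linear L" "\<And>x. L (L' x) = x" "\<And>x. L' (L x) = x" by blast
  with lin L'b b that show ?thesis by (auto simp: \<sigma>_def)
qed

section \<open>Round spheres as submanifolds\<close>

text \<open>The sphere through \<open>q\<close> and \<open>q + m\<close> centred at \<open>q + m / 2\<close> in the affine space \<open>q + T\<close>.\<close>

definition round_sphere :: "'e::euclidean_space \<Rightarrow> 'e \<Rightarrow> 'e set \<Rightarrow> 'e set" where
  "round_sphere q m T = {y. y - q \<in> T \<and> (y - q) \<bullet> m = (y - q) \<bullet> (y - q)}"

text \<open>The two ends of the diameter play symmetric roles. Inversion at either end gives a chart
  that misses only that end, so two such charts cover the sphere.\<close>

lemma round_sphere_antipode:
  assumes "subspace T" "m \<in> T"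
  shows "round_sphere (q + m) (- m) T = round_sphere q m T"
proof -
  have "y - (q + m) \<in> T \<longleftrightarrow> y - q \<in> T" for y
    using subspace_diff[OF assms(1) _ assms(2), of "y - q"] subspace_add[OF assms(1) _ assms(2), of "y - (q + m)"]
    by (auto simp: algebra_simps)
  moreover have "(y - (q + m)) \<bullet> - m = (y - (q + m)) \<bullet> (y - (q + m)) \<longleftrightarrow> (y - q) \<bullet> m = (y - q) \<bullet> (y - q)" for y
    by (auto simp: algebra_simps inner_commute)
  ultimately show ?thesis unfolding round_sphere_def by simp
qed

lemma round_sphere_subset_cball: "round_sphere q m T \<subseteq> cball q (norm m)"
proof
  fix y assume "y \<in> round_sphere q m T"
  then have "norm (y - q) * norm (y - q) \<le> norm (y - q) * norm m"
    using norm_cauchy_schwarz[of "y - q" m] by (simp add: round_sphere_def dot_square_norm power2_eq_square)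
  then have "norm (y - q) \<le> norm m"
    by (cases "norm (y - q) = 0") (auto simp: mult_le_cancel_left)
  then show "y \<in> cball q (norm m)" by (simp add: dist_norm norm_minus_commute)
qed

lemma round_sphere_homeomorphic:
  fixes q m :: "'e::euclidean_space"
  assumes T: "subspace T" "dim T = 3" and m: "m \<in> T" "m \<noteq> 0"
  shows "top_of_set (round_sphere q m T) homeomorphic_space top_of_set (sphere (0 :: real^3) 1)"
proof -
  obtain f :: "real^3 \<Rightarrow> 'e" where f: "linear f" "f ` UNIV = T" "\<And>x. norm (f x) = norm x"
  proof (rule isometry_subspaces[OF subspace_UNIV T(1)])
    show "dim (UNIV :: (real^3) set) = dim T" using T(2) by simp
  qed auto
  define r where "r = norm m / 2"
  have r: "r > 0" using m by (simp add: r_def)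
  define g where "g x = q + (1/2) *\<^sub>R m + r *\<^sub>R f x" for x
  have rr: "r * r = m \<bullet> m / 4" by (simp add: r_def dot_square_norm power2_eq_square)
  have "g ` sphere 0 1 = round_sphere q m T"
  proof (intro equalityI subsetI)
    fix y assume "y \<in> g ` sphere 0 1"
    then obtain x where x: "norm x = 1" "y = g x" by auto
    have ff: "f x \<bullet> f x = 1" using f(3)[of x] x(1) by (simp add: dot_square_norm)
    have yq: "y - q = (1/2) *\<^sub>R m + r *\<^sub>R f x" by (simp add: x(2) g_def)
    have "f x \<in> T" using f(2) by blast
    then have "y - q \<in> T" unfolding yq by (intro subspace_add subspace_scale T m)
    moreover have "(y - q) \<bullet> (y - q) = m \<bullet> m / 4 + r * (f x \<bullet> m) + (r * r) * (f x \<bullet> f x)"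
      unfolding yq by (simp add: inner_add_left inner_add_right inner_commute[of m "f x"] add_divide_distrib distrib_left)
    then have "(y - q) \<bullet> (y - q) = m \<bullet> m / 2 + r * (f x \<bullet> m)" using rr ff by simp
    ultimately show "y \<in> round_sphere q m T"
      using arg_cong[OF yq, of "\<lambda>u. u \<bullet> m"] by (simp add: round_sphere_def inner_add_left)
  next
    fix y assume y: "y \<in> round_sphere q m T"
    define z where "z = (1 / r) *\<^sub>R (y - q - (1/2) *\<^sub>R m)"
    have "z \<in> T" unfolding z_def using y m(1) T(1)
      by (auto simp: round_sphere_def intro!: subspace_scale subspace_diff)
    then obtain x where x: "f x = z" using f(2) by blast
    \<comment> \<open>Completing the square turns the defining equation into distance
      \<open>r\<close> from the centre \<open>q + m / 2\<close>.\<close>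
    have "(y - q - (1/2) *\<^sub>R m) \<bullet> (y - q - (1/2) *\<^sub>R m) = (y - q) \<bullet> (y - q) - (y - q) \<bullet> m + m \<bullet> m / 4"
      by (simp add: inner_diff_left inner_diff_right inner_commute)
    also have "\<dots> = m \<bullet> m / 4" using y by (simp add: round_sphere_def)
    finally have d: "(y - q - (1/2) *\<^sub>R m) \<bullet> (y - q - (1/2) *\<^sub>R m) = m \<bullet> m / 4" .
    have "z \<bullet> z = (1 / (r * r)) * ((y - q - (1/2) *\<^sub>R m) \<bullet> (y - q - (1/2) *\<^sub>R m))" by (simp add: z_def)
    then have "z \<bullet> z = (1 / (r * r)) * (m \<bullet> m / 4)" unfolding d .
    then have "z \<bullet> z = 1" using r unfolding rr[symmetric] by simp
    then have "norm x = 1" using f(3)[of x] x by (simp add: norm_eq_sqrt_inner)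
    moreover have "y = g x" using r by (simp add: g_def x z_def)
    ultimately show "y \<in> g ` sphere 0 1" by auto
  qed
  moreover have "continuous_on (sphere 0 1) g"
    unfolding g_def using linear_continuous_on[OF linear_conv_bounded_linear[THEN iffD1, OF f(1)]]
    by (intro continuous_intros) auto
  moreover have "inj_on g (sphere 0 1)"
  proof (rule inj_onI)
    fix x x' assume "g x = g x'"
    then have "f (x - x') = 0" using r by (simp add: g_def linear_diff[OF f(1)])
    then show "x = x'" using f(3)[of "x - x'"] by simp
  qed
  ultimately have "sphere (0 :: real^3) 1 homeomorphic round_sphere q m T"
    using homeomorphic_compact[OF compact_sphere] by blast
  then obtain h h' where "homeomorphism (sphere (0 :: real^3) 1) (round_sphere q m T) h h'"
    unfolding homeomorphic_def by blast
  then have "homeomorphic_maps (top_of_set (round_sphere q m T)) (top_of_set (sphere (0 :: real^3) 1)) h' h"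
    unfolding homeomorphic_maps_def homeomorphism_def by (auto simp: continuous_map_in_subtopology)
  then show ?thesis unfolding homeomorphic_space_def by blast
qed

text \<open>Dividing the equation of the sphere by the squared distance to \<open>q\<close> gives z
  . m = 1 for z = \<open>inversion (y - q)\<close>. Inside \<open>T\<close> this is the affine plane
  through \<open>z1\<close> in the directions \<open>v\<close> and \<open>w\<close>, which
  \<open>L\<close> straightens. The last claim makes the inverse of the slice chart explicit, so
  that analyticity on the sphere can be read as analyticity on the plane.\<close>

lemma inversion_chart:
  fixes q z1 v w m b1 b2 :: "'e::euclidean_space" and A :: "('a, 'e) atlas"
  assumes at: "analytic_atlas Basis X A" and U: "(U, \<phi>) \<in> A"
    and m: "z1 \<bullet> m = 1" "v \<bullet> m = 0" "w \<bullet> m = 0" and T: "T = span {z1, v, w}"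
    and S: "round_sphere q m T \<subseteq> \<phi> ` U"
    and N: "N = {p\<in>U. \<phi> p \<in> round_sphere q m T}"
    and L: "linear L" "linear L'" "\<And>x. L (L' x) = x" "\<And>x. L' (L x) = x" "L' b1 = v" "L' b2 = w"
    and \<psi>: "\<psi> = (\<lambda>p. L (inversion (\<phi> p - q) - z1))"
  shows "({p\<in>N. \<phi> p \<noteq> q}, \<psi>) \<in> slice_atlas {b1, b2} X A N"
    and "\<psi> ` {p\<in>N. \<phi> p \<noteq> q} = span {b1, b2}"
    and "\<And>x. x \<in> span {b1, b2} \<Longrightarrow> inv_into {p\<in>N. \<phi> p \<noteq> q} \<psi> x = inv_into U \<phi> (q + inversion (z1 + L' x))"
proof -
  have cU: "chart Basis X U \<phi>" using at U by (auto simp: analytic_atlas_def)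
  define \<theta> where "\<theta> y = L (inversion (y - q) - z1)" for y
  define \<theta>' where "\<theta>' x = q + inversion (z1 + L' x)" for x
  define E where "E = \<phi> ` U - {q}"
  \<comment> \<open>With \<open>inversion 0 = 0\<close> the maps \<open>\<theta>\<close> and
    \<open>\<theta>'\<close> are mutually inverse everywhere. Continuity and analyticity of
    \<open>\<theta>'\<close> are claimed only on \<open>G\<close>, where the argument of the
    inversion is nonzero.\<close>
  define G where "G = {x. z1 + L' x \<noteq> 0}"
  have contL: "continuous_on S L" "continuous_on S L'" for S
    using L(1,2) linear_continuous_on linear_conv_bounded_linear by blast+
  have inv1: "\<theta>' (\<theta> y) = y" for y by (simp add: \<theta>_def \<theta>'_def L)
  have inv2: "\<theta> (\<theta>' x) = x" for x by (simp add: \<theta>_def \<theta>'_def L)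
  have E: "open E" unfolding E_def using chart_open[OF cU] by (intro open_Diff) auto
  have contG: "continuous_on G \<theta>'"
    unfolding \<theta>'_def
    by (intro continuous_intros continuous_on_compose2[OF continuous_on_inversion, of _ "\<lambda>x. z1 + L' x"] contL)
       (auto simp: G_def)
  have contE: "continuous_on E \<theta>"
    unfolding \<theta>_def
    by (intro continuous_intros continuous_on_compose2[OF contL(1)[of UNIV], of _ "\<lambda>y. inversion (y - q) - z1"]
         continuous_on_compose2[OF continuous_on_inversion, of _ "\<lambda>y. y - q"]) (auto simp: E_def)
  have E'eq: "\<theta> ` E = G \<inter> \<theta>' -` (\<phi> ` U)"
  proof (intro equalityI subsetI)
    fix x assume "x \<in> \<theta> ` E"
    then obtain y where y: "y \<in> E" "x = \<theta> y" by auto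
    then have "z1 + L' x = inversion (y - q)" by (simp add: \<theta>_def L)
    then show "x \<in> G \<inter> \<theta>' -` (\<phi> ` U)" using y inv1 by (auto simp: G_def E_def)
  next
    fix x assume "x \<in> G \<inter> \<theta>' -` (\<phi> ` U)"
    then have "\<theta>' x \<in> E" by (auto simp: G_def E_def \<theta>'_def)
    then show "x \<in> \<theta> ` E" using inv2 by (metis imageI)
  qed
  have "open G" unfolding G_def by (intro open_Collect_neq continuous_intros contL)
  then have E': "open (\<theta> ` E)"
    unfolding E'eq using chart_open[OF cU] contG by (intro continuous_open_preimage)
  have max: "({p\<in>U. \<phi> p \<in> E}, \<lambda>p. \<theta> (\<phi> p)) \<in> maximal_atlas Basis X A"
  proof (rule maximal_atlas_reparametrization[OF at U E _ E' refl])
    show "continuous_on (\<theta> ` E) \<theta>'" using contG by (rule continuous_on_subset) (use E'eq in auto)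
    show "analytic_map_at Basis y \<theta>" if "y \<in> E" for y
      unfolding \<theta>_def
    proof (rule analytic_map_at_compose[where \<eta> = L and \<theta> = "\<lambda>y. inversion (y - q) - z1"])
      have "analytic_map_at Basis y (\<lambda>y. y - q)"
        by (intro analytic_map_at_add_const analytic_map_at_linear linear_ident) auto
      then have "analytic_map_at Basis y (\<lambda>y. inversion (y - q))"
        using that by (intro analytic_map_at_compose[where \<theta> = "\<lambda>y. y - q" and \<eta> = inversion] analytic_inversion) (auto simp: E_def)
      then show "analytic_map_at Basis y (\<lambda>y. inversion (y - q) - z1)" by (intro analytic_map_at_add_const) auto
    qed (auto intro: analytic_map_at_linear L)
    show "analytic_map_at Basis x \<theta>'" if "x \<in> \<theta> ` E" for x
      unfolding \<theta>'_def
    proof (rule analytic_map_at_add_const)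
      have "analytic_map_at Basis x (\<lambda>x. z1 + L' x)"
        by (intro analytic_map_at_add_const analytic_map_at_linear L) auto
      then show "analytic_map_at Basis x (\<lambda>x. inversion (z1 + L' x))"
        using that E'eq by (intro analytic_map_at_compose[where \<theta> = "\<lambda>x. z1 + L' x" and \<eta> = inversion] analytic_inversion) (auto simp: G_def)
    qed auto
  qed (use inv1 contE in \<open>auto simp: E_def\<close>)
  have orth: "u \<bullet> m = 0" if "u \<in> span {v, w}" for u
    using span_minimal[of "{v, w}" "{u. m \<bullet> u = 0}"] subspace_hyperplane[of m] m that by (auto simp: inner_commute)
  have spanL': "span {v, w} = L' ` span {b1, b2}"
    using linear_span_image[OF L(2), of "{b1, b2}"] L(5,6) by simp
  have forth: "\<theta> y \<in> span {b1, b2}" if y: "y \<in> round_sphere q m T" "y \<noteq> q" for y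
  proof -
    define z where "z = inversion (y - q)"
    have "(y - q) \<bullet> (y - q) \<noteq> 0" using y(2) by simp
    then have zm: "z \<bullet> m = 1" using y(1) by (simp add: z_def inversion_inner round_sphere_def)
    have "z \<in> span (insert z1 {v, w})" unfolding z_def inversion_def using y(1) T
      by (auto simp: round_sphere_def intro: span_scale)
    then obtain \<alpha> where \<alpha>: "z - \<alpha> *\<^sub>R z1 \<in> span {v, w}" using span_breakdown_eq by blast
    \<comment> \<open>Pairing with \<open>m\<close> kills \<open>v\<close> and \<open>w\<close> and
      so reads off the coefficient of \<open>z1\<close>.\<close>
    from orth[OF this] have "\<alpha> = 1" using zm m(1) by (simp add: inner_diff_left)
    then obtain x where "x \<in> span {b1, b2}" "z - z1 = L' x" using \<alpha> spanL' by auto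
    then show ?thesis by (simp add: \<theta>_def z_def[symmetric] L)
  qed
  have onto: "\<theta>' x \<in> round_sphere q m T" "\<theta>' x \<noteq> q" if x: "x \<in> span {b1, b2}" for x
  proof -
    define z where "z = z1 + L' x"
    have L'x: "L' x \<in> span {v, w}" using x spanL' by auto
    have zm: "z \<bullet> m = 1" using orth[OF L'x] m by (simp add: z_def inner_add_left)
    then have "z \<noteq> 0" by auto
    then show "\<theta>' x \<noteq> q" by (simp add: \<theta>'_def z_def)
    have "L' x \<in> T" using L'x span_mono[of "{v, w}" "{z1, v, w}"] T by blast
    then have "z \<in> T" unfolding z_def using T by (auto intro: span_add span_base)
    then have "inversion z \<in> T" unfolding inversion_def T by (rule span_scale)
    moreover have "inversion z \<bullet> m = inversion z \<bullet> inversion z"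
      unfolding inversion_inner_self by (simp add: inversion_inner zm)
    ultimately show "\<theta>' x \<in> round_sphere q m T"
      by (simp add: round_sphere_def \<theta>'_def z_def[symmetric])
  qed
  define W where "W = {p\<in>U. \<phi> p \<in> E}"
  have WN: "W \<inter> N = {p\<in>N. \<phi> p \<noteq> q}" by (auto simp: W_def N E_def)
  have \<psi>\<theta>: "\<psi> = (\<lambda>p. \<theta> (\<phi> p))" by (simp add: \<psi> \<theta>_def)
  have preimage: "inv_into U \<phi> (\<theta>' x) \<in> W \<inter> N" "\<phi> (inv_into U \<phi> (\<theta>' x)) = \<theta>' x" if x: "x \<in> span {b1, b2}" for x
  proof -
    have "\<theta>' x \<in> \<phi> ` U" using onto[OF x] S by auto
    then show "\<phi> (inv_into U \<phi> (\<theta>' x)) = \<theta>' x" "inv_into U \<phi> (\<theta>' x) \<in> W \<inter> N"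
      using onto[OF x] by (auto simp: W_def N E_def f_inv_into_f inv_into_into)
  qed
  show image: "\<psi> ` {p\<in>N. \<phi> p \<noteq> q} = span {b1, b2}"
  proof (intro equalityI subsetI)
    fix x assume "x \<in> \<psi> ` {p\<in>N. \<phi> p \<noteq> q}"
    then show "x \<in> span {b1, b2}" using forth by (auto simp: \<psi>\<theta> N)
  next
    fix x assume x: "x \<in> span {b1, b2}"
    show "x \<in> \<psi> ` {p\<in>N. \<phi> p \<noteq> q}"
      by (rule image_eqI[of _ _ "inv_into U \<phi> (\<theta>' x)"]) (use preimage[OF x] WN inv2 in \<open>auto simp: \<psi>\<theta>\<close>)
  qed
  have "\<psi> ` W \<inter> span {b1, b2} \<subseteq> \<psi> ` (W \<inter> N)" "\<psi> ` (W \<inter> N) \<subseteq> \<psi> ` W \<inter> span {b1, b2}"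
    using image WN by auto
  then have "\<psi> ` (W \<inter> N) = \<psi> ` W \<inter> span {b1, b2}" by (rule subset_antisym[rotated])
  moreover have "(W, \<psi>) \<in> maximal_atlas Basis X A" using max by (simp add: W_def \<psi>\<theta>)
  ultimately have "(W \<inter> N, \<psi>) \<in> slice_atlas {b1, b2} X A N" unfolding slice_atlas_def by blast
  then show "({p\<in>N. \<phi> p \<noteq> q}, \<psi>) \<in> slice_atlas {b1, b2} X A N" by (simp add: WN)
  show "inv_into {p\<in>N. \<phi> p \<noteq> q} \<psi> x = inv_into U \<phi> (q + inversion (z1 + L' x))" if x: "x \<in> span {b1, b2}" for x
  proof -
    have "inj_on \<psi> {p\<in>N. \<phi> p \<noteq> q}"
      using chart_inj[OF cU] inv1 by (auto simp: inj_on_def \<psi>\<theta> N) metis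
    moreover have "\<psi> (inv_into U \<phi> (\<theta>' x)) = x" using preimage[OF x] inv2 by (simp add: \<psi>\<theta>)
    moreover have "inv_into U \<phi> (\<theta>' x) \<in> {p\<in>N. \<phi> p \<noteq> q}" using preimage[OF x] WN by simp
    ultimately show ?thesis unfolding \<theta>'_def by (intro inv_into_f_eq)
  qed
qed

section \<open>The hypothesis on spheres expressed in one chart\<close>

locale sphere_analytic =
  fixes M :: "'a topology" and A :: "('a, 'e::euclidean_space) atlas" and f :: "'a \<Rightarrow> real"
    and U :: "'a set" and \<phi> :: "'a \<Rightarrow> 'e"
  assumes man: "analytic_manifold Basis M A" and dim3: "DIM('e) \<ge> 3"
    and sph: "\<And>N B. \<lbrakk>analytic_submanifold B M A N;
           subtopology M N homeomorphic_space top_of_set (sphere (0 :: real^3) 1)\<rbrakk>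
         \<Longrightarrow> analytic_function B (slice_atlas B M A N) f"
    and U: "(U, \<phi>) \<in> A"
begin

definition g where "g y = f (inv_into U \<phi> y)"

lemma atlas: "analytic_atlas Basis M A"
  using man by (simp add: analytic_manifold_def)

lemma chartU: "chart Basis M U \<phi>"
  using atlas U by (auto simp: analytic_atlas_def)

text \<open>The sphere with diameter from \<open>q\<close> to \<open>q + m\<close> lies in the chart
  and is a submanifold by the inversions at both ends of the diameter. The chart from
  \<open>q\<close> then transports the hypothesis to the plane. That \<open>m\<close> lies in the
  span puts the centre of the sphere into its affine space.\<close>

lemma analytic_on_plane_aux:
  fixes v w z1 m q b1 b2 y :: 'e
  assumes b: "b1 \<in> Basis" "b2 \<in> Basis" "b1 \<noteq> b2"
    and vw: "independent {v, w}" "v \<noteq> w"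
    and m: "z1 \<bullet> m = 1" "v \<bullet> m = 0" "w \<bullet> m = 0" "m \<in> span {z1, v, w}"
    and ball: "cball q (norm m) \<subseteq> \<phi> ` U"
    and y: "y \<in> span {b1, b2}"
  shows "real_analytic_at {b1, b2} y (\<lambda>y. g (q + inversion (z1 + ((y \<bullet> b1) *\<^sub>R v + (y \<bullet> b2) *\<^sub>R w))))"
proof -
  define T where "T = span {z1, v, w}"
  define S where "S = round_sphere q m T"
  define N where "N = {p\<in>U. \<phi> p \<in> S}"
  have S: "S \<subseteq> \<phi> ` U" using round_sphere_subset_cball ball unfolding S_def by blast
  obtain L L' where L: "linear L" "linear L'" "\<And>x. L (L' x) = x" "\<And>x. L' (L x) = x" "L' b1 = v" "L' b2 = w"
    by (rule linear_isomorphism_of_pair[OF vw b]) blast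
  define \<psi> where "\<psi> = (\<lambda>p. L (inversion (\<phi> p - q) - z1))"
  define \<psi>2 where "\<psi>2 = (\<lambda>p. L (inversion (\<phi> p - (q + m)) - (- z1)))"
  note c1 = inversion_chart[OF atlas U m(1-3) T_def S[unfolded S_def] N_def[unfolded S_def] L \<psi>_def]
  have m0: "m \<noteq> 0" using m(1) by auto
  have Tneg: "T = span {- z1, v, w}"
  proof -
    have "z1 \<in> span {- z1, v, w}" "- z1 \<in> span {z1, v, w}"
      using span_neg[OF span_base[of "- z1" "{- z1, v, w}"]] span_neg[OF span_base[of z1 "{z1, v, w}"]] by auto
    then show ?thesis unfolding T_def
      by (intro subset_antisym span_minimal) (auto intro: span_base)
  qed
  have S2: "S = round_sphere (q + m) (- m) T"
    unfolding S_def using m(4) by (intro round_sphere_antipode[symmetric]) (auto simp: T_def)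
  have "({p\<in>N. \<phi> p \<noteq> q + m}, \<psi>2) \<in> slice_atlas {b1, b2} M A N"
    by (rule inversion_chart(1)[OF atlas U _ _ _ Tneg S[unfolded S2] N_def[unfolded S2] L \<psi>2_def]) (use m in auto)
  note c2 = this
  have "N \<subseteq> (\<Union>(W, \<psi>)\<in>slice_atlas {b1, b2} M A N. W)"
  proof
    fix p assume "p \<in> N"
    then have "p \<in> {p\<in>N. \<phi> p \<noteq> q} \<or> p \<in> {p\<in>N. \<phi> p \<noteq> q + m}" using m0 by auto
    then show "p \<in> (\<Union>(W, \<psi>)\<in>slice_atlas {b1, b2} M A N. W)"
      using c1(1)[folded S_def N_def] c2 by fast
  qed
  moreover have "(\<Union>(W, \<psi>)\<in>slice_atlas {b1, b2} M A N. W) \<subseteq> N" by (auto simp: slice_atlas_def)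
  moreover have "N \<subseteq> topspace M" using chart_subset[OF chartU] by (auto simp: N_def)
  ultimately have sub: "analytic_submanifold {b1, b2} M A N"
    unfolding analytic_submanifold_def using b by blast
  \<comment> \<open>The functional given by \<open>m\<close> vanishes on \<open>v\<close> and
    \<open>w\<close> but not on \<open>z1\<close>, so the three vectors span a space of dimension
    3.\<close>
  have z1: "z1 \<notin> span {v, w}"
  proof
    assume "z1 \<in> span {v, w}"
    then have "m \<bullet> z1 = 0"
      using span_minimal[of "{v, w}" "{u. m \<bullet> u = 0}"] subspace_hyperplane[of m] m by (auto simp: inner_commute)
    then show False using m(1) by (simp add: inner_commute)
  qed
  then have "independent {z1, v, w}" using vw by (simp add: independent_insert span_base)
  moreover have "z1 \<noteq> v" "z1 \<noteq> w" using z1 by (auto intro: span_base)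
  ultimately have "dim T = 3" unfolding T_def using vw(2) by (simp add: dim_eq_card_independent)
  then have "top_of_set S homeomorphic_space top_of_set (sphere (0 :: real^3) 1)"
    unfolding S_def using m(4) m0 by (intro round_sphere_homeomorphic) (auto simp: T_def)
  moreover have "subtopology M N homeomorphic_space top_of_set S"
  proof -
    have "homeomorphic_map (subtopology (subtopology M U) N) (subtopology (top_of_set (\<phi> ` U)) S) \<phi>"
      by (rule homeomorphic_map_subtopologies[OF chart_homeo[OF chartU]])
         (use S chart_subset[OF chartU] in \<open>auto simp: N_def\<close>)
    moreover have "U \<inter> N = N" "\<phi> ` U \<inter> S = S" using S by (auto simp: N_def)
    ultimately show ?thesis by (simp only: subtopology_subtopology) (rule homeomorphic_map_imp_homeomorphic_space)
  qed
  ultimately have "analytic_function {b1, b2} (slice_atlas {b1, b2} M A N) f"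
    using sph[OF sub] homeomorphic_space_trans by blast
  then have "real_analytic_on {b1, b2} (f \<circ> inv_into {p\<in>N. \<phi> p \<noteq> q} \<psi>) (span {b1, b2})"
    using c1(1,2) unfolding analytic_function_def S_def[symmetric] N_def[symmetric] by fastforce
  from real_analytic_onD[OF _ this y, of 1]
  have an: "real_analytic_at {b1, b2} y (\<lambda>x. f (inv_into {p\<in>N. \<phi> p \<noteq> q} \<psi> x))" using b by simp
  show ?thesis
  proof (rule real_analytic_at_cong[OF _ y an zero_less_one])
    fix x assume x: "x \<in> span {b1, b2}"
    have "x = (\<Sum>b\<in>Basis. (x \<bullet> b) *\<^sub>R b)" by (simp add: euclidean_representation)
    also have "\<dots> = (\<Sum>b\<in>{b1, b2}. (x \<bullet> b) *\<^sub>R b)"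
      using b x span_substd_basis[of "{b1, b2}"] by (intro sum.mono_neutral_right) auto
    finally have "L' x = L' ((x \<bullet> b1) *\<^sub>R b1 + (x \<bullet> b2) *\<^sub>R b2)" using b by simp
    also have "\<dots> = (x \<bullet> b1) *\<^sub>R v + (x \<bullet> b2) *\<^sub>R w"
      using L by (simp add: linear_add linear_scale)
    finally show "f (inv_into {p\<in>N. \<phi> p \<noteq> q} \<psi> x) =
        g (q + inversion (z1 + ((x \<bullet> b1) *\<^sub>R v + (x \<bullet> b2) *\<^sub>R w)))"
      using c1(3)[OF x] by (simp add: g_def N_def S_def)
  qed (use b in auto)
qed

text \<open>Projecting \<open>m\<close> orthogonally onto the span changes none of its products with
  \<open>z1\<close>, \<open>v\<close> and \<open>w\<close> and does not increase its norm, so any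
  normal vector of controlled length will do.\<close>

lemma analytic_on_plane:
  fixes v w z1 m q b1 b2 y :: 'e
  assumes b: "b1 \<in> Basis" "b2 \<in> Basis" "b1 \<noteq> b2"
    and vw: "independent {v, w}" "v \<noteq> w"
    and m: "z1 \<bullet> m = 1" "v \<bullet> m = 0" "w \<bullet> m = 0"
    and ball: "cball q (norm m) \<subseteq> \<phi> ` U"
    and y: "y \<in> span {b1, b2}"
  shows "real_analytic_at {b1, b2} y (\<lambda>y. g (q + inversion (z1 + ((y \<bullet> b1) *\<^sub>R v + (y \<bullet> b2) *\<^sub>R w))))"
proof -
  obtain m0 m1 where m0: "m0 \<in> span {z1, v, w}" and m1: "\<And>u. u \<in> span {z1, v, w} \<Longrightarrow> orthogonal m1 u"
    and meq: "m = m0 + m1"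
    using orthogonal_subspace_decomp_exists[of "{z1, v, w}" m] by blast
  have eq: "u \<bullet> m0 = u \<bullet> m" if "u \<in> {z1, v, w}" for u
    using m1[OF span_base[OF that]] by (simp add: meq inner_add_right orthogonal_def inner_commute)
  have "norm m0 ^ 2 \<le> norm m ^ 2"
    using norm_add_Pythagorean[of m0 m1] m1[OF m0] by (simp add: meq orthogonal_commute)
  then have "norm m0 \<le> norm m" by (rule power2_le_imp_le) simp
  then have "cball q (norm m0) \<subseteq> \<phi> ` U" using ball by (meson order_trans subset_cball)
  then show ?thesis
    using m0 eq m by (intro analytic_on_plane_aux[OF b vw, where m = m0] y) auto
qed

end

section \<open>Extension and propagation\<close>

lemma exists_unit_orthogonal:
  fixes a b :: "'e::euclidean_space"
  assumes "DIM('e) \<ge> 3"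
  obtains w where "norm w = 1" "w \<bullet> a = 0" "w \<bullet> b = 0"
proof -
  have "dim {a, b} \<le> card {a, b}" by (rule dim_le_card') simp
  also have "\<dots> \<le> 2" by (simp add: card_insert_if)
  finally have "dim {a, b} < DIM('e)" using assms by simp
  then obtain x where x: "x \<noteq> 0" "\<And>y. y \<in> span {a, b} \<Longrightarrow> orthogonal x y"
    by (rule orthogonal_to_subspace_exists) blast
  have "x \<bullet> a = 0" "x \<bullet> b = 0" using x(2) by (auto simp: orthogonal_def span_base)
  then show ?thesis using that[of "sgn x"] x(1) by (simp add: norm_sgn sgn_div_norm)
qed

lemma exists_other_basis_vectors:
  fixes b :: "'e::euclidean_space"
  assumes "DIM('e) \<ge> 3"
  obtains b1 b2 where "b1 \<in> Basis" "b2 \<in> Basis" "b1 \<noteq> b2" "b1 \<noteq> b" "b2 \<noteq> b"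
proof -
  have "DIM('e) \<le> card (Basis - {b}) + 1" using card_Diff1_le[of Basis b] by (simp add: card_Diff_singleton_if)
  then have "card (Basis - {b}) \<ge> 2" using assms by linarith
  then obtain S where S: "S \<subseteq> Basis - {b}" "card S = 2" by (meson obtain_subset_with_card_n)
  then obtain b1 b2 where "S = {b1, b2}" "b1 \<noteq> b2" by (meson card_2_iff)
  then show ?thesis using S that by auto
qed

context sphere_analytic
begin

text \<open>The points \<open>a\<close> and \<open>y\<close> lie on a small sphere, one of whose diameters joins them;
  inversion at a third point of it turns an arc from \<open>a\<close> to \<open>y\<close> into a segment.\<close>

lemma equality_propagates:
  assumes G: "\<And>y. y \<in> ball x0 r \<Longrightarrow> real_analytic_at Basis y G" and r: "ball x0 r \<subseteq> \<phi> ` U"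
    and V: "open V" "a \<in> V" "\<And>y. y \<in> V \<Longrightarrow> g y = G y"
    and a: "a \<in> ball x0 (r / 5)" and y: "y \<in> ball x0 (r / 5)" and "y \<noteq> a"
  shows "g y = G y"
proof -
  define d where "d = y - a"
  have d: "d \<noteq> 0" using \<open>y \<noteq> a\<close> by (simp add: d_def)
  obtain u where u: "norm u = 1" "u \<bullet> d = 0" by (rule exists_unit_orthogonal[OF dim3, of d d]) blast
  obtain w where w: "norm w = 1" "w \<bullet> d = 0" "w \<bullet> u = 0" by (rule exists_unit_orthogonal[OF dim3, of d u]) blast
  obtain b1 b2 :: 'e where b: "b1 \<in> Basis" "b2 \<in> Basis" "b1 \<noteq> b2"
    by (rule exists_other_basis_vectors[OF dim3]) blast
  \<comment> \<open>The centre of inversion lies on the sphere with diameter from \<open>a\<close>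
    to \<open>y\<close>, in the direction \<open>u\<close> perpendicular to that diameter;
    \<open>q + m\<close> is its antipode. The vector \<open>w\<close> supplies the remaining
    direction of the sphere.\<close>
  define q where "q = (1/2) *\<^sub>R (a + y) + (norm d / 2) *\<^sub>R u"
  define m where "m = - norm d *\<^sub>R u"
  have oq: "a - q = - (1/2) *\<^sub>R d - (norm d / 2) *\<^sub>R u" and yq: "y - q = (1/2) *\<^sub>R d - (norm d / 2) *\<^sub>R u"
    unfolding q_def d_def by (simp_all add: algebra_simps flip: scaleR_add_left)
  have uu: "u \<bullet> u = 1" using u by (simp add: dot_square_norm)
  have nd: "norm d * norm d = d \<bullet> d" by (simp add: dot_square_norm power2_eq_square)
  have du: "d \<bullet> u = 0" using u by (simp add: inner_commute)
  have ooq: "(a - q) \<bullet> (a - q) = (d \<bullet> d) / 2" and yyq: "(y - q) \<bullet> (y - q) = (d \<bullet> d) / 2"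
    unfolding oq yq using u uu du nd
    by (simp_all add: inner_diff_left inner_diff_right inner_add_left inner_add_right)
  define z1 where "z1 = inversion (a - q)"
  define v where "v = inversion (y - q) - z1"
  have v: "v = (2 / (d \<bullet> d)) *\<^sub>R d"
    unfolding v_def z1_def inversion_def ooq yyq unfolding scaleR_diff_right[symmetric] by (simp add: d_def)
  have m: "z1 \<bullet> m = 1" "v \<bullet> m = 0" "w \<bullet> m = 0"
    unfolding z1_def inversion_inner ooq using d w du uu nd
    by (simp_all add: oq v m_def inner_diff_left inner_add_left)
  have v0: "v \<noteq> 0" using d by (simp add: v)
  have wv: "w \<bullet> v = 0" using w by (simp add: v)
  have vw: "v \<noteq> w" using wv w by auto
  have "independent {v, w}"
    by (rule pairwise_orthogonal_independent) (use v0 w wv in \<open>auto simp: pairwise_insert orthogonal_def inner_commute\<close>)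
  note ind = this vw
  \<comment> \<open>The factor 5: \<open>a\<close> and \<open>y\<close> are less than
    \<open>2 * r / 5\<close> apart and \<open>q\<close> is within \<open>2 * r / 5\<close> of
    \<open>x0\<close>, so the ball that contains the sphere stays within
    \<open>4 * r / 5\<close>.\<close>
  have ndr: "norm d < 2 * r / 5"
    using a y dist_triangle[of y a x0] by (simp add: d_def dist_norm[symmetric] dist_commute)
  have qx0: "dist x0 q \<le> 2 * r / 5"
  proof -
    have x0q: "x0 - q = (1/2) *\<^sub>R (x0 - a) + (1/2) *\<^sub>R (x0 - y) - (norm d / 2) *\<^sub>R u"
      unfolding q_def by (simp add: algebra_simps) (simp flip: scaleR_add_left)
    have "norm (x0 - q) \<le> norm ((1/2) *\<^sub>R (x0 - a)) + norm ((1/2) *\<^sub>R (x0 - y)) + norm ((norm d / 2) *\<^sub>R u)"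
      unfolding x0q using norm_triangle_ineq4[of "(1/2) *\<^sub>R (x0 - a) + (1/2) *\<^sub>R (x0 - y)" "(norm d / 2) *\<^sub>R u"]
        norm_triangle_ineq[of "(1/2) *\<^sub>R (x0 - a)" "(1/2) *\<^sub>R (x0 - y)"] by linarith
    then show ?thesis using a y u ndr by (simp add: dist_norm)
  qed
  have nm: "norm m = norm d" by (simp add: m_def u)
  have cb: "cball q (norm m) \<subseteq> ball x0 r"
  proof
    fix x assume "x \<in> cball q (norm m)"
    then have "dist q x \<le> norm d" by (simp add: nm)
    then show "x \<in> ball x0 r" unfolding mem_ball using dist_triangle[of x0 x q] qx0 ndr norm_ge_zero[of d] by linarith
  qed
  then have cbU: "cball q (norm m) \<subseteq> \<phi> ` U" using r by blast
  \<comment> \<open>The segment from \<open>z1\<close> to \<open>z1 + v\<close> is the inverted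
    image of an arc of the sphere from \<open>a\<close> to \<open>y\<close>.\<close>
  define c where "c t = q + inversion (z1 + t *\<^sub>R v)" for t
  have zm: "(z1 + t *\<^sub>R v) \<bullet> m = 1" for t using m by (simp add: inner_add_left)
  then have z0: "z1 + t *\<^sub>R v \<noteq> 0" for t by (metis inner_zero_left zero_neq_one)
  have c_ball: "c t \<in> ball x0 r" for t
  proof -
    have "1 \<le> norm (z1 + t *\<^sub>R v) * norm m" using norm_cauchy_schwarz[of "z1 + t *\<^sub>R v" m] zm by simp
    then have "norm (inversion (z1 + t *\<^sub>R v)) \<le> norm m"
      using z0[of t] by (simp add: inversion_def dot_square_norm power2_eq_square divide_simps mult.commute)
    then have "c t \<in> cball q (norm m)" by (simp add: c_def dist_norm)
    then show ?thesis using cb by blast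
  qed
  have c0: "c 0 = a" and c1: "c 1 = y" by (simp_all add: c_def z1_def v_def)
  have c_an: "analytic_map_at Basis t c" for t
    unfolding c_def[abs_def]
  proof (intro analytic_map_at_add_const(1))
    have "analytic_map_at Basis t (\<lambda>t. z1 + t *\<^sub>R v)"
      using span_Basis[where 'a = real]
      by (intro analytic_map_at_add_const(1) analytic_map_at_linear) (auto intro: linearI simp: scaleR_add_left)
    then show "analytic_map_at Basis t (\<lambda>t. inversion (z1 + t *\<^sub>R v))"
      using span_Basis[where 'a = real]
      by (intro analytic_map_at_compose[where \<theta> = "\<lambda>t. z1 + t *\<^sub>R v" and \<eta> = inversion] analytic_inversion z0) auto
  qed (use span_Basis[where 'a = real] in auto)
  have gc: "real_analytic_at Basis t (\<lambda>t. g (c t))" for t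
  proof -
    have bb: "b1 \<bullet> b1 = 1" "b1 \<bullet> b2 = 0" using b by (auto simp: inner_Basis)
    \<comment> \<open>Restricting the parameter plane to its first axis leaves only the direction
      \<open>v\<close>, that is, the curve \<open>c\<close>.\<close>
    have "real_analytic_at Basis t
        (\<lambda>t. g (q + inversion (z1 + (((t *\<^sub>R b1) \<bullet> b1) *\<^sub>R v + ((t *\<^sub>R b1) \<bullet> b2) *\<^sub>R w))))"
    proof (rule real_analytic_at_compose[where B' = "{b1, b2}" and d = 1 and \<theta> = "\<lambda>t. t *\<^sub>R b1"])
      show "real_analytic_at {b1, b2} (t *\<^sub>R b1)
          (\<lambda>y. g (q + inversion (z1 + ((y \<bullet> b1) *\<^sub>R v + (y \<bullet> b2) *\<^sub>R w))))"
        by (rule analytic_on_plane[OF b ind m cbU]) (auto intro: span_scale span_base)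
      show "real_analytic_at Basis t (\<lambda>t. (t *\<^sub>R b1) \<bullet> b)" if "b \<in> {b1, b2}" for b
        using real_analytic_at_inner[of Basis t "b1 \<bullet> b"] span_Basis[where 'a = real] by auto
      show "t *\<^sub>R b1 \<in> span {b1, b2}" for t by (auto intro: span_scale span_base)
    qed (use b span_Basis[where 'a = real] in auto)
    then show ?thesis by (simp add: c_def bb)
  qed
  have "continuous_on UNIV c"
    unfolding c_def[abs_def]
    by (intro continuous_intros continuous_on_compose2[OF continuous_on_inversion, of _ "\<lambda>t. z1 + t *\<^sub>R v"])
       (use z0 in auto)
  then have "open (c -` V)" using V(1) open_vimage by blast
  moreover have "0 \<in> c -` V" using c0 V(2) by simp
  ultimately obtain \<delta> where \<delta>: "\<delta> > 0" "ball 0 \<delta> \<subseteq> c -` V" by (rule openE)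
  have "g (c 1) - G (c 1) = 0"
  proof (rule real_analytic_zero_interval[where g = "\<lambda>t. g (c t) - G (c t)" and \<delta> = \<delta>])
    show "real_analytic_at Basis t (\<lambda>t. g (c t) - G (c t))" for t
      using span_Basis[where 'a = real]
      by (intro real_analytic_at_diff gc real_analytic_at_compose_map[OF _ _ c_an] G c_ball) auto
    show "g (c t) - G (c t) = 0" if "0 \<le> t" "t < \<delta>" for t
    proof -
      have "t \<in> ball 0 \<delta>" using that by simp
      then have "c t \<in> V" using \<delta>(2) by blast
      then show ?thesis using V(3) by simp
    qed
  qed (rule \<delta>(1))
  then show ?thesis by (simp add: c1)
qed

text \<open>Since \<open>v \<bullet> b'\<close> stays away from \<open>v \<bullet> b''\<close>, the vector \<open>m\<close> can be chosen in the plane of \<open>b'\<close> and \<open>b''\<close>.\<close>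

lemma bounded_normal_vector:
  fixes v b :: 'e and l :: "'e \<Rightarrow> nat"
  assumes l: "bij_betw l Basis {0..<DIM('e)}" and v: "\<And>b. b \<in> Basis \<Longrightarrow> \<bar>v \<bullet> b - real (l b)\<bar> < 1/4"
    and b: "b \<in> Basis"
  obtains m where "m \<bullet> v = 0" "m \<bullet> b = 0" "m \<bullet> (\<Sum>Basis) = 1" "norm m \<le> 4 * DIM('e)"
    and "independent {v, b}" "v \<noteq> b"
proof -
  obtain b1 b2 :: 'e where b12: "b1 \<in> Basis" "b2 \<in> Basis" "b1 \<noteq> b2" "b1 \<noteq> b" "b2 \<noteq> b"
    by (rule exists_other_basis_vectors[OF dim3]) blast
  define D where "D = v \<bullet> b2 - v \<bullet> b1"
  have "l b1 \<noteq> l b2" using l b12 by (auto simp: bij_betw_def inj_on_def)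
  \<comment> \<open>Distinct labels differ by at least 1 and the coordinates of \<open>v\<close> are
    within 1/4 of them, so the two coordinates differ by at least 1/2.\<close>
  then have "\<bar>real (l b2) - real (l b1)\<bar> \<ge> 1" by linarith
  then have D: "\<bar>D\<bar> \<ge> 1/2" using v[OF b12(1)] v[OF b12(2)] unfolding D_def by linarith
  have bd: "\<bar>v \<bullet> b'\<bar> \<le> DIM('e)" if "b' \<in> Basis" for b'
  proof -
    have "l b' < DIM('e)" using l that by (auto simp: bij_betw_def)
    then have "real (l b') + 1 \<le> DIM('e)" by linarith
    then show ?thesis using v[OF that] by linarith
  qed
  \<comment> \<open>Within the plane of \<open>b1\<close> and \<open>b2\<close> this solves the two
    linear equations for orthogonality to \<open>v\<close> and product 1 with the sum of the basis;
    \<open>D\<close> is their determinant. Its lower bound gives each coefficient size at most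
    \<open>2 * DIM('e)\<close>.\<close>
  define m where "m = (v \<bullet> b2 / D) *\<^sub>R b1 - (v \<bullet> b1 / D) *\<^sub>R b2"
  have D0: "D \<noteq> 0" using D by auto
  have "b1 \<bullet> (\<Sum>Basis) = 1" "b2 \<bullet> (\<Sum>Basis) = 1" using b12 by (auto simp: inner_sum_right inner_Basis)
  then have "m \<bullet> (\<Sum>Basis) = 1" using D0 by (simp add: m_def inner_diff_left flip: diff_divide_distrib) (simp add: D_def)
  moreover have "m \<bullet> v = 0" by (simp add: m_def inner_diff_right inner_commute[of _ v])
  moreover have "m \<bullet> b = 0" using b12 b by (simp add: m_def inner_diff_left inner_Basis)
  moreover have "norm m \<le> 4 * DIM('e)"
  proof -
    have q: "\<bar>v \<bullet> b' / D\<bar> \<le> 2 * DIM('e)" if "b' \<in> Basis" for b'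
    proof -
      have "\<bar>v \<bullet> b'\<bar> / \<bar>D\<bar> \<le> DIM('e) / (1/2)" using bd[OF that] D by (intro frac_le) auto
      then show ?thesis by simp
    qed
    have "norm m \<le> \<bar>v \<bullet> b2 / D\<bar> + \<bar>v \<bullet> b1 / D\<bar>"
      unfolding m_def by (rule order_trans[OF norm_triangle_ineq4]) (use b12 in simp)
    then show ?thesis using q[OF b12(1)] q[OF b12(2)] by simp
  qed
  moreover have notin: "v \<notin> span {b}"
  proof
    assume "v \<in> span {b}"
    then obtain k where "v = k *\<^sub>R b" by (auto simp: span_singleton)
    then have "D = 0" using b12 b by (simp add: D_def inner_Basis)
    with D0 show False by simp
  qed
  then have "v \<noteq> b" by (auto intro: span_base)
  moreover have "independent {v, b}" using notin b by (simp add: independent_insert nonzero_Basis)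
  ultimately show ?thesis using that by blast
qed

text \<open>Inversion at \<open>q\<close> is analytic around \<open>x0\<close>, so the extension
  found at 0 pulls back to a function \<open>G\<close> analytic on a full neighbourhood of
  \<open>x0\<close>. Agreement with \<open>g\<close> is obtained only on open sets arbitrarily close
  to \<open>x0\<close>.\<close>

lemma local_extension:
  assumes x0: "x0 \<in> \<phi> ` U"
  obtains G r where "r > 0" "ball x0 r \<subseteq> \<phi> ` U" "\<And>y. y \<in> ball x0 r \<Longrightarrow> real_analytic_at Basis y G"
    and "\<And>\<epsilon>. \<epsilon> > 0 \<Longrightarrow> \<exists>V. open V \<and> V \<noteq> {} \<and> V \<subseteq> ball x0 \<epsilon> \<and> (\<forall>y\<in>V. g y = G y)"
proof -
  obtain R0 where R0: "R0 > 0" "cball x0 R0 \<subseteq> \<phi> ` U"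
    using chart_open[OF chartU] x0 open_contains_cball by blast
  define R where "R = R0 / 2"
  have R: "R > 0" using R0 by (simp add: R_def)
  define n where "n = real DIM('e)"
  have n: "n \<ge> 3" using dim3 by (simp add: n_def)
  define e :: 'e where "e = \<Sum>Basis"
  have ee: "e \<bullet> e = n" by (simp add: e_def n_def inner_sum_left inner_sum_right inner_Basis)
  have ne: "norm e \<le> n"
  proof -
    have "norm e \<le> (\<Sum>b\<in>Basis. norm (b::'e))" unfolding e_def by (rule norm_sum)
    then show ?thesis by (simp add: n_def)
  qed
  \<comment> \<open>The normal vectors used below have norm at most \<open>4 * n\<close>, and
    normalizing them against \<open>z0\<close> multiplies by \<open>\<epsilon> * n\<close>. This
    choice makes the resulting bound exactly \<open>R\<close>, and also places \<open>q\<close>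
    within \<open>R\<close> of \<open>x0\<close>.\<close>
  define \<epsilon> where "\<epsilon> = R / (4 * n * n)"
  have \<epsilon>: "\<epsilon> > 0" using R n by (simp add: \<epsilon>_def)
  have \<epsilon>R: "\<epsilon> * (4 * n * n) = R" using n by (simp add: \<epsilon>_def)
  have e0: "e \<noteq> 0" using ee n by auto
  define q where "q = x0 - \<epsilon> *\<^sub>R e"
  define z0 where "z0 = inversion (\<epsilon> *\<^sub>R e)"
  have z0: "z0 \<noteq> 0" using e0 \<epsilon> by (simp add: z0_def)
  have "norm (\<epsilon> *\<^sub>R e) \<le> R"
  proof -
    have "norm (\<epsilon> *\<^sub>R e) \<le> \<epsilon> * n" using ne \<epsilon> by simp
    also have "\<dots> \<le> \<epsilon> * (4 * n * n)" using n \<epsilon> by (intro mult_left_mono) auto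
    finally show ?thesis using \<epsilon>R by simp
  qed
  then have "dist x0 q \<le> R" by (simp add: q_def dist_norm)
  then have "cball q R \<subseteq> cball x0 R0" 
    using order_trans[OF dist_triangle[of x0 _ q]] by (intro subsetI) (fastforce simp: R_def)
  then have cbq: "cball q R \<subseteq> \<phi> ` U" using R0(2) by blast
  obtain b1 b2 :: 'e where b: "b1 \<in> Basis" "b2 \<in> Basis" "b1 \<noteq> b2"
    by (rule exists_other_basis_vectors[OF dim3]) blast
  obtain l :: "'e \<Rightarrow> nat" where l: "bij_betw l Basis {0..<DIM('e)}"
    using ex_bij_betw_finite_nat[of "Basis :: 'e set"] by auto
  \<comment> \<open>Each direction in \<open>V\<close> has coordinates close to distinct integers,
    hence stays away from the diagonal \<open>e\<close>, along which \<open>q\<close> and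
    \<open>z0\<close> were placed.\<close>
  define V where "V = (\<Inter>b\<in>Basis. {v::'e. \<bar>v \<bullet> b - real (l b)\<bar> < 1/4})"
  define h where "h x = g (q + inversion (z0 + x))" for x
  interpret analytic_on_planes h V b1 b2
  proof
    show "open V" unfolding V_def by (intro open_INT ballI open_Collect_less continuous_intros) auto
    fix v b' y :: 'e assume v: "v \<in> V" and b': "b' \<in> Basis" and y: "y \<in> span {b1, b2}"
    obtain m where m: "m \<bullet> v = 0" "m \<bullet> b' = 0" "m \<bullet> (\<Sum>Basis) = 1" "norm m \<le> 4 * DIM('e)"
        "independent {v, b'}" "v \<noteq> b'"
      by (rule bounded_normal_vector[OF l _ b', of v]) (use v in \<open>auto simp: V_def\<close>)
    let ?m = "(\<epsilon> * n) *\<^sub>R m"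
    show "real_analytic_at {b1, b2} y (\<lambda>y. h ((y \<bullet> b1) *\<^sub>R v + (y \<bullet> b2) *\<^sub>R b'))"
      unfolding h_def
    proof (rule analytic_on_plane[OF b m(5,6), where m = ?m])
      \<comment> \<open>Since \<open>z0\<close> is \<open>e\<close> divided by
        \<open>\<epsilon> * n\<close>, the factor in \<open>?m\<close> cancels and leaves the
        product of \<open>e\<close> and \<open>m\<close>.\<close>
      show "z0 \<bullet> ?m = 1"
        using \<epsilon> n ee m(3) by (simp add: z0_def inversion_inner e_def[symmetric] inner_commute[of e m])
      have "norm ?m \<le> \<epsilon> * n * (4 * n)"
        using m(4) \<epsilon> n by (simp add: n_def)
      then have "norm ?m \<le> R" using \<epsilon>R by (simp add: mult_ac)
      then show "cball q (norm ?m) \<subseteq> \<phi> ` U" using cbq by (meson order_trans subset_cball)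
    qed (use m y in \<open>auto simp: inner_commute\<close>)
  qed (use b in auto)
  have "(\<Sum>b\<in>Basis. real (l b) *\<^sub>R b) \<in> V" by (simp add: V_def)
  then have "V \<noteq> {}" by blast
  then obtain F \<rho> K where \<rho>: "\<rho> > 0"
    and F: "pseries Basis (coord_box Basis 0 \<rho>) (\<lambda>b x. (x - 0) \<bullet> b) \<rho> K F"
    and hF: "\<And>\<epsilon>. \<epsilon> > 0 \<Longrightarrow> \<exists>U. open U \<and> U \<noteq> {} \<and> U \<subseteq> ball 0 \<epsilon> \<and> (\<forall>x\<in>U. h x = F x)"
    by (rule analytic_extension) blast
  define \<theta> where "\<theta> y = inversion (y - q) - z0" for y
  define G where "G y = F (\<theta> y)" for y
  have cont\<theta>: "continuous_on (- {q}) \<theta>"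
    unfolding \<theta>_def
    by (intro continuous_intros continuous_on_compose2[OF continuous_on_inversion, of _ "\<lambda>y. y - q"]) auto
  have open_pre: "open (- {q} \<inter> \<theta> -` W)" if "open W" for W
    using cont\<theta> that by (intro continuous_open_preimage) auto
  have \<theta>x0: "\<theta> x0 = 0" by (simp add: \<theta>_def q_def z0_def)
  have x0q: "x0 \<noteq> q" using e0 \<epsilon> by (simp add: q_def)
  define D where "D = (- {q} \<inter> \<theta> -` ball 0 \<rho>) \<inter> ball x0 R"
  have "open D" "x0 \<in> D" unfolding D_def using open_pre[of "ball 0 \<rho>"] x0q \<theta>x0 \<rho> R by auto
  then obtain r where r: "r > 0" "ball x0 r \<subseteq> D" by (rule openE)
  have GD: "real_analytic_at Basis y G" if y: "y \<in> D" for y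
  proof -
    have yq: "y \<noteq> q" and small: "norm (\<theta> y) < \<rho>" using y by (auto simp: D_def)
    have "analytic_map_at Basis y (\<lambda>y. y - q)"
      by (intro analytic_map_at_add_const analytic_map_at_linear linear_ident) auto
    then have "analytic_map_at Basis y (\<lambda>y. inversion (y - q))"
      using yq by (intro analytic_map_at_compose[where \<theta> = "\<lambda>y. y - q" and \<eta> = inversion] analytic_inversion) auto
    then have an\<theta>: "analytic_map_at Basis y \<theta>" unfolding \<theta>_def by (intro analytic_map_at_add_const) auto
    have "real_analytic_at Basis (\<theta> y) F"
    proof (rule pseries_imp_real_analytic_at[OF F])
      show "\<bar>(\<theta> y - 0) \<bullet> b\<bar> < \<rho>" if "b \<in> Basis" for b
        using Basis_le_norm[OF that, of "\<theta> y"] small by simp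
    qed
    then show ?thesis unfolding G_def using an\<theta> by (intro real_analytic_at_compose_map[where \<theta> = \<theta>]) auto
  qed
  show ?thesis
  proof (rule that[OF r(1)])
    have "ball x0 R \<subseteq> \<phi> ` U" using R0 by (force simp: R_def)
    then show "ball x0 r \<subseteq> \<phi> ` U" using r(2) by (auto simp: D_def)
    show "real_analytic_at Basis y G" if "y \<in> ball x0 r" for y using GD r(2) that by blast
    fix \<eta> :: real assume \<eta>: "\<eta> > 0"
    \<comment> \<open>The inverse of \<open>\<theta>\<close> is continuous at 0, so a set of
      agreement close enough to 0 corresponds to points within \<open>\<eta>\<close> of
      \<open>x0\<close>.\<close>
    define \<theta>' where "\<theta>' x = q + inversion (z0 + x)" for x
    have "continuous_on (- {- z0}) \<theta>'"
      unfolding \<theta>'_def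
      by (intro continuous_intros continuous_on_compose2[OF continuous_on_inversion, of _ "\<lambda>x. z0 + x"])
         (auto simp: add_eq_0_iff)
    then have "open (- {- z0} \<inter> \<theta>' -` ball x0 \<eta>)" by (intro continuous_open_preimage) auto
    moreover have "0 \<in> - {- z0} \<inter> \<theta>' -` ball x0 \<eta>" using z0 \<eta> by (simp add: \<theta>'_def z0_def q_def)
    ultimately obtain s where s: "s > 0" "ball 0 s \<subseteq> - {- z0} \<inter> \<theta>' -` ball x0 \<eta>" by (rule openE)
    obtain W where W: "open W" "W \<noteq> {}" "W \<subseteq> ball 0 s" "\<forall>x\<in>W. h x = F x" using hF[OF s(1)] by blast
    show "\<exists>V. open V \<and> V \<noteq> {} \<and> V \<subseteq> ball x0 \<eta> \<and> (\<forall>y\<in>V. g y = G y)"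
    proof (intro exI[of _ "(- {q} \<inter> \<theta> -` W) \<inter> ball x0 \<eta>"] conjI ballI)
      show "open (- {q} \<inter> \<theta> -` W \<inter> ball x0 \<eta>)" using open_pre[OF W(1)] by blast
      obtain x where x: "x \<in> W" using W(2) by blast
      then have "x \<noteq> - z0" "\<theta>' x \<in> ball x0 \<eta>" using W(3) s(2) by auto
      moreover from this(1) have "\<theta>' x \<noteq> q" by (simp add: \<theta>'_def add_eq_0_iff)
      moreover have "\<theta> (\<theta>' x) = x" by (simp add: \<theta>_def \<theta>'_def)
      ultimately have "\<theta>' x \<in> - {q} \<inter> \<theta> -` W \<inter> ball x0 \<eta>" using x by simp
      then show "- {q} \<inter> \<theta> -` W \<inter> ball x0 \<eta> \<noteq> {}" by blast
      fix y assume "y \<in> - {q} \<inter> \<theta> -` W \<inter> ball x0 \<eta>"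
      then have "h (\<theta> y) = F (\<theta> y)" using W(4) by auto
      then show "g y = G y" by (simp add: h_def G_def \<theta>_def)
    qed auto
  qed
qed

text \<open>The open set of agreement is chosen within \<open>r / 5\<close> of the base point, so
  every other point of that ball can be joined to one of its points \<open>a\<close> by a sphere on
  which both functions are analytic. Then \<open>g\<close> is equal to \<open>G\<close> on a whole
  neighbourhood.\<close>

lemma real_analytic_on_chart: "real_analytic_on Basis (f \<circ> inv_into U \<phi>) (\<phi> ` U)"
proof (rule real_analytic_onI)
  show "openin (top_of_set (span Basis)) (\<phi> ` U)"
    using chart_open[OF chartU] by (simp only: open_iff_openin_span_Basis)
  fix x0 :: 'e and b :: real assume x0: "x0 \<in> \<phi> ` U" and b: "b \<in> Basis"
  obtain G r where r: "r > 0" "ball x0 r \<subseteq> \<phi> ` U" and G: "\<And>y. y \<in> ball x0 r \<Longrightarrow> real_analytic_at Basis y G"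
    and eq: "\<And>\<epsilon>. \<epsilon> > 0 \<Longrightarrow> \<exists>V. open V \<and> V \<noteq> {} \<and> V \<subseteq> ball x0 \<epsilon> \<and> (\<forall>y\<in>V. g y = G y)"
    by (rule local_extension[OF x0]) blast
  have r5: "r / 5 > 0" using r by simp
  obtain V where V: "open V" "V \<noteq> {}" "V \<subseteq> ball x0 (r / 5)" "\<forall>y\<in>V. g y = G y" using eq[OF r5] by blast
  then obtain a where a: "a \<in> V" by blast
  have gG: "g y = G y" if y: "y \<in> ball x0 (r / 5)" for y
  proof (cases "y = a")
    case True
    then show ?thesis using V(4) a by blast
  next
    case False
    then show ?thesis using equality_propagates[OF G r(2) V(1) a _ _ y] V a by blast
  qed
  have "real_analytic_at Basis x0 g"
    by (rule real_analytic_at_cong[OF order_refl _ G r5]) (use r gG in auto)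
  then show "real_analytic_at Basis x0 (\<lambda>x. (f \<circ> inv_into U \<phi>) x \<bullet> b)"
    using b by (simp add: g_def[abs_def])
qed auto

end

theorem theorem1:
  fixes M :: "'a topology"
    and A :: "('a, 'e::euclidean_space) atlas"
    and f :: "'a \<Rightarrow> real"
  assumes "analytic_manifold Basis M A"
    and "DIM('e) \<ge> 3"
    and "\<And>N B. \<lbrakk>analytic_submanifold B M A N;
           subtopology M N homeomorphic_space top_of_set (sphere (0 :: real^3) 1)\<rbrakk>
         \<Longrightarrow> analytic_function B (slice_atlas B M A N) f"
  shows "analytic_function Basis A f"
  unfolding analytic_function_def
proof clarify
  fix U \<phi> assume "(U, \<phi>) \<in> A"
  with assms interpret sphere_analytic M A f U \<phi> by unfold_locales
  show "real_analytic_on Basis (f \<circ> inv_into U \<phi>) (\<phi> ` U)" by (rule real_analytic_on_chart)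
qed

end
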